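(* Let $K$ be a PAC field, let $V=\mathrm{Spec}(R)$ be an absolutely irreducible smooth affine $K$-variety, let $f(X)\in R[X]$ be a separable monic polynomial, and let $P$ be a partition of $\deg f$. Assume that the geometric embedding problem $\mathcal{E}(f,V)$ associated to $f$ has a solution whose orbit type is $P$. Then there exists a Zariski dense set of $\mathfrak{p}\in V(K)$ such that $f\bmod\mathfrak{p}$ is a separable polynomial of factorization type $P$.
   Context: A field $K$ is PAC if $V(K)\neq\emptyset$ for every non-empty absolutely irreducible $K$-variety $V$. Fix an algebraic closure $\tilde K$ of $K$ and let $\textnormal{Gal}(K)$ be the absolute Galois group. Let $E$ be the function field of $V$, let $F$ be the splitting field of $f$ over $E$, and let $L=F\cap\tilde K$ (a finite Galois extension of $K$). Let $\alpha:\textnormal{Gal}(F/E)\to\textnormal{Gal}(L/K)$ and $\pi:\textnormal{Gal}(K)\to\textnormal{Gal}(L/K)$ be the restriction maps. The embedding problem $\mathcal{E}(f,V)$ is the pair $(\pi,\alpha)$; a solution of it is a continuous homomorphism $\theta:\textnormal{Gal}(K)\to\textnormal{Gal}(F/E)$ with $\alpha\circ\theta=\pi$. The orbit type of a solution $\theta$ is the partition of $\deg f$ given by the lengths of the orbits of $\theta(\textnormal{Gal}(K))$ on the set of roots of $f$ in $F$. For $\mathfrak{p}\in V(K)$ (a maximal ideal of $R$ with residue field $K$), $f\bmod\mathfrak{p}\in K[X]$ is obtained by reducing the coefficients. The factorization type of a separable polynomial is the partition of its degree given by the degrees of its irreducible factors. *)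

theory Defs
  imports
    "HOL-Analysis.Abstract_Topology"
    "HOL-Library.Poly_Mapping"
    "HOL-Library.Extended_Nat"
    "HOL-Algebra.Algebraic_Closure_Type"
    "HOL-Algebra.Generated_Fields"
    "HOL-Algebra.Group_Action"
    "HOL-Algebra.Bij"
    "Jordan_Normal_Form.DL_Rank"
begin

section \<open>Polynomials in several variables\<close>

text \<open>A monomial is a finitely supported exponent vector; the polynomial ring in
  X_0, ..., X_(n-1) is cut out of the polynomials in all the variables X_i, i a natural number.\<close>

type_synonym 'a mpoly = "(nat \<Rightarrow>\<^sub>0 nat) \<Rightarrow>\<^sub>0 'a"

definition mpoly_ring :: "nat \<Rightarrow> 'a::comm_ring_1 mpoly ring" where
  "mpoly_ring n =
     ring_of_type_algebra \<lparr>carrier := {p. \<forall>m\<in>Poly_Mapping.keys p. Poly_Mapping.keys m \<subseteq> {..<n}}\<rparr>"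

text \<open>Evaluation at \<^term>\<open>a\<close>, the coefficients being mapped by \<^term>\<open>h\<close>.\<close>

definition mpoly_eval ::
  "('a::zero \<Rightarrow> 'b::comm_ring_1) \<Rightarrow> (nat \<Rightarrow> 'b) \<Rightarrow> 'a mpoly \<Rightarrow> 'b" where
  "mpoly_eval h a p =
     (\<Sum>m\<in>Poly_Mapping.keys p. h (Poly_Mapping.lookup p m) * (\<Prod>i\<in>Poly_Mapping.keys m. a i ^ Poly_Mapping.lookup m i))"

definition mpoly_pderiv :: "nat \<Rightarrow> 'a::comm_ring_1 mpoly \<Rightarrow> 'a mpoly" where
  "mpoly_pderiv i p =
     (\<Sum>m\<in>Poly_Mapping.keys p. Poly_Mapping.single (m - Poly_Mapping.single i 1)
                   (of_nat (Poly_Mapping.lookup m i) * Poly_Mapping.lookup p m))"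


section \<open>Affine varieties over a field\<close>

text \<open>A closed subscheme of affine n-space over a field k is given by an ideal \<^term>\<open>I\<close> of
  k[X_0, ..., X_(n-1)]. Its base change to the algebraic closure is given by the ideal
  generated by \<^term>\<open>I\<close> over the algebraic closure.\<close>

definition base_change :: "nat \<Rightarrow> 'k::field mpoly set \<Rightarrow> 'k alg_closure mpoly set" where
  "base_change n I = Idl\<^bsub>mpoly_ring n\<^esub> (Poly_Mapping.map to_ac ` I)"

text \<open>Varieties are reduced, also after base change, as in Weil's and Fried and Jarden's
  terminology. So absolutely irreducible means that the coordinate ring tensored with the
  algebraic closure is an integral domain; in particular the variety is non-empty.\<close>

definition absolutely_irreducible :: "nat \<Rightarrow> 'k::field mpoly set \<Rightarrow> bool" where
  "absolutely_irreducible n I \<longleftrightarrow> primeideal (base_change n I) (mpoly_ring n)"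

text \<open>Every non-empty variety contains a non-empty affine open subvariety, so that only affine
  varieties occur in the following definition.\<close>

definition PAC :: "'k::field itself \<Rightarrow> bool" where
  "PAC _ \<longleftrightarrow> (\<forall>n (I :: 'k mpoly set).
     ideal I (mpoly_ring n) \<and> absolutely_irreducible n I \<longrightarrow>
     (\<exists>a. \<forall>p\<in>I. mpoly_eval id a p = 0))"

definition affine_dim :: "nat \<Rightarrow> 'a::field mpoly set \<Rightarrow> enat" where
  "affine_dim n J =
     (SUP d \<in> {d. \<exists>C. (\<forall>i\<le>d. primeideal (C i) (mpoly_ring n) \<and> J \<subseteq> C i) \<and>
                      (\<forall>i<d. C i \<subset> C (Suc i))}. enat d)"

definition jacobian :: "nat \<Rightarrow> 'a::field mpoly list \<Rightarrow> (nat \<Rightarrow> 'a) \<Rightarrow> 'a mat" where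
  "jacobian n gs a =
     mat (length gs) n (\<lambda>(i, j). mpoly_eval id a (mpoly_pderiv j (gs ! i)))"

text \<open>Nonsingularity of an irreducible affine variety over an algebraically closed field. The
  first argument of \<^const>\<open>vec_space.rank\<close> is the number of rows.\<close>

definition nonsingular :: "nat \<Rightarrow> 'a::alg_closed_field mpoly set \<Rightarrow> bool" where
  "nonsingular n J \<longleftrightarrow> (\<exists>gs. set gs \<subseteq> carrier (mpoly_ring n) \<and>
     J = Idl\<^bsub>mpoly_ring n\<^esub> (set gs) \<and>
     (\<forall>a. (\<forall>p\<in>J. mpoly_eval id a p = 0) \<longrightarrow>
        enat (vec_space.rank (length gs) (jacobian n gs a)) + affine_dim n J = enat n))"

definition smooth :: "nat \<Rightarrow> 'k::field mpoly set \<Rightarrow> bool" where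
  "smooth n I \<longleftrightarrow> nonsingular n (base_change n I)"


section \<open>The affine scheme Spec R\<close>

text \<open>A finitely generated algebra over a field is a ring homomorphism \<^term>\<open>\<iota>\<close> from the field
  with generators \<^term>\<open>x 0\<close>, ..., \<^term>\<open>x (n - 1)\<close>; it is the coordinate ring of
  the closed subscheme of affine n-space given by the relations between the generators.\<close>

definition affine_algebra ::
  "('k::field \<Rightarrow> 'r::comm_ring_1) \<Rightarrow> nat \<Rightarrow> (nat \<Rightarrow> 'r) \<Rightarrow> bool" where
  "affine_algebra \<iota> n x \<longleftrightarrow>
     comm_ring_hom \<iota> \<and> mpoly_eval \<iota> x ` carrier (mpoly_ring n) = UNIV"

definition relation_ideal ::
  "('k::field \<Rightarrow> 'r::comm_ring_1) \<Rightarrow> nat \<Rightarrow> (nat \<Rightarrow> 'r) \<Rightarrow> 'k mpoly set" where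
  "relation_ideal \<iota> n x = {p \<in> carrier (mpoly_ring n). mpoly_eval \<iota> x p = 0}"

definition zariski :: "'r::comm_ring_1 set topology" where
  "zariski = topology_generated_by
     {{\<pp>. primeideal \<pp> ring_of_type_algebra \<and> h \<notin> \<pp>} | h. True}"

text \<open>The points in V(K), V = Spec R, are the maximal ideals with residue field K.\<close>

definition rational_points :: "('k::field \<Rightarrow> 'r::comm_ring_1) \<Rightarrow> 'r set set" where
  "rational_points \<iota> =
     {\<pp>. maximalideal \<pp> ring_of_type_algebra \<and> (\<forall>r. \<exists>c. r - \<iota> c \<in> \<pp>)}"

definition residue :: "('k::field \<Rightarrow> 'r::comm_ring_1) \<Rightarrow> 'r set \<Rightarrow> 'r \<Rightarrow> 'k" where
  "residue \<iota> \<pp> r = (THE c. r - \<iota> c \<in> \<pp>)"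

definition reduce_poly ::
  "('k::field \<Rightarrow> 'r::comm_ring_1) \<Rightarrow> 'r set \<Rightarrow> 'r poly \<Rightarrow> 'k poly" where
  "reduce_poly \<iota> \<pp> f = map_poly (residue \<iota> \<pp>) f"


section \<open>Separable polynomials and partitions\<close>

text \<open>No multiple roots in an algebraic closure.\<close>

definition separable :: "'a::field poly \<Rightarrow> bool" where
  "separable p \<longleftrightarrow> rsquarefree (map_poly to_ac p)"

definition is_partition :: "nat multiset \<Rightarrow> nat \<Rightarrow> bool" where
  "is_partition P d \<longleftrightarrow> 0 \<notin># P \<and> sum_mset P = d"

text \<open>Only meaningful for separable polynomials: multiplicities are not counted.\<close>

definition factorization_type :: "'a::field poly \<Rightarrow> nat multiset" where
  "factorization_type g =
     image_mset degree (mset_set {p. irreducible p \<and> lead_coeff p = 1 \<and> p dvd g})"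


section \<open>Galois groups\<close>

definition Gal :: "'a::field set \<Rightarrow> 'a set \<Rightarrow> ('a \<Rightarrow> 'a) monoid" where
  "Gal M N = (BijGroup M) \<lparr>carrier := {\<sigma> \<in> Bij M.
      (\<forall>x\<in>M. \<forall>y\<in>M. \<sigma> (x + y) = \<sigma> x + \<sigma> y \<and> \<sigma> (x * y) = \<sigma> x * \<sigma> y) \<and>
      (\<forall>x\<in>N. \<sigma> x = x)}\<rparr>"

text \<open>The Krull topology on Gal(M/N): a basis is formed by the cosets of the groups
  Gal(M/N(S)), where N(S) runs through the finitely generated (for algebraic M/N: finite)
  intermediate extensions.\<close>

definition krull :: "'a::field set \<Rightarrow> 'a set \<Rightarrow> ('a \<Rightarrow> 'a) topology" where
  "krull M N = topology_generated_by
     {\<sigma> <#\<^bsub>Gal M N\<^esub> carrier (Gal M (generate_field ring_of_type_algebra (N \<union> S))) | \<sigma> S.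
        \<sigma> \<in> carrier (Gal M N) \<and> finite S \<and> S \<subseteq> M}"


section \<open>The geometric embedding problem\<close>

text \<open>All fields are taken inside an algebraic closure of the function field E = Frac(R). In
  particular the algebraic closure and the separable closure of K are those inside the algebraic
  closure of E, so that the intersection with the splitting field makes sense.\<close>

type_synonym 'r geom = "'r fract alg_closure"

definition to_geom :: "'r::idom \<Rightarrow> 'r geom" where
  "to_geom r = to_ac (to_fract r)"

definition base_field :: "('k::field \<Rightarrow> 'r::idom) \<Rightarrow> 'r geom set" where
  "base_field \<iota> = range (\<lambda>c. to_geom (\<iota> c))"

definition base_alg_closure :: "('k::field \<Rightarrow> 'r::idom) \<Rightarrow> 'r geom set" where
  "base_alg_closure \<iota> =
     {z. \<exists>p. p \<noteq> 0 \<and> poly (map_poly (\<lambda>c. to_geom (\<iota> c)) p) z = 0}"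

definition base_sep_closure :: "('k::field \<Rightarrow> 'r::idom) \<Rightarrow> 'r geom set" where
  "base_sep_closure \<iota> =
     {z. \<exists>p. separable p \<and> poly (map_poly (\<lambda>c. to_geom (\<iota> c)) p) z = 0}"

definition function_field :: "'r::idom geom set" where
  "function_field = range to_ac"

definition geom_roots :: "'r::idom poly \<Rightarrow> 'r geom set" where
  "geom_roots f = {z. poly (map_poly to_geom f) z = 0}"

definition splitting_field :: "'r::idom poly \<Rightarrow> 'r geom set" where
  "splitting_field f =
     generate_field ring_of_type_algebra (function_field \<union> geom_roots f)"

definition constant_field :: "('k::field \<Rightarrow> 'r::idom) \<Rightarrow> 'r poly \<Rightarrow> 'r geom set" where
  "constant_field \<iota> f = splitting_field f \<inter> base_alg_closure \<iota>"

definition absolute_Gal :: "('k::field \<Rightarrow> 'r::idom) \<Rightarrow> ('r geom \<Rightarrow> 'r geom) monoid" where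
  "absolute_Gal \<iota> = Gal (base_sep_closure \<iota>) (base_field \<iota>)"

definition absolute_krull :: "('k::field \<Rightarrow> 'r::idom) \<Rightarrow> ('r geom \<Rightarrow> 'r geom) topology" where
  "absolute_krull \<iota> = krull (base_sep_closure \<iota>) (base_field \<iota>)"

text \<open>The restriction maps of the embedding problem: \<open>\<pi>\<close> from Gal(K) and \<open>\<alpha>\<close> from Gal(F/E),
  both onto Gal(L/K), where L is \<^const>\<open>constant_field\<close>.\<close>

definition embed_\<pi> ::
  "('k::field \<Rightarrow> 'r::idom) \<Rightarrow> 'r poly \<Rightarrow> ('r geom \<Rightarrow> 'r geom) \<Rightarrow> ('r geom \<Rightarrow> 'r geom)" where
  "embed_\<pi> \<iota> f = (\<lambda>\<sigma> \<in> carrier (absolute_Gal \<iota>). restrict \<sigma> (constant_field \<iota> f))"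

definition embed_\<alpha> ::
  "('k::field \<Rightarrow> 'r::idom) \<Rightarrow> 'r poly \<Rightarrow> ('r geom \<Rightarrow> 'r geom) \<Rightarrow> ('r geom \<Rightarrow> 'r geom)" where
  "embed_\<alpha> \<iota> f =
     (\<lambda>\<sigma> \<in> carrier (Gal (splitting_field f) function_field). restrict \<sigma> (constant_field \<iota> f))"

definition embedding_solution ::
  "('k::field \<Rightarrow> 'r::idom) \<Rightarrow> 'r poly \<Rightarrow> (('r geom \<Rightarrow> 'r geom) \<Rightarrow> ('r geom \<Rightarrow> 'r geom)) \<Rightarrow> bool"
where
  "embedding_solution \<iota> f \<theta> \<longleftrightarrow>
     \<theta> \<in> hom (absolute_Gal \<iota>) (Gal (splitting_field f) function_field) \<and>
     continuous_map (absolute_krull \<iota>) (krull (splitting_field f) function_field) \<theta> \<and>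
     (\<forall>\<sigma> \<in> carrier (absolute_Gal \<iota>). embed_\<alpha> \<iota> f (\<theta> \<sigma>) = embed_\<pi> \<iota> f \<sigma>)"

text \<open>A solution \<open>\<theta>\<close> lets Gal(K) act on the roots of f by evaluation; its orbits are those of
  the image of \<open>\<theta>\<close>.\<close>

definition orbit_type ::
  "('k::field \<Rightarrow> 'r::idom) \<Rightarrow> 'r poly \<Rightarrow> (('r geom \<Rightarrow> 'r geom) \<Rightarrow> ('r geom \<Rightarrow> 'r geom))
     \<Rightarrow> nat multiset" where
  "orbit_type \<iota> f \<theta> =
     image_mset card (mset_set (orbits (absolute_Gal \<iota>) (geom_roots f) \<theta>))"

end

theory Submission
  imports Defs "Jordan_Normal_Form.Char_Poly"
begin

text \<open>Let \<open>E\<close> be the function field, \<open>F\<close> the splitting field of \<open>f\<close> and \<open>Ks\<close> the separable closure of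
  \<open>K\<close>, all inside an algebraic closure of \<open>E\<close>. Absolute irreducibility makes \<open>E\<close> linearly disjoint from
  the algebraic closure of \<open>K\<close>; therefore the restrictions of \<open>\<theta> g\<close> and \<open>g\<close> to \<open>F\<close> and \<open>Ks\<close> glue to an
  automorphism over \<open>E\<close>. Let \<open>H\<close> be the group of all automorphisms \<open>\<gamma>\<close> over \<open>E\<close> with
  \<open>\<gamma>|F = \<theta> (\<gamma>|Ks)\<close>, and \<open>D\<close> its fixed field in \<open>F Ks\<close>: the function field of the cover of \<open>V\<close> twisted
  by \<open>\<theta>\<close>. Since \<open>H\<close> maps onto \<open>Gal(K)\<close> and \<open>D\<close> is separable over \<open>E\<close>, also \<open>D\<close> is linearly disjoint from
  the algebraic closure of \<open>K\<close>, so every finitely generated subalgebra of \<open>D\<close> is the coordinate ring of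
  an absolutely irreducible variety and has a \<open>K\<close>-rational point \<open>\<phi>\<close>. The roots of \<open>f\<close> are linear
  combinations over \<open>Ks\<close> of elements of \<open>D\<close>; put these elements, and the inverse of a given \<open>h\<close> times the
  discriminant of \<open>f\<close>, into the subalgebra. Then \<open>\<phi>\<close> extends to the roots, injectively, and
  \<open>\<phi> (\<theta> g r) = g (\<phi> r)\<close>: the orbits of \<open>Gal(K)\<close> on the roots of the reduced polynomial are the
  orbits of \<open>\<theta>\<close> on the roots of \<open>f\<close>.\<close>

section \<open>Extension of homomorphisms\<close>

text \<open>Three points carry the argument. Gluing: an element of F that lies in E Ks is a
  combination over E of elements of F \<inter> Ks, by linear disjointness; there \<theta> g and g
  agree because \<alpha> \<circ> \<theta> = \<pi>, so an automorphism extending g can be corrected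
  by one that fixes E Ks. Finiteness: Gal(K) and H may be infinite, but continuity gives a finite
  subset S of Ks whose pointwise stabilizer is killed by \<theta>; Artin's theorem for the finite
  set of roots together with S then places the roots in D Ks. Imperfect fields: PAC concerns
  irreducibility over the full algebraic closure, while automorphisms see elements only up to a
  power of the characteristic exponent. A relation over D is therefore brought by descent only to
  purely inseparable coefficients, and is then raised to a power q; separability of F Ks over E
  keeps independent elements independent. Equivariance is a computation: if a root is a sum of terms
  v d with v in Ks and d in D, a lift of g moves only the v, whereas \<phi> is the identity on the
  algebraic closure of K and sends each d that occurs into K.\<close>

definition subalg :: "('e \<Rightarrow> 'a::comm_ring_1) \<Rightarrow> 'a set \<Rightarrow> bool" where
  "subalg e N \<longleftrightarrow> range e \<subseteq> N \<and> (\<forall>x\<in>N. \<forall>y\<in>N. x + y \<in> N \<and> x * y \<in> N)"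

lemma subalgI:
  assumes "\<And>c. e c \<in> N" "\<And>x y. x \<in> N \<Longrightarrow> y \<in> N \<Longrightarrow> x + y \<in> N" "\<And>x y. x \<in> N \<Longrightarrow> y \<in> N \<Longrightarrow> x * y \<in> N"
  shows "subalg e N"
  using assms by (auto simp: subalg_def)

lemma subalg_add: "subalg e N \<Longrightarrow> x \<in> N \<Longrightarrow> y \<in> N \<Longrightarrow> x + y \<in> N"
  and subalg_mult: "subalg e N \<Longrightarrow> x \<in> N \<Longrightarrow> y \<in> N \<Longrightarrow> x * y \<in> N"
  and subalg_base: "subalg e N \<Longrightarrow> e c \<in> N"
  by (auto simp: subalg_def)

context comm_ring_hom
begin

lemma subalg_0: "subalg hom N \<Longrightarrow> 0 \<in> N"
  using subalg_base[of hom N 0] by simp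

lemma subalg_1: "subalg hom N \<Longrightarrow> 1 \<in> N"
  using subalg_base[of hom N 1] by simp

text \<open>Negatives are not a clause of \<open>subalg\<close>: they come from multiplication by
  the image of -1.\<close>

lemma subalg_uminus: "subalg hom N \<Longrightarrow> x \<in> N \<Longrightarrow> - x \<in> N"
  using subalg_mult[of hom N "hom (- 1)" x] subalg_base[of hom N "- 1"] by (simp add: hom_uminus)

lemma subalg_diff: "subalg hom N \<Longrightarrow> x \<in> N \<Longrightarrow> y \<in> N \<Longrightarrow> x - y \<in> N"
  using subalg_add[of hom N x "- y"] subalg_uminus[of N y] by simp

lemma subalg_sum: "subalg hom N \<Longrightarrow> (\<And>i. i \<in> A \<Longrightarrow> f i \<in> N) \<Longrightarrow> sum f A \<in> N"
  by (induction A rule: infinite_finite_induct) (auto intro: subalg_0 subalg_add)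

lemma subalg_prod: "subalg hom N \<Longrightarrow> (\<And>i. i \<in> A \<Longrightarrow> f i \<in> N) \<Longrightarrow> prod f A \<in> N"
  by (induction A rule: infinite_finite_induct) (auto intro: subalg_1 subalg_mult)

lemma subalg_power: "subalg hom N \<Longrightarrow> x \<in> N \<Longrightarrow> x ^ k \<in> N"
  by (induction k) (auto intro: subalg_1 subalg_mult)

lemma subalg_poly:
  assumes "subalg hom N" "\<And>i. coeff p i \<in> N" "z \<in> N"
  shows "poly p z \<in> N"
  unfolding poly_altdef
  by (intro subalg_sum[OF assms(1)] subalg_mult[OF assms(1)] subalg_power[OF assms(1)] assms)

end

text \<open>One step of division with remainder. The quotient term is explicit because later
  divisions must keep their coefficients in a subalgebra, or run in parallel on the two sides of a
  graph.\<close>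

lemma degree_reduce_monic:
  fixes p g :: "'a::field poly"
  assumes p: "lead_coeff p = 1" and deg: "degree p \<le> degree g" and "g \<noteq> 0"
    and f: "f = g - monom (lead_coeff g) (degree g - degree p) * p"
  shows "f = 0 \<or> degree f < degree g"
proof -
  have "p \<noteq> 0" using p by auto
  then have "degree f \<le> degree g"
    unfolding f using deg \<open>g \<noteq> 0\<close>
    by (intro degree_diff_le) (auto simp: degree_mult_eq degree_monom_eq)
  moreover have "coeff f (degree g) = 0"
    using deg p by (simp add: f coeff_monom_mult)
  ultimately show ?thesis by (metis le_neq_implies_less leading_coeff_0_iff)
qed

section \<open>Algebraic extensions and minimal polynomials\<close>

locale algebraic_ext = field_hom e for e :: "'e::field \<Rightarrow> 'a::field" +
  assumes algebraic: "\<exists>p. p \<noteq> 0 \<and> poly (map_poly e p) z = 0"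
begin

lemma e_eq_0_iff [simp]: "e x = 0 \<longleftrightarrow> x = 0"
  by (rule hom_0_iff)

text \<open>Factors X can be divided out of an annihilating polynomial of z \<noteq> 0; a nonzero
  constant term is what makes z invertible in \<open>subalg_inverse\<close>.\<close>

lemma algebraic_nonzero:
  assumes "z \<noteq> 0"
  shows "\<exists>p. coeff p 0 \<noteq> 0 \<and> poly (map_poly e p) z = 0"
proof -
  obtain p where p: "p \<noteq> 0" "poly (map_poly e p) z = 0"
    using algebraic by blast
  then show ?thesis
  proof (induction "degree p" arbitrary: p rule: less_induct)
    case less
    show ?case
    proof (cases "coeff p 0 = 0")
      case True
      obtain a r where r: "p = pCons a r" by (cases p)
      have "a = 0" using True r by simp
      then have "r \<noteq> 0" "degree r < degree p" using less.prems r by auto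
      moreover have "poly (map_poly e r) z = 0"
        using less.prems r \<open>a = 0\<close> assms by (simp add: map_poly_pCons)
      ultimately show ?thesis using less.hyps by blast
    qed (use less.prems in auto)
  qed
qed

text \<open>From a + z r(z) = 0 with a \<noteq> 0 in the base field, the inverse of z is -r(z)/a, a
  polynomial in z. So subalgebras of algebraic extensions are fields.\<close>

lemma subalg_inverse:
  assumes N: "subalg e N" and z: "z \<in> N"
  shows "inverse z \<in> N"
proof (cases "z = 0")
  case False
  obtain p where p: "coeff p 0 \<noteq> 0" "poly (map_poly e p) z = 0"
    using algebraic_nonzero[OF False] by blast
  obtain a r where r: "p = pCons a r" by (cases p)
  have a: "a \<noteq> 0" using p r by simp
  have "e a + z * poly (map_poly e r) z = 0"
    using p r by (simp add: map_poly_pCons)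
  then have "z * (- poly (map_poly e r) z * e (inverse a)) = 1"
  proof -
    have "z * poly (map_poly e r) z = - e a"
      using \<open>e a + z * poly (map_poly e r) z = 0\<close> by (metis add.commute eq_neg_iff_add_eq_0)
    moreover have "z * (- poly (map_poly e r) z * e (inverse a))
        = - (z * poly (map_poly e r) z) * e (inverse a)"
      by (simp only: mult.assoc mult_minus_left mult_minus_right)
    ultimately have "z * (- poly (map_poly e r) z * e (inverse a)) = e a * e (inverse a)"
      by simp
    also have "\<dots> = 1"
      using a by (metis hom_mult hom_one right_inverse)
    finally show ?thesis .
  qed
  then have "inverse z = - poly (map_poly e r) z * e (inverse a)"
    by (metis False inverse_unique)
  also have "\<dots> \<in> N"
    by (intro subalg_mult[OF N] subalg_uminus[OF N] subalg_poly[OF N] subalg_base[OF N] z)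
       (auto simp: coeff_map_poly subalg_base[OF N])
  finally show ?thesis .
qed (use subalg_0[OF N] in auto)

text \<open>Since N is a field, an annihilating polynomial of least degree can be made monic.
  Minimality is a degree bound, the form in which division with remainder uses it.\<close>

lemma minimal_poly_exists:
  assumes N: "subalg e N"
  obtains p where "lead_coeff p = 1" "\<And>i. coeff p i \<in> N" "poly p z = 0"
    "\<And>g. g \<noteq> 0 \<Longrightarrow> (\<And>i. coeff g i \<in> N) \<Longrightarrow> poly g z = 0 \<Longrightarrow> degree p \<le> degree g"
proof -
  define S where "S = {g. g \<noteq> 0 \<and> (\<forall>i. coeff g i \<in> N) \<and> poly g z = 0}"
  obtain p0 where "p0 \<noteq> 0" "poly (map_poly e p0) z = 0" using algebraic by blast
  then have "map_poly e p0 \<in> S"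
    using subalg_base[OF N] by (auto simp: S_def coeff_map_poly map_poly_eq_0_iff)
  then obtain p where p: "p \<in> S" "\<And>g. g \<in> S \<Longrightarrow> degree p \<le> degree g"
    using ex_has_least_nat[of "\<lambda>g. g \<in> S" _ degree] by blast
  show ?thesis
  proof (rule that)
    let ?p = "smult (inverse (lead_coeff p)) p"
    have "p \<noteq> 0" using p by (auto simp: S_def)
    then show "lead_coeff ?p = 1" by simp
    show "coeff ?p i \<in> N" for i
      using p by (auto simp: S_def intro!: subalg_mult[OF N] subalg_inverse[OF N])
    show "poly ?p z = 0" using p by (auto simp: S_def)
    show "degree ?p \<le> degree g" if "g \<noteq> 0" "\<And>i. coeff g i \<in> N" "poly g z = 0" for g
      using p(2)[of g] that by (auto simp: S_def)
  qed
qed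

end

text \<open>Homomorphisms on subalgebras are represented by their graphs.\<close>

definition partial_hom :: "('e \<Rightarrow> 'a::field) \<Rightarrow> ('e \<Rightarrow> 'b::field) \<Rightarrow> ('a \<times> 'b) set \<Rightarrow> bool" where
  "partial_hom e h G \<longleftrightarrow> (\<forall>c. (e c, h c) \<in> G) \<and>
     (\<forall>a b c d. (a, b) \<in> G \<longrightarrow> (c, d) \<in> G \<longrightarrow> (a + c, b + d) \<in> G \<and> (a * c, b * d) \<in> G) \<and>
     (\<forall>b. (0, b) \<in> G \<longrightarrow> b = 0)"

lemma partial_homD:
  assumes "partial_hom e h G"
  shows "(e c, h c) \<in> G" "(a, b) \<in> G \<Longrightarrow> (c', d) \<in> G \<Longrightarrow> (a + c', b + d) \<in> G"
    "(a, b) \<in> G \<Longrightarrow> (c', d) \<in> G \<Longrightarrow> (a * c', b * d) \<in> G" "(0, b) \<in> G \<Longrightarrow> b = 0"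
  using assms unfolding partial_hom_def by blast+

section \<open>Adjoining one element to a partial homomorphism\<close>

definition adjoin_graph :: "('a::field \<times> 'b::field) set \<Rightarrow> 'a \<Rightarrow> 'b \<Rightarrow> ('a \<times> 'b) set" where
  "adjoin_graph G z z' = {(poly g z, poly g' z') | g g'. \<forall>i. (coeff g i, coeff g' i) \<in> G}"

lemma adjoin_graphI:
  "(\<And>i. (coeff g i, coeff g' i) \<in> G) \<Longrightarrow> a = poly g z \<Longrightarrow> b = poly g' z' \<Longrightarrow> (a, b) \<in> adjoin_graph G z z'"
  by (auto simp: adjoin_graph_def)

lemma adjoin_graphE:
  assumes "(a, b) \<in> adjoin_graph G z z'"
  obtains g g' where "\<forall>i. (coeff g i, coeff g' i) \<in> G" "a = poly g z" "b = poly g' z'"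
  using assms by (auto simp: adjoin_graph_def)

locale algebraic_ext_hom = algebraic_ext e + h: field_hom h
  for e :: "'e::field \<Rightarrow> 'a::field" and h :: "'e \<Rightarrow> 'b::field"
begin

lemma partial_hom_0: "partial_hom e h G \<Longrightarrow> (0, 0) \<in> G"
  using partial_homD(1)[of e h G 0] by simp

lemma partial_hom_1: "partial_hom e h G \<Longrightarrow> (1, 1) \<in> G"
  using partial_homD(1)[of e h G 1] by simp

lemma partial_hom_uminus: "partial_hom e h G \<Longrightarrow> (a, b) \<in> G \<Longrightarrow> (- a, - b) \<in> G"
  using partial_homD(3)[of e h G "e (- 1)" "h (- 1)" a b] partial_homD(1)[of e h G "- 1"]
  by (simp add: hom_uminus h.hom_uminus)

lemma partial_hom_diff:
  "partial_hom e h G \<Longrightarrow> (a, b) \<in> G \<Longrightarrow> (c, d) \<in> G \<Longrightarrow> (a - c, b - d) \<in> G"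
  using partial_homD(2)[of e h G a b "- c" "- d"] partial_hom_uminus by auto

lemma partial_hom_unique: "partial_hom e h G \<Longrightarrow> (a, b) \<in> G \<Longrightarrow> (a, c) \<in> G \<Longrightarrow> b = c"
  using partial_hom_diff[of G a b a c] partial_homD(4)[of e h G "b - c"] by auto

lemma partial_hom_sum:
  assumes "partial_hom e h G" "\<And>i. i \<in> A \<Longrightarrow> (f i, g i) \<in> G"
  shows "(sum f A, sum g A) \<in> G"
  using assms(2)
  by (induction A rule: infinite_finite_induct)
     (auto intro: partial_hom_0[OF assms(1)] partial_homD(2)[OF assms(1)])

lemma subalg_Domain: "partial_hom e h G \<Longrightarrow> subalg e (Domain G)"
  unfolding partial_hom_def by (intro subalgI) blast+

text \<open>The issue is well-definedness: g(z) = 0 must force g'(z') = 0 for coefficientwise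
  related g and g'. Dividing g by p and g' by p' in parallel keeps the coefficients related and
  lowers the degree of g; by minimality of p the descent can only end at g = 0.\<close>

lemma partial_hom_adjoin:
  assumes G: "partial_hom e h G"
    and pp: "\<And>i. (coeff p i, coeff p' i) \<in> G" and monic: "lead_coeff p = 1" and pz: "poly p z = 0"
    and min: "\<And>g. g \<noteq> 0 \<Longrightarrow> (\<And>i. coeff g i \<in> Domain G) \<Longrightarrow> poly g z = 0 \<Longrightarrow> degree p \<le> degree g"
    and pz': "poly p' z' = 0"
  shows "partial_hom e h (adjoin_graph G z z')"
proof -
  have zero: "poly g' z' = 0" if "\<And>i. (coeff g i, coeff g' i) \<in> G" "poly g z = 0" for g g'
    using that
  proof (induction "degree g" arbitrary: g g' rule: less_induct)
    case less
    show ?case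
    proof (cases "g = 0")
      case True
      then have "g' = 0"
        using less.prems(1) partial_homD(4)[OF G] by (auto intro!: poly_eqI)
      then show ?thesis by simp
    next
      case False
      let ?m = "degree g - degree p"
      have deg: "degree p \<le> degree g"
        by (rule min) (use False less.prems in \<open>auto intro: DomainI\<close>)
      define f where "f = g - monom (lead_coeff g) ?m * p"
      define f' where "f' = g' - monom (coeff g' (degree g)) ?m * p'"
      have cf: "(coeff f i, coeff f' i) \<in> G" for i
        unfolding f_def f'_def coeff_diff coeff_monom_mult
        by (auto intro!: partial_hom_diff[OF G] less.prems partial_homD(3)[OF G] pp)
      have pf: "poly f z = 0" using less.prems pz by (simp add: f_def)
      have "poly f' z' = 0"
      proof (cases "f = 0")
        case True
        then have "f' = 0"
          using cf partial_homD(4)[OF G] by (auto intro!: poly_eqI)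
        then show ?thesis by simp
      next
        case f0: False
        then have "degree f < degree g"
          using degree_reduce_monic[OF monic deg False f_def] by blast
        then show ?thesis using less.hyps cf pf by blast
      qed
      then show ?thesis using pz' by (simp add: f'_def)
    qed
  qed
  show ?thesis
    unfolding partial_hom_def
  proof (intro conjI allI impI)
    show "(e c, h c) \<in> adjoin_graph G z z'" for c
      by (rule adjoin_graphI[of "[:e c:]" "[:h c:]"])
         (auto simp: coeff_pCons partial_homD(1)[OF G] partial_hom_0[OF G] split: nat.split)
  next
    fix a b c d
    assume ab: "(a, b) \<in> adjoin_graph G z z'" and cd: "(c, d) \<in> adjoin_graph G z z'"
    from ab obtain g g' where g: "\<forall>i. (coeff g i, coeff g' i) \<in> G" "a = poly g z" "b = poly g' z'"
      by (rule adjoin_graphE)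
    from cd obtain k k' where k: "\<forall>i. (coeff k i, coeff k' i) \<in> G" "c = poly k z" "d = poly k' z'"
      by (rule adjoin_graphE)
    show "(a + c, b + d) \<in> adjoin_graph G z z'"
      by (rule adjoin_graphI[of "g + k" "g' + k'"]) (use g k partial_homD(2)[OF G] in simp_all)
    show "(a * c, b * d) \<in> adjoin_graph G z z'"
      by (rule adjoin_graphI[of "g * k" "g' * k'"])
         (use g k in \<open>simp_all add: coeff_mult partial_hom_sum[OF G] partial_homD(3)[OF G]\<close>)
  next
    fix b
    assume "(0, b) \<in> adjoin_graph G z z'"
    then obtain g g' where "\<forall>i. (coeff g i, coeff g' i) \<in> G" "0 = poly g z" "b = poly g' z'"
      by (rule adjoin_graphE)
    then show "b = 0" using zero[of g g'] by simp
  qed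
qed

lemma adjoin_graph_supset:
  assumes G: "partial_hom e h G"
  shows "G \<subseteq> adjoin_graph G z z'" "(z, z') \<in> adjoin_graph G z z'"
proof -
  show "G \<subseteq> adjoin_graph G z z'"
  proof safe
    fix a b assume "(a, b) \<in> G"
    then show "(a, b) \<in> adjoin_graph G z z'"
      using partial_hom_0[OF G]
      by (intro adjoin_graphI[of "[:a:]" "[:b:]"]) (auto simp: coeff_pCons split: nat.split)
  qed
  show "(z, z') \<in> adjoin_graph G z z'"
    using partial_hom_0[OF G] partial_hom_1[OF G]
    by (intro adjoin_graphI[of "[:0, 1:]" "[:0, 1:]"]) (auto simp: coeff_pCons split: nat.split)
qed

end

locale algebraic_ext_closed = algebraic_ext_hom e h
  for e :: "'e::field \<Rightarrow> 'a::field" and h :: "'e \<Rightarrow> 'b::alg_closed_field"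
begin

lemma partial_hom_step:
  assumes G: "partial_hom e h G"
  shows "\<exists>G'. partial_hom e h G' \<and> G \<subseteq> G' \<and> z \<in> Domain G'"
proof -
  obtain p where p: "lead_coeff p = 1" "\<And>i. coeff p i \<in> Domain G" "poly p z = 0"
    "\<And>g. g \<noteq> 0 \<Longrightarrow> (\<And>i. coeff g i \<in> Domain G) \<Longrightarrow> poly g z = 0 \<Longrightarrow> degree p \<le> degree g"
    using minimal_poly_exists[OF subalg_Domain[OF G]] by metis
  have "\<forall>a\<in>Domain G. \<exists>b. (a, b) \<in> G" by blast
  then obtain \<phi> where \<phi>: "\<And>a. a \<in> Domain G \<Longrightarrow> (a, \<phi> a) \<in> G" by metis
  have \<phi>0: "\<phi> 0 = 0" using \<phi> partial_hom_unique[OF G] partial_hom_0[OF G] by blast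
  define p' where "p' = map_poly \<phi> p"
  have pp: "(coeff p i, coeff p' i) \<in> G" for i
    using \<phi> p(2) \<phi>0 by (simp add: p'_def coeff_map_poly)
  \<comment> \<open>A coefficient 1 in positive degree keeps \<open>p'\<close> from being constant,
    so it has a root.\<close>
  have "coeff p' (degree p) = 1"
    using pp[of "degree p"] p(1) partial_hom_unique[OF G partial_hom_1[OF G]] by simp
  then have "degree p \<le> degree p'" by (intro le_degree) auto
  moreover have "degree p \<noteq> 0" using p(1,3) by (metis degree_0_id one_neq_zero poly_const_conv of_nat_0)
  ultimately obtain z' where z': "poly p' z' = 0"
    using alg_closed_imp_poly_has_root[of p'] by auto
  let ?G = "adjoin_graph G z z'"
  have "partial_hom e h ?G"
    by (rule partial_hom_adjoin[OF G pp p(1,3) _ z']) (use p(4) in blast)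
  moreover have "G \<subseteq> ?G" by (rule adjoin_graph_supset(1)[OF G])
  moreover have "z \<in> Domain ?G" by (rule DomainI[OF adjoin_graph_supset(2)[OF G]])
  ultimately show ?thesis by (intro exI conjI)
qed

text \<open>Zorn's lemma on graphs: a maximal one has full domain, because
  \<open>partial_hom_step\<close> would adjoin any missing element.\<close>

theorem extend_hom:
  assumes G: "partial_hom e h G"
  shows "\<exists>\<psi>. field_hom \<psi> \<and> (\<forall>a b. (a, b) \<in> G \<longrightarrow> \<psi> a = b)"
proof -
  let ?P = "{G'. partial_hom e h G' \<and> G \<subseteq> G'}"
  have "\<exists>M\<in>?P. \<forall>W\<in>?P. M \<subseteq> W \<longrightarrow> W = M"
  proof (rule subset_Zorn_nonempty)
    show "?P \<noteq> {}" using G by blast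
    fix C assume C: "C \<noteq> {}" "subset.chain ?P C"
    have ph: "partial_hom e h W" "G \<subseteq> W" if "W \<in> C" for W
      using C(2) that by (auto simp: subset.chain_def)
    have tot: "\<exists>Z\<in>C. u \<in> Z \<and> v \<in> Z" if "u \<in> \<Union>C" "v \<in> \<Union>C" for u v
      using that C(2) unfolding subset_chain_def by blast
    have "partial_hom e h (\<Union>C)"
      unfolding partial_hom_def
    proof (intro conjI allI impI)
      show "(e c, h c) \<in> \<Union>C" for c
      proof -
        obtain Z where "Z \<in> C" using C(1) by blast
        then show ?thesis using partial_homD(1)[OF ph(1)] by blast
      qed
      fix a b c d assume "(a, b) \<in> \<Union>C" "(c, d) \<in> \<Union>C"
      then obtain Z where "Z \<in> C" "(a, b) \<in> Z" "(c, d) \<in> Z" using tot by blast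
      then show "(a + c, b + d) \<in> \<Union>C" "(a * c, b * d) \<in> \<Union>C"
        using partial_homD(2,3)[OF ph(1)] by (meson UnionI)+
    next
      fix b assume "(0, b) \<in> \<Union>C"
      then show "b = 0" using partial_homD(4)[OF ph(1)] by auto
    qed
    then show "\<Union>C \<in> ?P" using ph(2) C(1) by blast
  qed
  then obtain M where "M \<in> ?P" and max: "\<forall>W\<in>?P. M \<subseteq> W \<longrightarrow> W = M" by (rule bexE)
  then have M: "partial_hom e h M" "G \<subseteq> M" by auto
  have dom: "z \<in> Domain M" for z
  proof -
    obtain G' where "partial_hom e h G'" "M \<subseteq> G'" "z \<in> Domain G'"
      using partial_hom_step[OF M(1)] by blast
    then have "G' \<in> ?P" using M(2) by auto
    from max[rule_format, OF this \<open>M \<subseteq> G'\<close>] have "G' = M" .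
    then show ?thesis using \<open>z \<in> Domain G'\<close> by simp
  qed
  then have "\<forall>a. \<exists>b. (a, b) \<in> M" by blast
  then obtain \<psi> where \<psi>: "\<And>a. (a, \<psi> a) \<in> M" by metis
  have eq: "\<psi> a = b" if "(a, b) \<in> M" for a b
    using partial_hom_unique[OF M(1) \<psi> that] .
  have "field_hom \<psi>"
    by standard
       (auto intro!: eq partial_homD(2,3)[OF M(1)] \<psi> partial_hom_0[OF M(1)] partial_hom_1[OF M(1)])
  then show ?thesis using eq M(2) by blast
qed

end

section \<open>Automorphisms of an algebraic closure\<close>

text \<open>Total endomorphisms stand in for Galois groups: over an algebraic base they are
  bijective (\<open>fixing_surj\<close>), and they compose as plain functions.\<close>

definition fixing :: "'a::field set \<Rightarrow> ('a \<Rightarrow> 'a) set" where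
  "fixing N = {\<psi>. field_hom \<psi> \<and> (\<forall>x\<in>N. \<psi> x = x)}"

lemma fixing_hom: "\<psi> \<in> fixing N \<Longrightarrow> field_hom \<psi>"
  and fixing_fix: "\<psi> \<in> fixing N \<Longrightarrow> x \<in> N \<Longrightarrow> \<psi> x = x"
  by (auto simp: fixing_def)

lemma fixing_mono: "N \<subseteq> M \<Longrightarrow> fixing M \<subseteq> fixing N"
  by (auto simp: fixing_def)

lemma field_hom_comp:
  assumes "field_hom \<phi>" "field_hom \<psi>"
  shows "field_hom (\<lambda>x. \<phi> (\<psi> x))"
proof -
  interpret f: field_hom \<phi> by fact
  interpret g: field_hom \<psi> by fact
  show ?thesis by standard (auto simp: f.hom_add g.hom_add f.hom_mult g.hom_mult)
qed

lemma field_hom_id: "field_hom (\<lambda>x. x)"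
  by standard auto

lemma fixing_comp: "\<phi> \<in> fixing N \<Longrightarrow> \<psi> \<in> fixing N \<Longrightarrow> (\<lambda>x. \<phi> (\<psi> x)) \<in> fixing N"
  by (auto simp: fixing_def field_hom_comp)

lemma id_fixing: "(\<lambda>x. x) \<in> fixing N"
  by (auto simp: fixing_def field_hom_id)

context algebraic_ext
begin

lemma fixing_root:
  assumes \<psi>: "\<psi> \<in> fixing (range e)" and "poly (map_poly e p) z = 0"
  shows "poly (map_poly e p) (\<psi> z) = 0"
proof -
  interpret f: field_hom \<psi> using \<psi> by (rule fixing_hom)
  have "map_poly \<psi> (map_poly e p) = map_poly e p"
    using \<psi> by (intro poly_eqI) (simp add: coeff_map_poly fixing_fix)
  then have "poly (map_poly e p) (\<psi> z) = \<psi> (poly (map_poly e p) z)"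
    using f.poly_map_poly[of "map_poly e p" z] by simp
  then show ?thesis using assms by simp
qed

lemma finite_orbit: "finite ((\<lambda>\<psi>. \<psi> z) ` fixing (range e))"
proof -
  obtain p where p: "p \<noteq> 0" "poly (map_poly e p) z = 0" using algebraic by blast
  have "map_poly e p \<noteq> 0" using p by (simp add: map_poly_eq_0_iff)
  then have "finite {a. poly (map_poly e p) a = 0}" by (rule poly_roots_finite)
  then show ?thesis
    by (rule finite_subset[rotated]) (use fixing_root p in auto)
qed

text \<open>An injective map that sends roots to roots permutes the finitely many roots of a
  polynomial over the base that annihilates z, so z is in its image.\<close>

lemma fixing_surj:
  assumes \<psi>: "\<psi> \<in> fixing (range e)"
  shows "surj \<psi>"
proof -
  interpret f: field_hom \<psi> using \<psi> by (rule fixing_hom)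
  have "z \<in> range \<psi>" for z
  proof -
    obtain p where p: "p \<noteq> 0" "poly (map_poly e p) z = 0" using algebraic by blast
    let ?R = "{a. poly (map_poly e p) a = 0}"
    have "map_poly e p \<noteq> 0" using p by (simp add: map_poly_eq_0_iff)
    then have "finite ?R" by (rule poly_roots_finite)
    moreover have "\<psi> ` ?R \<subseteq> ?R" using fixing_root[OF \<psi>] by auto
    moreover have "inj_on \<psi> ?R" using f.inj_f by (rule inj_on_subset) auto
    ultimately have "\<psi> ` ?R = ?R" by (rule endo_inj_surj)
    then show ?thesis using p by blast
  qed
  then show ?thesis by blast
qed

lemma fixing_inv:
  assumes \<psi>: "\<psi> \<in> fixing (range e)"
  shows "inv_into UNIV \<psi> \<in> fixing (range e)" "\<psi> (inv_into UNIV \<psi> x) = x" "inv_into UNIV \<psi> (\<psi> x) = x"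
proof -
  interpret f: field_hom \<psi> using \<psi> by (rule fixing_hom)
  note s = fixing_surj[OF \<psi>]
  show 1: "\<psi> (inv_into UNIV \<psi> x) = x" for x using s by (rule surj_f_inv_f)
  show 2: "inv_into UNIV \<psi> (\<psi> x) = x" for x using f.inj_f by (simp add: inv_into_f_f)
  have "inv_into UNIV \<psi> (a + b) = inv_into UNIV \<psi> a + inv_into UNIV \<psi> b" "inv_into UNIV \<psi> (a * b) = inv_into UNIV \<psi> a * inv_into UNIV \<psi> b" for a b
    using 2[of "inv_into UNIV \<psi> a + inv_into UNIV \<psi> b"] 2[of "inv_into UNIV \<psi> a * inv_into UNIV \<psi> b"]
    by (simp_all add: f.hom_add f.hom_mult 1)
  moreover have "inv_into UNIV \<psi> 0 = 0" "inv_into UNIV \<psi> 1 = 1" using 2[of 0] 2[of 1] by simp_all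
  moreover have "inv_into UNIV \<psi> x = x" if "x \<in> range e" for x using 2[of x] fixing_fix[OF \<psi> that] by simp
  ultimately show "inv_into UNIV \<psi> \<in> fixing (range e)"
    unfolding fixing_def by (auto intro!: field_hom.intro idom_hom.intro comm_ring_hom.intro
      ring_hom.intro semiring_hom.intro comm_monoid_add_hom.intro monoid_add_hom.intro
      monoid_mult_hom.intro zero_hom.intro semigroup_add_hom.intro plus_hom.intro one_hom.intro
      semigroup_mult_hom.intro times_hom.intro)
qed

end

section \<open>Conjugates and elements fixed by automorphisms\<close>

locale algebraic_closure_ext = algebraic_ext e for e :: "'e::field \<Rightarrow> 'a::alg_closed_field"
begin

sublocale self: algebraic_ext_closed e e
  by unfold_locales

lemma minimal_poly_dvd:
  assumes N: "subalg e N" and p: "lead_coeff p = 1" "\<And>i. coeff p i \<in> N"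
    and min: "\<And>g. g \<noteq> 0 \<Longrightarrow> (\<And>i. coeff g i \<in> N) \<Longrightarrow> poly g z = 0 \<Longrightarrow> degree p \<le> degree g"
    and pz: "poly p z = 0" and g: "\<And>i. coeff g i \<in> N" "poly g z = 0"
  shows "p dvd g"
  using g
proof (induction "degree g" arbitrary: g rule: less_induct)
  case less
  show ?case
  proof (cases "g = 0")
    case False
    let ?m = "degree g - degree p"
    have deg: "degree p \<le> degree g" by (rule min) (use False less.prems in auto)
    define f where "f = g - monom (lead_coeff g) ?m * p"
    have cf: "coeff f i \<in> N" for i
      unfolding f_def coeff_diff coeff_monom_mult
      by (auto intro!: subalg_diff[OF N] less.prems subalg_mult[OF N] subalg_0[OF N] p)
    have pf: "poly f z = 0" using less.prems pz by (simp add: f_def)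
    have "p dvd f"
    proof (cases "f = 0")
      case f0: False
      then have "degree f < degree g"
        using degree_reduce_monic[OF p(1) deg False f_def] by blast
      then show ?thesis using less.hyps cf pf by blast
    qed simp
    moreover have "g = f + monom (lead_coeff g) ?m * p" by (simp add: f_def)
    ultimately show ?thesis by (metis dvd_add dvd_triv_right)
  qed simp
qed

text \<open>Sending z to z' extends the identity of N to a partial homomorphism;
  \<open>extend_hom\<close> prolongs it to the whole algebraic closure.\<close>

lemma conjugate_exists:
  assumes N: "subalg e N" and p: "lead_coeff p = 1" "\<And>i. coeff p i \<in> N"
    and min: "\<And>g. g \<noteq> 0 \<Longrightarrow> (\<And>i. coeff g i \<in> N) \<Longrightarrow> poly g z = 0 \<Longrightarrow> degree p \<le> degree g"
    and pz: "poly p z = 0" and pz': "poly p z' = 0"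
  shows "\<exists>\<psi>\<in>fixing N. \<psi> z = z'"
proof -
  let ?G = "{(x, x) | x. x \<in> N}"
  have G: "partial_hom e e ?G"
    using subalg_base[OF N] subalg_add[OF N] subalg_mult[OF N] unfolding partial_hom_def by auto
  have D: "Domain ?G = N" by auto
  have "partial_hom e e (adjoin_graph ?G z z')"
    by (rule self.partial_hom_adjoin[OF G _ p(1) pz _ pz']) (use p(2) min D in auto)
  from self.extend_hom[OF this] obtain \<psi> where \<psi>: "field_hom \<psi>"
    "\<And>a b. (a, b) \<in> adjoin_graph ?G z z' \<Longrightarrow> \<psi> a = b"
    by blast
  have "\<psi> z = z'" by (rule \<psi>(2)[OF self.adjoin_graph_supset(2)[OF G]])
  moreover have "\<psi> x = x" if "x \<in> N" for x
    by (rule \<psi>(2)[OF subsetD[OF self.adjoin_graph_supset(1)[OF G]]]) (use that in auto)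
  ultimately show ?thesis using \<psi>(1) by (auto simp: fixing_def)
qed

text \<open>The minimal polynomial p of z over N divides the squarefree q. A further root would be a
  conjugate of z, hence z itself, and then a double root of q; so p = X - z, and its constant
  coefficient puts z into N.\<close>

theorem fixed_imp_mem:
  assumes N: "subalg e N" and q: "\<And>i. coeff q i \<in> N" "rsquarefree q" "poly q z = 0"
    and fixed: "\<And>\<psi>. \<psi> \<in> fixing N \<Longrightarrow> \<psi> z = z"
  shows "z \<in> N"
proof -
  obtain p where p: "lead_coeff p = 1" "\<And>i. coeff p i \<in> N" "poly p z = 0"
    "\<And>g. g \<noteq> 0 \<Longrightarrow> (\<And>i. coeff g i \<in> N) \<Longrightarrow> poly g z = 0 \<Longrightarrow> degree p \<le> degree g"
    using minimal_poly_exists[OF N] by metis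
  have dvd: "p dvd q" by (rule minimal_poly_dvd[OF N p(1,2,4,3) q(1,3)])
  obtain r where r: "p = [:- z, 1:] * r" using p(3) by (auto simp: poly_eq_0_iff_dvd)
  have "p \<noteq> 0" "r \<noteq> 0" using p(1) r by auto
  have "degree r = 0"
  proof (rule ccontr)
    assume "degree r \<noteq> 0"
    then obtain z' where z': "poly r z' = 0" using alg_closed_imp_poly_has_root[of r] by auto
    then have "\<exists>\<psi>\<in>fixing N. \<psi> z = z'"
      by (intro conjugate_exists[OF N p(1,2,4,3)]) (auto simp: r)
    then have "z' = z" using fixed by auto
    then obtain s where "r = [:- z, 1:] * s" using z' by (auto simp: poly_eq_0_iff_dvd)
    then have "[:- z, 1:] ^ 2 dvd p" 
      unfolding r by (simp only: power2_eq_square mult.assoc[symmetric] dvd_triv_left)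
    then have "[:- z, 1:] ^ 2 dvd q" using dvd by (rule dvd_trans)
    then have "2 \<le> order z q" using q(2) by (auto simp: order_divides rsquarefree_def)
    then show False using q(2) unfolding rsquarefree_def by (metis one_le_numeral numeral_le_one_iff not_numeral_le_zero semiring_norm(69))
  qed
  then obtain c where c: "r = [:c:]" by (metis degree_eq_zeroE)
  then have "c = 1" using p(1) \<open>r \<noteq> 0\<close> by (simp add: r)
  then have "coeff p 0 = - z" by (simp add: r c)
  then have "- z \<in> N" using p(2) by metis
  then show ?thesis using subalg_uminus[OF N] by fastforce
qed

end

text \<open>Turns closure of a subalgebra under products into a statement on the coefficients of
  product polynomials; it is iterated in \<open>artin\<close>, where polynomials have polynomial
  coefficients.\<close>

lemma subalg_polys:
  assumes e: "comm_ring_hom e" and Z: "subalg e Z"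
  shows "comm_ring_hom (\<lambda>c. [:e c:])" "subalg (\<lambda>c. [:e c:]) {p. \<forall>i. coeff p i \<in> Z}"
proof -
  interpret comm_ring_hom e by fact
  show "comm_ring_hom (\<lambda>c. [:e c:])"
    by standard (auto simp: hom_add hom_mult hom_one one_pCons)
  show "subalg (\<lambda>c. [:e c:]) {p. \<forall>i. coeff p i \<in> Z}"
    by (rule subalgI)
       (auto simp: coeff_pCons coeff_mult subalg_base[OF Z] subalg_0[OF Z] subalg_add[OF Z]
          intro!: subalg_sum[OF Z] subalg_mult[OF Z] split: nat.split)
qed

context algebraic_closure_ext
begin

text \<open>Artin's theorem on finite groups of automorphisms, for the finite set of restrictions of the
  elements of \<^term>\<open>B\<close> to \<^term>\<open>U\<close>. Listing \<^term>\<open>U\<close> as the coefficients of one polynomial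
  \<open>v\<close> replaces the choice of a primitive element: the polynomial with roots \<open>b v\<close> is
  fixed by \<^term>\<open>\<psi>\<close>.\<close>

theorem artin:
  assumes Z: "subalg e Z" and B: "B \<subseteq> fixing (range e)" "(\<lambda>x. x) \<in> B"
    and comp: "\<And>a b. a \<in> B \<Longrightarrow> b \<in> B \<Longrightarrow> (\<lambda>x. a (b x)) \<in> B"
    and U: "finite U" "\<And>b u. b \<in> B \<Longrightarrow> u \<in> U \<Longrightarrow> b u \<in> Z"
    and \<psi>: "field_hom \<psi>" "\<And>z. z \<in> Z \<Longrightarrow> (\<And>b. b \<in> B \<Longrightarrow> b z = z) \<Longrightarrow> \<psi> z = z"
  shows "\<exists>b\<in>B. \<forall>u\<in>U. \<psi> u = b u"
proof -
  obtain us where us: "set us = U" using U(1) finite_list by auto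
  have map_Poly: "map_poly b (Poly us) = Poly (map b us)" if "field_hom b" for b
  proof -
    interpret b: field_hom b by fact
    show ?thesis
      by (intro poly_eqI) (simp add: coeff_map_poly nth_default_def)
  qed
  \<comment> \<open>\<open>B\<close> may be infinite; the set of images of the list is finite
    because every element has finitely many conjugates.\<close>
  define O' where "O' = (\<lambda>b. Poly (map b us)) ` B"
  have homB: "field_hom b" if "b \<in> B" for b using that B(1) fixing_hom by blast
  have "finite O'"
  proof -
    let ?W = "\<Union>u\<in>U. (\<lambda>\<psi>. \<psi> u) ` fixing (range e)"
    have "(\<lambda>b. map b us) ` B \<subseteq> {xs. set xs \<subseteq> ?W \<and> length xs = length us}"
    proof -
      have "b u \<in> ?W" if "b \<in> B" "u \<in> U" for b u using that B(1) by blast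
      then have "set (map b us) \<subseteq> ?W" if "b \<in> B" for b using that us by auto
      then show ?thesis by (simp add: image_subset_iff)
    qed
    moreover have "finite {xs. set xs \<subseteq> ?W \<and> length xs = length us}"
      using U(1) finite_orbit by (intro finite_lists_length_eq) auto
    ultimately have "finite ((\<lambda>b. map b us) ` B)" by (rule finite_subset)
    then have "finite (Poly ` (\<lambda>b. map b us) ` B)" by (rule finite_imageI)
    then show ?thesis by (simp add: O'_def image_image)
  qed
  define \<Phi> where "\<Phi> = (\<Prod>w\<in>O'. [:- w, 1:])"
  have stable: "map_poly (map_poly c) \<Phi> = \<Phi>" if c: "c \<in> B" for c
  proof -
    interpret c: field_hom c using homB[OF c] .
    interpret m: map_poly_inj_idom_hom c ..
    interpret mm: map_poly_inj_idom_hom "map_poly c" ..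
    have "map_poly c ` O' \<subseteq> O'"
    proof
      fix y assume "y \<in> map_poly c ` O'"
      then obtain b where b: "b \<in> B" "y = map_poly c (Poly (map b us))" by (auto simp: O'_def)
      have "y = Poly (map (\<lambda>x. c (b x)) us)"
        unfolding b by (intro poly_eqI) (simp add: coeff_map_poly nth_default_def)
      then show "y \<in> O'" using comp[OF c b(1)] by (auto simp: O'_def)
    qed
    moreover have "inj_on (map_poly c) O'" using m.inj_f by (rule inj_on_subset) auto
    ultimately have im: "map_poly c ` O' = O'" using \<open>finite O'\<close> by (intro endo_inj_surj)
    have "map_poly (map_poly c) \<Phi> = (\<Prod>w\<in>O'. map_poly (map_poly c) [:- w, 1:])"
      unfolding \<Phi>_def by (rule mm.hom_prod)
    also have "\<dots> = (\<Prod>w\<in>O'. [:- map_poly c w, 1:])"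
      by (intro prod.cong refl) (simp add: m.hom_uminus map_poly_pCons)
    also have "\<dots> = (\<Prod>w\<in>map_poly c ` O'. [:- w, 1:])"
      using \<open>inj_on (map_poly c) O'\<close> by (simp add: prod.reindex)
    finally show ?thesis by (simp add: im \<Phi>_def)
  qed
  have coeffs: "coeff (coeff \<Phi> i) k \<in> Z" for i k
  proof -
    note 1 = subalg_polys[OF comm_ring_hom_axioms Z]
    note 2 = subalg_polys[OF 1]
    interpret cc: comm_ring_hom "\<lambda>c. [:[:e c:]:]" by (rule 2(1))
    interpret c: comm_ring_hom "\<lambda>c. [:e c:]" by (rule 1(1))
    have "Poly (map b us) \<in> {p. \<forall>i. coeff p i \<in> Z}" if "b \<in> B" for b
      using that U(2) us subalg_0[OF Z] by (auto simp: nth_default_def)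
    then have "[:- w, 1:] \<in> {p. \<forall>i. coeff p i \<in> {p. \<forall>i. coeff p i \<in> Z}}" if "w \<in> O'" for w
      using that c.subalg_0[OF 1(2)] c.subalg_1[OF 1(2)] c.subalg_uminus[OF 1(2)]
      unfolding O'_def mem_Collect_eq[of _ "\<lambda>p. \<forall>i. coeff p i \<in> _"]
      by (auto simp del: mem_Collect_eq coeff_Poly_eq simp: coeff_pCons split: nat.split)
    then have "\<Phi> \<in> {p. \<forall>i. coeff p i \<in> {p. \<forall>i. coeff p i \<in> Z}}"
      unfolding \<Phi>_def by (intro cc.subalg_prod[OF 2(2)])
    then show ?thesis by blast
  qed
  interpret p: field_hom \<psi> by fact
  interpret m: map_poly_inj_idom_hom \<psi> ..
  interpret mm: map_poly_inj_idom_hom "map_poly \<psi>" ..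
  have "map_poly (map_poly \<psi>) \<Phi> = \<Phi>"
  proof (intro poly_eqI)
    fix i k
    have "\<psi> (coeff (coeff \<Phi> i) k) = coeff (coeff \<Phi> i) k"
    proof (rule \<psi>(2)[OF coeffs])
      fix c assume c: "c \<in> B"
      interpret c: field_hom c using homB[OF c] .
      interpret m': map_poly_inj_idom_hom c ..
      have "coeff (coeff (map_poly (map_poly c) \<Phi>) i) k = c (coeff (coeff \<Phi> i) k)" by simp
      then show "c (coeff (coeff \<Phi> i) k) = coeff (coeff \<Phi> i) k" using stable[OF c] by simp
    qed
    then show "coeff (coeff (map_poly (map_poly \<psi>) \<Phi>) i) k = coeff (coeff \<Phi> i) k" by simp
  qed
  moreover have "poly \<Phi> (Poly us) = 0"
  proof -
    have "Poly us \<in> O'" unfolding O'_def by (rule image_eqI[OF _ B(2)]) simp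
    then show ?thesis
      unfolding \<Phi>_def poly_prod using \<open>finite O'\<close> by (intro prod_zero) auto
  qed
  \<comment> \<open>A root of \<Phi> is one whole polynomial \<open>Poly (map b us)\<close>, so a
    single b serves all elements of U at once.\<close>
  ultimately have "poly \<Phi> (map_poly \<psi> (Poly us)) = 0"
    using m.poly_map_poly[of \<Phi> "Poly us"] by simp
  then obtain w where "w \<in> O'" "map_poly \<psi> (Poly us) = w"
    unfolding \<Phi>_def poly_prod using \<open>finite O'\<close> by auto
  then obtain b where b: "b \<in> B" "Poly (map \<psi> us) = Poly (map b us)"
    using map_Poly[OF \<psi>(1)] by (auto simp: O'_def)
  \<comment> \<open>\<open>Poly\<close> drops trailing zeros, but its coefficients at positions
    below the length of the list are still the list entries.\<close>
  have "\<psi> u = b u" if u: "u \<in> U" for u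
  proof -
    obtain i where i: "i < length us" "us ! i = u" using u us by (metis in_set_conv_nth)
    then show ?thesis
      using arg_cong[OF b(2), of "\<lambda>p. coeff p i"] by (simp add: nth_default_nth)
  qed
  then show ?thesis using b(1) by blast
qed

end

section \<open>Separable and purely inseparable elements\<close>

text \<open>The characteristic exponent. With the value 1 in characteristic zero, taking powers is
  harmless there and both cases share one argument.\<close>

definition char_exp :: "'a::field itself \<Rightarrow> nat" where
  "char_exp _ = max 1 CHAR('a)"

lemma char_exp_pos: "char_exp TYPE('a::field) > 0"
  by (simp add: char_exp_def)

lemma char_exp_cases: "char_exp TYPE('a::field) = 1 \<or> prime CHAR('a) \<and> char_exp TYPE('a) = CHAR('a)"
proof (cases "CHAR('a) = 0")
  case False
  then have "prime CHAR('a)" by (intro prime_CHAR_semidom) auto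
  then show ?thesis using prime_ge_1_nat[of "CHAR('a)"] by (auto simp: char_exp_def)
qed (auto simp: char_exp_def)

lemma field_hom_CHAR:
  fixes h :: "'a::field \<Rightarrow> 'b::field"
  assumes "field_hom h"
  shows "CHAR('a) = CHAR('b)"
proof (rule dvd_antisym)
  interpret field_hom h by fact
  have *: "of_nat n = (0::'a) \<longleftrightarrow> of_nat n = (0::'b)" for n
  proof -
    have "of_nat n = (0::'a) \<longleftrightarrow> h (of_nat n) = 0" by (rule hom_0_iff[symmetric])
    also have "h (of_nat n) = of_nat n" by (rule hom_of_nat)
    finally show ?thesis .
  qed
  show "CHAR('a) dvd CHAR('b)" using *[of "CHAR('b)"] by (simp only: of_nat_eq_0_iff_char_dvd dvd_refl)
  show "CHAR('b) dvd CHAR('a)" using *[of "CHAR('a)"] by (simp only: of_nat_eq_0_iff_char_dvd dvd_refl)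
qed

text \<open>The exponent comes from the field \<open>'b\<close>, the summands from any commutative
  semiring of that characteristic: \<open>kernel_subset_base_change\<close> applies it to
  multivariate polynomials.\<close>

lemma frobenius_sum:
  fixes f :: "'i \<Rightarrow> 'a::comm_semiring_1"
  assumes "CHAR('a) = CHAR('b::field)"
  shows "sum f A ^ (char_exp TYPE('b) ^ k) = (\<Sum>i\<in>A. f i ^ (char_exp TYPE('b) ^ k))"
proof (cases "char_exp TYPE('b) = 1")
  case False
  then have "prime CHAR('a)" "char_exp TYPE('b) = CHAR('a)" using assms char_exp_cases[where 'a='b] by auto
  then show ?thesis by (intro freshmans_dream_sum') auto
qed simp

lemma frobenius_add:
  fixes x y :: "'a::field"
  shows "(x + y) ^ (char_exp TYPE('a) ^ k) = x ^ (char_exp TYPE('a) ^ k) + y ^ (char_exp TYPE('a) ^ k)"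
  using frobenius_sum[OF refl, of "\<lambda>b. if b then x else y" UNIV k] by (simp add: UNIV_bool add.commute)

lemma frobenius_inj:
  fixes x y :: "'a::field"
  assumes "x ^ (char_exp TYPE('a) ^ k) = y ^ (char_exp TYPE('a) ^ k)"
  shows "x = y"
proof -
  have "(x - y) ^ (char_exp TYPE('a) ^ k) = 0"
    using frobenius_add[of "x - y" y k] assms by simp
  then show ?thesis by simp
qed

text \<open>Generated by ring operations alone. Over an algebraic base the result is a field by
  \<open>subalg_inverse\<close>, and equals the generated field
  (\<open>generate_field_eq_alg_gen\<close>).\<close>

inductive_set alg_gen :: "('e \<Rightarrow> 'a::comm_ring_1) \<Rightarrow> 'a set \<Rightarrow> 'a set" for e W where
  base: "e c \<in> alg_gen e W"
| gen: "x \<in> W \<Longrightarrow> x \<in> alg_gen e W"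
| add: "x \<in> alg_gen e W \<Longrightarrow> y \<in> alg_gen e W \<Longrightarrow> x + y \<in> alg_gen e W"
| mult: "x \<in> alg_gen e W \<Longrightarrow> y \<in> alg_gen e W \<Longrightarrow> x * y \<in> alg_gen e W"

lemma subalg_alg_gen: "subalg e (alg_gen e W)"
  by (rule subalgI) (blast intro: alg_gen.intros)+

lemma alg_gen_least:
  assumes "subalg e N" "W \<subseteq> N"
  shows "alg_gen e W \<subseteq> N"
proof
  fix x assume "x \<in> alg_gen e W"
  then show "x \<in> N"
    by induction (use assms in \<open>auto simp: subalg_def\<close>)
qed

lemma alg_gen_mono: "W \<subseteq> W' \<Longrightarrow> alg_gen e W \<subseteq> alg_gen e W'"
  by (intro alg_gen_least subalg_alg_gen) (auto intro: alg_gen.gen)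

lemma alg_gen_finite_support:
  assumes "finite A" "A \<subseteq> alg_gen e W"
  shows "\<exists>U. finite U \<and> U \<subseteq> W \<and> A \<subseteq> alg_gen e U"
proof -
  have 1: "\<exists>U. finite U \<and> U \<subseteq> W \<and> x \<in> alg_gen e U" if "x \<in> alg_gen e W" for x
    using that
  proof induction
    case (base c)
    show ?case by (intro exI[of _ "{}"]) (auto intro: alg_gen.base)
  next
    case (gen x)
    then show ?case by (intro exI[of _ "{x}"]) (auto intro: alg_gen.gen)
  next
    case (add x y)
    then obtain U V where "finite U" "U \<subseteq> W" "x \<in> alg_gen e U" "finite V" "V \<subseteq> W" "y \<in> alg_gen e V"
      by blast
    then show ?case
      using alg_gen_mono[of U "U \<union> V" e] alg_gen_mono[of V "U \<union> V" e]
      by (intro exI[of _ "U \<union> V"]) (auto intro: alg_gen.add)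
  next
    case (mult x y)
    then obtain U V where "finite U" "U \<subseteq> W" "x \<in> alg_gen e U" "finite V" "V \<subseteq> W" "y \<in> alg_gen e V"
      by blast
    then show ?case
      using alg_gen_mono[of U "U \<union> V" e] alg_gen_mono[of V "U \<union> V" e]
      by (intro exI[of _ "U \<union> V"]) (auto intro: alg_gen.mult)
  qed
  show ?thesis
    using assms
  proof (induction A)
    case empty
    then show ?case by blast
  next
    case (insert a A)
    obtain U where "finite U" "U \<subseteq> W" "A \<subseteq> alg_gen e U"
      using insert.IH insert.prems by auto
    moreover obtain V where "finite V" "V \<subseteq> W" "a \<in> alg_gen e V"
      using 1[of a] insert.prems by auto
    ultimately show ?case
      using alg_gen_mono[of U "U \<union> V" e] alg_gen_mono[of V "U \<union> V" e]
      by (intro exI[of _ "U \<union> V"]) auto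
  qed
qed

section \<open>Finitely generated subalgebras as vector spaces\<close>

context algebraic_ext
begin

sublocale vs: vector_space "\<lambda>c z. e c * z"
  by standard (auto simp: algebra_simps hom_add hom_mult)

text \<open>For a new generator u, a root of p, the spanning set is multiplied by the powers of u
  below deg p; the equation p(u) = 0 rewrites the next power.\<close>

lemma alg_gen_finite_dim:
  assumes "finite U"
  shows "\<exists>T. finite T \<and> alg_gen e U \<subseteq> vs.span T"
  using assms
proof (induction U)
  case empty
  have "subalg e (vs.span {1})"
  proof (rule subalgI)
    show "e c \<in> vs.span {1}" for c using vs.span_scale[OF vs.span_base, of 1 "{1}" c] by simp
    show "x * y \<in> vs.span {1}" if "x \<in> vs.span {1}" "y \<in> vs.span {1}" for x y
    proof -
      have "x \<in> range e" "y \<in> range e" using that by (simp_all add: vs.span_singleton)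
      then obtain a b where "x = e a" "y = e b" by blast
      then have "x * y = e (a * b) * 1" by (simp add: hom_mult)
      then show ?thesis using vs.span_scale[OF vs.span_base, of 1 "{1}" "a * b"] by simp
    qed
  qed (rule vs.span_add)
  then have "alg_gen e {} \<subseteq> vs.span {1}" by (rule alg_gen_least) auto
  then show ?case by blast
next
  case (insert u U)
  then obtain T where T: "finite T" "alg_gen e U \<subseteq> vs.span T" by blast
  obtain p where p: "p \<noteq> 0" "poly (map_poly e p) u = 0" using algebraic by blast
  define m where "m = degree p"
  have "m > 0"
  proof (rule ccontr)
    assume "\<not> m > 0"
    then obtain c where "p = [:c:]" unfolding m_def by (metis degree_eq_zeroE neq0_conv)
    then show False using p by (simp add: map_poly_pCons)
  qed
  define T' where "T' = (\<lambda>(t, i). t * u ^ i) ` (T \<times> {..<m})"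
  have fin: "finite T'" unfolding T'_def using T by auto
  have m1: "t * u ^ i \<in> vs.span T'" if "t \<in> T" "i < m" for t i
    using that by (intro vs.span_base) (auto simp: T'_def)
  have top: "t * u ^ m \<in> vs.span T'" if "t \<in> T" for t
  proof -
    have "poly (map_poly e p) u = (\<Sum>i<m. e (coeff p i) * u ^ i) + e (lead_coeff p) * u ^ m"
      unfolding poly_altdef m_def by (simp add: coeff_map_poly lessThan_Suc_atMost[symmetric])
    then have "e (lead_coeff p) * u ^ m = - (\<Sum>i<m. e (coeff p i) * u ^ i)"
      using p(2) by (simp add: eq_neg_iff_add_eq_0 add.commute)
    then have "e (inverse (lead_coeff p)) * (e (lead_coeff p) * u ^ m)
        = - (\<Sum>i<m. e (inverse (lead_coeff p)) * (e (coeff p i) * u ^ i))"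
      by (simp add: sum_distrib_left)
    moreover have "e (inverse (lead_coeff p)) * (e (lead_coeff p) * u ^ m) = u ^ m"
      using p(1) by (simp add: mult.assoc[symmetric] flip: hom_mult)
    ultimately have "u ^ m = - (\<Sum>i<m. e (inverse (lead_coeff p)) * (e (coeff p i) * u ^ i))" by simp
    then have "t * u ^ m = - (\<Sum>i<m. e (inverse (lead_coeff p) * coeff p i) * (t * u ^ i))"
      by (simp add: sum_distrib_left hom_mult mult_ac)
    also have "\<dots> \<in> vs.span T'"
      using m1[OF that] by (intro vs.span_neg vs.span_sum vs.span_scale) auto
    finally show ?thesis .
  qed
  have mult_u: "x * u \<in> vs.span T'" if "x \<in> vs.span T'" for x
    using that
  proof (induction rule: vs.span_induct_alt)
    case (step c x y)
    have "x * u \<in> vs.span T'"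
    proof -
      obtain t i where x: "x = t * u ^ i" "t \<in> T" "i < m" using step(1) by (auto simp: T'_def)
      then have "x * u = t * u ^ Suc i" by (simp add: mult_ac)
      moreover have "t * u ^ Suc i \<in> vs.span T'"
        using m1[OF x(2), of "Suc i"] top[OF x(2)] x(3) by (cases "Suc i = m") (simp_all del: power_Suc)
      ultimately show ?thesis by (simp only:)
    qed
    then have "e c * (x * u) + y * u \<in> vs.span T'"
      using step by (intro vs.span_add vs.span_scale)
    then show ?case by (simp add: algebra_simps)
  qed (simp add: vs.span_zero)
  have mult_pow: "x * u ^ i \<in> vs.span T'" if "x \<in> vs.span T'" for x i
    by (induction i) (use that mult_u in \<open>auto simp: power_Suc2 mult.assoc[symmetric] simp del: power_Suc\<close>)
  have "vs.span T \<subseteq> vs.span T'"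
    using m1[of _ 0] \<open>m > 0\<close> by (intro vs.span_minimal) auto
  then have polys: "poly g u \<in> vs.span T'" if "\<And>i. coeff g i \<in> alg_gen e U" for g
    unfolding poly_altdef using that T(2) by (intro vs.span_sum mult_pow) blast
  \<comment> \<open>Polynomials in u over the smaller algebra already form an algebra, and each of
    their values lies in the span.\<close>
  let ?N = "{poly g u | g. \<forall>i. coeff g i \<in> alg_gen e U}"
  note N = subalg_alg_gen[of e U]
  have "subalg e ?N"
  proof (rule subalgI)
    show "e c \<in> ?N" for c
      by (intro CollectI exI[of _ "[:e c:]"]) (auto simp: coeff_pCons subalg_base[OF N] subalg_0[OF N] split: nat.split)
    fix x y assume "x \<in> ?N" "y \<in> ?N"
    then obtain g h where gh: "x = poly g u" "y = poly h u"
      "\<forall>i. coeff g i \<in> alg_gen e U" "\<forall>i. coeff h i \<in> alg_gen e U" by blast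
    show "x + y \<in> ?N"
      by (intro CollectI exI[of _ "g + h"]) (use gh subalg_add[OF N] in auto)
    show "x * y \<in> ?N"
      by (intro CollectI exI[of _ "g * h"])
         (use gh in \<open>auto simp: coeff_mult intro!: subalg_sum[OF N] subalg_mult[OF N]\<close>)
  qed
  moreover have "insert u U \<subseteq> ?N"
  proof -
    have "u \<in> ?N"
      by (intro CollectI exI[of _ "[:0, 1:]"])
         (auto simp: coeff_pCons subalg_0[OF N] subalg_1[OF N] split: nat.split)
    moreover have "x \<in> ?N" if "x \<in> U" for x
      by (intro CollectI exI[of _ "[:x:]"])
         (use that in \<open>auto simp: coeff_pCons subalg_0[OF N] intro: alg_gen.gen split: nat.split\<close>)
    ultimately show ?thesis by blast
  qed
  ultimately have "alg_gen e (insert u U) \<subseteq> ?N" by (rule alg_gen_least)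
  then have "alg_gen e (insert u U) \<subseteq> vs.span T'" using polys by blast
  then show ?case using fin by blast
qed

lemma subalg_range: "subalg e (range e)"
  by (auto simp: subalg_def simp flip: hom_add hom_mult)

lemma fixing_alg_gen:
  assumes \<psi>: "\<psi> \<in> fixing (range e)" and W: "\<psi> ` W \<subseteq> alg_gen e W'" and x: "x \<in> alg_gen e W"
  shows "\<psi> x \<in> alg_gen e W'"
proof -
  interpret f: field_hom \<psi> using \<psi> by (rule fixing_hom)
  show ?thesis
    using x
  proof induction
    case (base c)
    then show ?case using fixing_fix[OF \<psi>] by (simp add: alg_gen.base)
  qed (use W in \<open>auto simp: f.hom_add f.hom_mult intro: alg_gen.add alg_gen.mult\<close>)
qed

text \<open>The separable closure of the base field inside the extension. Closure under ring
  operations is not visible from this form; it follows from \<open>alg_gen_sep\<close>.\<close>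

definition sep :: "'a set" where
  "sep = {z. \<exists>p. rsquarefree (map_poly e p) \<and> poly (map_poly e p) z = 0}"

lemma sep_fixing:
  assumes "\<psi> \<in> fixing (range e)" "z \<in> sep"
  shows "\<psi> z \<in> sep"
  using assms fixing_root unfolding sep_def by blast

end

section \<open>Polynomials with a prescribed finite set of roots\<close>

lemma coeff_prod_linear_mem:
  assumes e: "comm_ring_hom e" and N: "subalg e N" "S \<subseteq> N"
  shows "coeff (\<Prod>a\<in>S. [:- a, 1:]) i \<in> N"
proof -
  interpret comm_ring_hom e by fact
  note pol = subalg_polys[OF e N(1)]
  interpret c: comm_ring_hom "\<lambda>c. [:e c:]" by (rule pol(1))
  have "(\<Prod>a\<in>S. [:- a, 1:]) \<in> {p. \<forall>i. coeff p i \<in> N}"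
  proof (rule c.subalg_prod[OF pol(2)])
    fix a assume "a \<in> S"
    then show "[:- a, 1:] \<in> {p. \<forall>i. coeff p i \<in> N}"
      using N by (auto simp: coeff_pCons subalg_0[OF N(1)] subalg_1[OF N(1)] subalg_uminus[OF N(1)] split: nat.split)
  qed
  then show ?thesis by blast
qed

lemma map_poly_prod_linear:
  assumes "field_hom \<psi>"
  shows "map_poly \<psi> (\<Prod>a\<in>S. [:- a, 1:]) = (\<Prod>a\<in>S. [:- \<psi> a, 1:])"
proof -
  interpret f: field_hom \<psi> by fact
  interpret m: map_poly_inj_idom_hom \<psi> ..
  show ?thesis
    unfolding m.hom_prod by (intro prod.cong refl) (simp add: f.hom_uminus map_poly_pCons)
qed

lemma map_poly_prod_linear_stable:
  assumes \<psi>: "field_hom \<psi>" and S: "finite S" "\<psi> ` S \<subseteq> S"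
  shows "map_poly \<psi> (\<Prod>a\<in>S. [:- a, 1:]) = (\<Prod>a\<in>S. [:- a, 1:])"
proof -
  interpret f: field_hom \<psi> by fact
  have inj: "inj_on \<psi> S" using f.inj_f by (rule inj_on_subset) auto
  have im: "\<psi> ` S = S" using S inj by (intro endo_inj_surj)
  have "map_poly \<psi> (\<Prod>a\<in>S. [:- a, 1:]) = (\<Prod>a\<in>\<psi> ` S. [:- a, 1:])"
    unfolding map_poly_prod_linear[OF \<psi>] prod.reindex[OF inj] by (simp only: o_def)
  then show ?thesis unfolding im .
qed

lemma rsquarefreeI:
  fixes p :: "'a::field poly"
  assumes "p \<noteq> 0" "\<And>a. poly p a = 0 \<Longrightarrow> poly (pderiv p) a \<noteq> 0"
  shows "rsquarefree p"
  unfolding rsquarefree_def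
proof (intro conjI allI)
  fix a
  show "order a p = 0 \<or> order a p = 1"
  proof (rule ccontr)
    assume "\<not> ?thesis"
    then have "2 \<le> order a p" by linarith
    then have "[:- a, 1:] ^ 2 dvd p" using assms(1) by (simp add: order_divides)
    then obtain r where "p = [:- a, 1:] ^ 2 * r" by (rule dvdE)
    then have "p = [:- a, 1:] * ([:- a, 1:] * r)" by (simp only: power2_eq_square mult.assoc)
    then have "poly p a = 0" "poly (pderiv p) a = 0"
      by (simp_all add: pderiv_mult del: mult_pCons_left)
    then show False using assms(2) by blast
  qed
qed (fact assms)

lemma rsquarefree_prod_linear:
  fixes S :: "'a::field set"
  assumes "finite S"
  shows "rsquarefree (\<Prod>a\<in>S. [:- a, 1:])"
proof -
  have nz: "(\<Prod>a\<in>S. [:- a, 1:]) \<noteq> 0" using assms by simp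
  have "order b (\<Prod>a\<in>S. [:- a, 1:]) = (if b \<in> S then 1 else 0)" for b
    using assms
  proof (induction S)
    case (insert a S)
    have "[:- a, 1:] * (\<Prod>a\<in>S. [:- a, 1:]) \<noteq> 0"
      using insert.hyps(1) by (intro no_zero_divisors) auto
    moreover have "order b [:- a, 1:] = (if a = b then 1 else 0)"
      using order_power_n_n[of a 1] by (auto intro!: order_0I)
    ultimately show ?case using insert by (auto simp: order_mult simp del: mult_pCons_left)
  qed simp
  then show ?thesis using nz by (simp add: rsquarefree_def)
qed

section \<open>Frobenius powers and separable elements\<close>

context algebraic_closure_ext
begin

text \<open>Induction on the degree of an annihilating polynomial, via the minimal polynomial P. If
  P has nonzero derivative, it is squarefree; otherwise P is a polynomial in X^c, where c is the
  characteristic, and z^c has smaller degree.\<close>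

lemma power_in_sep: "\<exists>k. z ^ (char_exp TYPE('a) ^ k) \<in> sep"
proof -
  have "\<exists>k. z ^ (char_exp TYPE('a) ^ k) \<in> sep" if "p \<noteq> 0" "poly (map_poly e p) z = 0" for p
    using that
  proof (induction "degree p" arbitrary: p z rule: less_induct)
    case less
    obtain P where P: "lead_coeff P = 1" "\<And>i. coeff P i \<in> range e" "poly P z = 0"
      "\<And>g. g \<noteq> 0 \<Longrightarrow> (\<And>i. coeff g i \<in> range e) \<Longrightarrow> poly g z = 0 \<Longrightarrow> degree P \<le> degree g"
      using minimal_poly_exists[OF subalg_range, of z] by metis
    note N = subalg_range
    have "P \<noteq> 0" using P(1) by auto
    define p' where "p' = map_poly (inv_into UNIV e) P"
    have "inv_into UNIV e 0 = 0" using inv_into_f_f[OF inj_f, of 0] by simp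
    then have Pp: "P = map_poly e p'"
      by (intro poly_eqI) (simp add: p'_def coeff_map_poly f_inv_into_f[OF P(2)])
    have deg: "degree p' \<le> degree p"
      using P(4)[of "map_poly e p"] less.prems by (auto simp: Pp map_poly_eq_0_iff coeff_map_poly)
    have "p' \<noteq> 0" using \<open>P \<noteq> 0\<close> Pp by auto
    have d0: "degree p' > 0"
    proof (rule ccontr)
      assume "\<not> ?thesis"
      then obtain c where "p' = [:c:]" by (metis degree_eq_zeroE neq0_conv)
      then show False using P(1,3) Pp by (simp add: map_poly_pCons)
    qed
    show ?case
    proof (cases "pderiv p' = 0")
      case False
      \<comment> \<open>A common root of P and its derivative is conjugate to z, so z itself would
        be a root of the derivative, against minimality.\<close>
      have "poly (pderiv P) a \<noteq> 0" if a: "poly P a = 0" for a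
      proof
        assume 0: "poly (pderiv P) a = 0"
        have "\<exists>\<psi>\<in>fixing (range e). \<psi> z = a"
          by (rule conjugate_exists[OF N P(1,2,4,3) a])
        then obtain \<psi> where \<psi>: "\<psi> \<in> fixing (range e)" "\<psi> z = a" by blast
        interpret f: field_hom \<psi> using \<psi>(1) by (rule fixing_hom)
        have dP: "pderiv P = map_poly e (pderiv p')" unfolding Pp by (rule map_poly_pderiv[symmetric])
        have "map_poly \<psi> (pderiv P) = pderiv P"
          unfolding dP using \<psi>(1) by (intro poly_eqI) (simp add: coeff_map_poly fixing_fix)
        then have "\<psi> (poly (pderiv P) z) = 0"
          using f.poly_map_poly[of "pderiv P" z] 0 \<psi>(2) by simp
        then have "poly (pderiv P) z = 0" by simp
        then have "degree P \<le> degree (pderiv P)"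
          using False by (intro P(4)) (auto simp: dP coeff_map_poly map_poly_eq_0_iff)
        moreover have "degree (pderiv P) < degree P"
        proof -
          have "degree (pderiv p') \<le> degree p' - 1"
            by (rule degree_le) (auto simp: coeff_pderiv coeff_eq_0)
          moreover have "degree (pderiv P) = degree (pderiv p')" unfolding dP by simp
          moreover have "degree P = degree p'" unfolding Pp by simp
          ultimately show ?thesis using d0 by linarith
        qed
        ultimately show False by simp
      qed
      then have "rsquarefree P" using \<open>P \<noteq> 0\<close> by (intro rsquarefreeI) auto
      then have "z \<in> sep" using P(3) Pp by (auto simp: sep_def)
      then show ?thesis by (intro exI[of _ 0]) simp
    next
      case True
      let ?c = "CHAR('a)"
      have dvd: "?c dvd i" if "coeff p' i \<noteq> 0" for i
      proof (cases i)
        case (Suc n)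
        have "of_nat (Suc n) * coeff p' (Suc n) = 0"
          using True coeff_pderiv[of p' n] by simp
        then have "of_nat i = (0::'e)" using that Suc by simp
        then show ?thesis by (simp only: of_nat_eq_0_iff_char_dvd field_hom_CHAR[OF field_hom_axioms])
      qed simp
      have "?c \<noteq> 0" using dvd[of "degree p'"] d0 \<open>p' \<noteq> 0\<close> by auto
      then have c: "char_exp TYPE('a) = ?c" "prime ?c"
        using char_exp_cases[where 'a='a] prime_CHAR_semidom[where 'a='a] by (auto simp: char_exp_def)
      \<comment> \<open>Only exponents divisible by \<open>?c\<close> occur in \<open>p'\<close>, so
        \<open>p'\<close> arises from \<open>q\<close> by substituting the \<open>?c\<close>-th
        power of X.\<close>
      define q where "q = (\<Sum>i\<le>degree p'. monom (coeff p' (?c * i)) i)"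
      have cq: "coeff q i = coeff p' (?c * i)" for i
      proof -
        have "coeff q i = (if i \<le> degree p' then coeff p' (?c * i) else 0)"
          unfolding q_def coeff_sum by simp
        also have "\<dots> = coeff p' (?c * i)"
        proof -
          have "i \<le> ?c * i" using \<open>?c \<noteq> 0\<close> by simp
          then have "coeff p' (?c * i) = 0" if "\<not> i \<le> degree p'"
            using that by (intro coeff_eq_0) linarith
          then show ?thesis by simp
        qed
        finally show ?thesis .
      qed
      obtain s where s: "degree p' = ?c * s" using dvd[of "degree p'"] \<open>p' \<noteq> 0\<close> by (auto simp: dvd_def)
      have "q \<noteq> 0" using cq[of s] s \<open>p' \<noteq> 0\<close> by (metis coeff_0 leading_coeff_0_iff)
      have "degree q < degree p'"
      proof -
        have "coeff p' (?c * degree q) \<noteq> 0" using cq[of "degree q"] \<open>q \<noteq> 0\<close> by (metis leading_coeff_0_iff)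
        then have "?c * degree q \<le> degree p'" by (rule le_degree)
        moreover have "2 * degree q \<le> ?c * degree q" using prime_ge_2_nat[OF c(2)] by (rule mult_le_mono1)
        ultimately show ?thesis using d0 by linarith
      qed
      moreover have "poly (map_poly e q) (z ^ ?c) = 0"
      proof -
        have "poly (map_poly e q) (z ^ ?c) = (\<Sum>i\<le>degree q. e (coeff p' (?c * i)) * z ^ (?c * i))"
          unfolding poly_altdef by (simp add: coeff_map_poly cq power_mult)
        also have "\<dots> = (\<Sum>j\<in>(*) ?c ` {..degree q}. e (coeff p' j) * z ^ j)"
          using \<open>?c \<noteq> 0\<close> by (subst sum.reindex) (auto simp: inj_on_def)
        also have "\<dots> = (\<Sum>j\<le>degree p'. e (coeff p' j) * z ^ j)"
        proof (rule sum.mono_neutral_cong)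
          fix j assume "j \<in> {..degree p'} - (*) ?c ` {..degree q}"
          then have j: "j \<notin> (*) ?c ` {..degree q}" by auto
          have "coeff p' j = 0"
          proof (rule ccontr)
            assume nz: "coeff p' j \<noteq> 0"
            then obtain i where i: "j = ?c * i" using dvd[OF nz] by (auto simp: dvd_def)
            then have "coeff q i \<noteq> 0" using cq nz by simp
            then have "i \<le> degree q" by (rule le_degree)
            then show False using i j by auto
          qed
          then show "e (coeff p' j) * z ^ j = 0" by simp
        qed (auto simp: coeff_eq_0)
        also have "\<dots> = poly P z" unfolding Pp poly_altdef by (simp add: coeff_map_poly)
        finally show ?thesis using P(3) by simp
      qed
      ultimately obtain k where "(z ^ ?c) ^ (char_exp TYPE('a) ^ k) \<in> sep"
        using less.hyps[of q "z ^ ?c"] deg \<open>q \<noteq> 0\<close> by auto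
      then have "z ^ (char_exp TYPE('a) ^ Suc k) \<in> sep" using c by (simp add: power_mult)
      then show ?thesis by blast
    qed
  qed
  then show ?thesis using algebraic by blast
qed

lemma sep_fixed_mem:
  assumes "subalg e N" "z \<in> sep" "\<And>\<psi>. \<psi> \<in> fixing N \<Longrightarrow> \<psi> z = z"
  shows "z \<in> N"
proof -
  obtain p where p: "rsquarefree (map_poly e p)" "poly (map_poly e p) z = 0"
    using assms(2) by (auto simp: sep_def)
  show ?thesis
    by (rule fixed_imp_mem[OF assms(1) _ p])
       (simp add: coeff_map_poly subalg_base[OF assms(1)], rule assms(3))
qed

text \<open>Over an imperfect base, invariance only makes z purely inseparable: a power of z is
  separable, and \<open>sep_fixed_mem\<close> applies to that power.\<close>

lemma fixed_power:
  assumes "\<And>\<psi>. \<psi> \<in> fixing (range e) \<Longrightarrow> \<psi> z = z"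
  shows "\<exists>k. z ^ (char_exp TYPE('a) ^ k) \<in> range e"
proof -
  obtain k where k: "z ^ (char_exp TYPE('a) ^ k) \<in> sep" using power_in_sep by blast
  have "z ^ (char_exp TYPE('a) ^ k) \<in> range e"
  proof (rule sep_fixed_mem[OF subalg_range k])
    fix \<psi> assume \<psi>: "\<psi> \<in> fixing (range e)"
    interpret f: field_hom \<psi> using \<psi> by (rule fixing_hom)
    show "\<psi> (z ^ (char_exp TYPE('a) ^ k)) = z ^ (char_exp TYPE('a) ^ k)"
      using assms[OF \<psi>] by (simp add: f.hom_power)
  qed
  then show ?thesis by blast
qed

lemma uniform_power:
  assumes S: "finite S" and w: "\<And>m. m \<in> S \<Longrightarrow> \<exists>k. w m ^ (char_exp TYPE('a) ^ k) \<in> range e"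
  shows "\<exists>k. \<forall>m\<in>S. w m ^ (char_exp TYPE('a) ^ k) \<in> range e"
proof -
  obtain K where K: "\<And>m. m \<in> S \<Longrightarrow> w m ^ (char_exp TYPE('a) ^ K m) \<in> range e" using w by metis
  \<comment> \<open>The sum of the individual exponents is a common one, since the base field is
    closed under powers.\<close>
  have "w m ^ (char_exp TYPE('a) ^ sum K S) \<in> range e" if m: "m \<in> S" for m
  proof -
    have "K m \<le> sum K S" using S m by (intro member_le_sum) auto
    then obtain d where "sum K S = K m + d" by (auto simp: le_iff_add)
    then have "w m ^ (char_exp TYPE('a) ^ sum K S)
        = (w m ^ (char_exp TYPE('a) ^ K m)) ^ (char_exp TYPE('a) ^ d)"
      by (simp only: power_add power_mult)
    then show ?thesis using subalg_power[OF subalg_range K[OF m]] by simp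
  qed
  then show ?thesis by blast
qed

text \<open>A separable element \<open>u\<close> is both separable and purely inseparable over \<open>e[u ^ q]\<close>, hence lies in it.\<close>

lemma sep_alg_gen_power:
  assumes U: "U \<subseteq> sep" and q: "q = char_exp TYPE('a) ^ k"
  shows "alg_gen e U \<subseteq> vs.span ((\<lambda>z. z ^ q) ` alg_gen e U)"
proof -
  let ?S = "vs.span ((\<lambda>z. z ^ q) ` alg_gen e U)"
  have "U \<subseteq> alg_gen e ((\<lambda>u. u ^ q) ` U)"
  proof
    fix u assume u: "u \<in> U"
    have "u \<in> alg_gen e {u ^ q}"
    proof (rule sep_fixed_mem[OF subalg_alg_gen])
      show "u \<in> sep" using u U by blast
      fix \<psi> assume \<psi>: "\<psi> \<in> fixing (alg_gen e {u ^ q})"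
      interpret f: field_hom \<psi> using \<psi> by (rule fixing_hom)
      have "\<psi> u ^ q = u ^ q"
        using fixing_fix[OF \<psi>, of "u ^ q"] by (simp add: f.hom_power alg_gen.gen)
      then show "\<psi> u = u" unfolding q by (rule frobenius_inj)
    qed
    moreover have "alg_gen e {u ^ q} \<subseteq> alg_gen e ((\<lambda>u. u ^ q) ` U)"
      by (rule alg_gen_mono) (use u in auto)
    ultimately show "u \<in> alg_gen e ((\<lambda>u. u ^ q) ` U)" by blast
  qed
  then have "alg_gen e U \<subseteq> alg_gen e ((\<lambda>u. u ^ q) ` U)"
    by (intro alg_gen_least subalg_alg_gen)
  also have "\<dots> \<subseteq> ?S"
  proof (rule alg_gen_least)
    show "subalg e ?S"
    proof (rule subalgI)
      have "1 ^ q \<in> (\<lambda>z. z ^ q) ` alg_gen e U"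
        using subalg_1[OF subalg_alg_gen] by (rule imageI)
      then show "e c \<in> ?S" for c using vs.span_scale[OF vs.span_base, of 1 _ c] by simp
      show "x + y \<in> ?S" if "x \<in> ?S" "y \<in> ?S" for x y using that by (rule vs.span_add)
      have gen: "a ^ q * y \<in> ?S" if "a \<in> alg_gen e U" "y \<in> ?S" for a y
        using that(2)
      proof (induction rule: vs.span_induct_alt)
        case (step c x y)
        then obtain b where b: "b \<in> alg_gen e U" "x = b ^ q" by blast
        have "(a * b) ^ q \<in> ?S" using that(1) b by (intro vs.span_base imageI alg_gen.mult)
        then have "e c * (a * b) ^ q + a ^ q * y \<in> ?S"
          using step by (intro vs.span_add vs.span_scale)
        then show ?case by (simp add: b algebra_simps power_mult_distrib)
      qed (simp add: vs.span_zero)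
      show "x * y \<in> ?S" if "x \<in> ?S" "y \<in> ?S" for x y
        using that(1)
      proof (induction rule: vs.span_induct_alt)
        case (step c x z)
        then have "e c * (x * y) + z * y \<in> ?S"
          using gen that(2) by (intro vs.span_add vs.span_scale) auto
        then show ?case by (simp add: algebra_simps)
      qed (simp add: vs.span_zero)
    qed
    show "(\<lambda>u. u ^ q) ` U \<subseteq> ?S" by (auto intro!: vs.span_base imageI alg_gen.gen)
  qed
  finally show ?thesis .
qed

text \<open>Within a finite-dimensional algebra V containing A, extend A to a basis B. By
  \<open>sep_alg_gen_power\<close> the q-th powers of V span V, hence so do those of B; a spanning
  set with at most card B elements is a basis, so the q-th powers are distinct and
  independent.\<close>

lemma sep_power_independent:
  assumes U: "U \<subseteq> sep" and q: "q = char_exp TYPE('a) ^ k"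
    and A: "finite A" "A \<subseteq> alg_gen e U" "vs.independent A"
    and zero: "(\<Sum>b\<in>A. e (f b) * b ^ q) = 0" and b: "b \<in> A"
  shows "f b = 0"
proof -
  obtain U' where U': "finite U'" "U' \<subseteq> U" "A \<subseteq> alg_gen e U'"
    using alg_gen_finite_support[OF A(1,2)] by blast
  let ?V = "alg_gen e U'"
  obtain T where T: "finite T" "?V \<subseteq> vs.span T" using alg_gen_finite_dim[OF U'(1)] by blast
  obtain B where B: "A \<subseteq> B" "B \<subseteq> ?V" "vs.independent B" "?V \<subseteq> vs.span B"
    using vs.maximal_independent_subset_extend[OF U'(3) A(3)] by blast
  have finB: "finite B" using vs.independent_span_bound[OF T(1) B(3)] B(2) T(2) by blast
  let ?Bq = "(\<lambda>z. z ^ q) ` B"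
  have "(\<lambda>z. z ^ q) ` ?V \<subseteq> vs.span ?Bq"
  proof clarify
    fix z assume "z \<in> ?V"
    then obtain g where "z = (\<Sum>b\<in>B. e (g b) * b)" using B(4) vs.span_finite[OF finB] by auto
    then have "z ^ q = (\<Sum>b\<in>B. e (g b ^ q) * b ^ q)"
      unfolding q by (simp add: frobenius_sum[OF refl] power_mult_distrib hom_power)
    also have "\<dots> \<in> vs.span ?Bq" by (intro vs.span_sum vs.span_scale vs.span_base) auto
    finally show "z ^ q \<in> vs.span ?Bq" .
  qed
  then have "vs.span ((\<lambda>z. z ^ q) ` ?V) \<subseteq> vs.span ?Bq" by (intro vs.span_minimal) auto
  then have span: "?V \<subseteq> vs.span ?Bq" using sep_alg_gen_power[OF _ q, of U'] U'(2) U by blast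
  obtain C where C: "C \<subseteq> ?Bq" "vs.independent C" "?Bq \<subseteq> vs.span C"
    using vs.maximal_independent_subset[of ?Bq] by blast
  have finC: "finite C" using C(1) finB by (meson finite_imageI finite_subset)
  have "vs.span ?Bq \<subseteq> vs.span C" using C(3) by (intro vs.span_minimal) auto
  then have "B \<subseteq> vs.span C" using B(2) span by blast
  then have "card B \<le> card C" using vs.independent_span_bound[OF finC B(3)] by blast
  moreover have "card C \<le> card ?Bq" using C(1) finB by (intro card_mono) auto
  moreover have "card ?Bq \<le> card B" using finB by (rule card_image_le)
  ultimately have "card ?Bq = card B" "card C = card ?Bq" by linarith+
  then have inj: "inj_on (\<lambda>z. z ^ q) B" and "C = ?Bq"
    using finB C(1) by (auto intro: eq_card_imp_inj_on intro!: card_subset_eq del: equalityI subset_antisym)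
  then have ind: "vs.independent ?Bq" using C(2) by simp
  have injA: "inj_on (\<lambda>z. z ^ q) A" using inj B(1) by (rule inj_on_subset)
  have inv: "inv_into A (\<lambda>z. z ^ q) (x ^ q) = x" if "x \<in> A" for x
    using inv_into_f_f[OF injA that] .
  \<comment> \<open>Independence concerns the set of powers, so the relation is reindexed along the
    injective power map.\<close>
  have "(\<Sum>v\<in>(\<lambda>z. z ^ q) ` A. e (f (inv_into A (\<lambda>z. z ^ q) v)) * v) = 0"
    using zero by (simp add: sum.reindex[OF injA] inv cong: sum.cong)
  from vs.independentD[OF ind _ _ this, of "b ^ q"] have "f (inv_into A (\<lambda>z. z ^ q) (b ^ q)) = 0"
    using A(1) B(1) b by blast
  then show ?thesis using inv[OF b] by simp
qed

text \<open>By \<open>fixed_power\<close> some z^q is a constant c. If z were not in the base field,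
  1 and z would be independent, while the relation c 1^q - z^q = 0 makes their q-th powers
  dependent.\<close>

lemma fixed_sep_alg_gen:
  assumes z: "z \<in> alg_gen e sep" and fixed: "\<And>\<psi>. \<psi> \<in> fixing (range e) \<Longrightarrow> \<psi> z = z"
  shows "z \<in> range e"
proof (rule ccontr)
  assume nz: "z \<notin> range e"
  obtain k c where k: "z ^ (char_exp TYPE('a) ^ k) = e c" using fixed_power[of z] fixed by blast
  have "z \<noteq> 1" using nz hom_one by (metis rangeI)
  have "vs.independent {1, z}"
  proof (rule vs.independent_insertI)
    show "vs.independent {z}" using nz hom_zero by (metis rangeI vs.dependent_single)
    show "1 \<notin> vs.span {z}"
    proof
      assume "1 \<in> vs.span {z}"
      then obtain a where "1 = e a * z" by (auto simp: vs.span_singleton)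
      then have "z = e (inverse a)" by (metis hom_inverse inverse_unique)
      then show False using nz by blast
    qed
  qed
  then have "(if (1::'a) = 1 then c else - 1) = 0 \<and> (if z = 1 then c else - 1) = 0"
    using \<open>z \<noteq> 1\<close> k z
    by (intro conjI sep_power_independent[OF order_refl refl, of "{1, z}" "\<lambda>b. if b = 1 then c else - 1" k])
       (auto simp: hom_uminus intro: subalg_1[OF subalg_alg_gen])
  then show False using \<open>z \<noteq> 1\<close> by simp
qed

text \<open>For z generated by separable elements, the polynomial whose roots are the conjugates of
  z is squarefree by construction. Its coefficients are fixed and again generated by separable
  elements, so \<open>fixed_sep_alg_gen\<close> places them in the base field.\<close>

theorem alg_gen_sep: "alg_gen e sep = sep"
proof
  show "sep \<subseteq> alg_gen e sep" by (auto intro: alg_gen.gen)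
  show "alg_gen e sep \<subseteq> sep"
  proof
    fix z assume z: "z \<in> alg_gen e sep"
    define S where "S = (\<lambda>\<psi>. \<psi> z) ` fixing (range e)"
    have finS: "finite S" unfolding S_def by (rule finite_orbit)
    have genS: "\<psi> x \<in> alg_gen e sep" if \<psi>: "\<psi> \<in> fixing (range e)" and "x \<in> alg_gen e sep" for \<psi> x
      using fixing_alg_gen[OF \<psi> _ that(2)] sep_fixing[OF \<psi>] by (auto intro: alg_gen.gen)
    define P where "P = (\<Prod>a\<in>S. [:- a, 1:])"
    have cP: "coeff P i \<in> range e" for i
    proof (rule fixed_sep_alg_gen)
      have "S \<subseteq> alg_gen e sep" using z genS by (auto simp: S_def)
      then show "coeff P i \<in> alg_gen e sep"
        unfolding P_def by (rule coeff_prod_linear_mem[OF comm_ring_hom_axioms subalg_alg_gen])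
      fix \<psi> assume \<psi>: "\<psi> \<in> fixing (range e)"
      interpret f: field_hom \<psi> using \<psi> by (rule fixing_hom)
      have "\<psi> ` S \<subseteq> S" using fixing_comp[OF \<psi>] by (auto simp: S_def)
      then have "map_poly \<psi> P = P"
        unfolding P_def by (rule map_poly_prod_linear_stable[OF f.field_hom_axioms finS])
      then show "\<psi> (coeff P i) = coeff P i" by (metis f.coeff_map_poly_hom)
    qed
    define p where "p = map_poly (inv_into UNIV e) P"
    have "inv_into UNIV e 0 = 0" using inv_into_f_f[OF inj_f, of 0] by simp
    then have "map_poly e p = P"
      by (intro poly_eqI) (simp add: p_def coeff_map_poly f_inv_into_f[OF cP])
    moreover have "z \<in> S" unfolding S_def by (rule image_eqI[OF _ id_fixing]) simp
    then have "poly P z = 0" unfolding P_def poly_prod using finS by (intro prod_zero) auto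
    ultimately show "z \<in> sep"
      using rsquarefree_prod_linear[OF finS] unfolding sep_def P_def[symmetric]
      by (intro CollectI exI[of _ p]) simp
  qed
qed

lemma subalg_sep: "subalg e sep"
  using subalg_alg_gen[of e sep] by (simp add: alg_gen_sep)

end

section \<open>Polynomials in several variables\<close>

abbreviation "lookup \<equiv> Poly_Mapping.lookup"
abbreviation "keys \<equiv> Poly_Mapping.keys"
abbreviation "single \<equiv> Poly_Mapping.single"
abbreviation "mapc \<equiv> Poly_Mapping.map"
abbreviation mpolys :: "nat \<Rightarrow> 'a::comm_ring_1 mpoly set" where "mpolys n \<equiv> carrier (mpoly_ring n)"

definition monom_eval :: "(nat \<Rightarrow> 'b::comm_ring_1) \<Rightarrow> (nat \<Rightarrow>\<^sub>0 nat) \<Rightarrow> 'b" where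
  "monom_eval a m = (\<Prod>i\<in>keys m. a i ^ lookup m i)"

lemma monom_eval_superset:
  assumes "finite S" "keys m \<subseteq> S"
  shows "monom_eval a m = (\<Prod>i\<in>S. a i ^ lookup m i)"
  unfolding monom_eval_def using assms
  by (intro prod.mono_neutral_left) (auto simp: in_keys_iff)

lemma monom_eval_add: "monom_eval a (m + m') = monom_eval a m * monom_eval a m'"
proof -
  let ?S = "keys m \<union> keys m'"
  have "monom_eval a (m + m') = (\<Prod>i\<in>?S. a i ^ lookup (m + m') i)"
    using Poly_Mapping.keys_add[of m m'] by (intro monom_eval_superset) auto
  also have "\<dots> = (\<Prod>i\<in>?S. a i ^ lookup m i) * (\<Prod>i\<in>?S. a i ^ lookup m' i)"
    by (simp add: lookup_add power_add prod.distrib)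
  also have "\<dots> = monom_eval a m * monom_eval a m'"
    using monom_eval_superset[of ?S m a] monom_eval_superset[of ?S m' a] by simp
  finally show ?thesis .
qed

lemma monom_eval_0 [simp]: "monom_eval a 0 = 1"
  by (simp add: monom_eval_def)

lemma mpoly_eval_superset:
  assumes "finite S" "keys p \<subseteq> S" "h 0 = 0"
  shows "mpoly_eval h a p = (\<Sum>m\<in>S. h (lookup p m) * monom_eval a m)"
  unfolding mpoly_eval_def monom_eval_def[symmetric] using assms
  by (intro sum.mono_neutral_left) (auto simp: in_keys_iff)

lemma mpoly_eval_0 [simp]: "mpoly_eval h a 0 = 0"
  by (simp add: mpoly_eval_def)

lemma mpoly_eval_single:
  "h 0 = 0 \<Longrightarrow> mpoly_eval h a (single m c) = h c * monom_eval a m"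
  by (cases "c = 0") (simp_all add: mpoly_eval_def monom_eval_def)

text \<open>Coefficient maps are only assumed additive, because linear disjointness is tested with
  maps that are linear over K but not multiplicative.\<close>

locale additive_map =
  fixes h :: "'c::comm_ring_1 \<Rightarrow> 'b::comm_ring_1"
  assumes add: "h (x + y) = h x + h y"
begin

lemma zero: "h 0 = 0"
  using add[of 0 0] by simp

lemma eval_add: "mpoly_eval h a (p + q) = mpoly_eval h a p + mpoly_eval h a q"
proof -
  let ?S = "keys p \<union> keys q"
  have "mpoly_eval h a (p + q) = (\<Sum>m\<in>?S. h (lookup (p + q) m) * monom_eval a m)"
    using Poly_Mapping.keys_add[of p q] zero by (intro mpoly_eval_superset) auto
  also have "\<dots> = (\<Sum>m\<in>?S. h (lookup p m) * monom_eval a m)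
      + (\<Sum>m\<in>?S. h (lookup q m) * monom_eval a m)"
    by (simp add: lookup_add add distrib_right sum.distrib)
  also have "\<dots> = mpoly_eval h a p + mpoly_eval h a q"
    using mpoly_eval_superset[of ?S p h a] mpoly_eval_superset[of ?S q h a] zero by simp
  finally show ?thesis .
qed

lemma eval_sum: "mpoly_eval h a (sum f A) = (\<Sum>i\<in>A. mpoly_eval h a (f i))"
  by (induction A rule: infinite_finite_induct) (auto simp: eval_add)

end

lemma poly_mapping_expand:
  fixes p :: "'i \<Rightarrow>\<^sub>0 'a::comm_monoid_add"
  shows "p = (\<Sum>m\<in>keys p. single m (lookup p m))"
proof (rule poly_mapping_eqI)
  fix k
  have "lookup (\<Sum>m\<in>keys p. single m (lookup p m)) k
      = (\<Sum>m\<in>keys p. if m = k then lookup p m else 0)"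
    by (simp add: lookup_sum lookup_single when_def)
  also have "\<dots> = lookup p k"
    by (simp add: in_keys_iff)
  finally show "lookup p k
      = lookup (\<Sum>m\<in>keys p. single m (lookup p m)) k"
    by simp
qed

lemma lookup_map: "e 0 = 0 \<Longrightarrow> lookup (mapc e p) m = e (lookup p m)"
  by transfer (simp add: when_def)

lemma map_add_hom:
  assumes "\<And>x y. e (x + y) = e x + e y" "e 0 = 0"
  shows "mapc e (p + q) = mapc e p + mapc e q"
  by (rule poly_mapping_eqI) (simp add: lookup_map lookup_add assms)

lemma map_sum_hom:
  assumes "\<And>x y. e (x + y) = e x + e y" "e 0 = 0"
  shows "mapc e (sum f A) = (\<Sum>i\<in>A. mapc e (f i))"
  by (induction A rule: infinite_finite_induct)
     (auto simp: map_add_hom[OF assms] map_eq_zero_iff)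

lemma map_single_hom: "e 0 = 0 \<Longrightarrow> mapc e (single m c) = single m (e c)"
  by simp

text \<open>Covers the multiplicativity of the evaluation (\<open>e = id\<close>, \<open>\<mu> = h\<close>) as well as
  evaluations whose coefficient map is only linear over the subring \<open>range e\<close>.\<close>

lemma mpoly_eval_mult_map:
  assumes \<mu>: "additive_map \<mu>" and h: "additive_map h" and e: "\<And>x y. e (x + y) = e x + e y" "e 0 = 0"
    and lin: "\<And>c d. \<mu> (c * e d) = \<mu> c * h d"
  shows "mpoly_eval \<mu> a (p * mapc e q) = mpoly_eval \<mu> a p * mpoly_eval h a q"
proof -
  interpret m: additive_map \<mu> by fact
  interpret h: additive_map h by fact
  have 1: "p * mapc e q = (\<Sum>m\<in>keys p. \<Sum>m'\<in>keys q.
      single (m + m') (lookup p m * e (lookup q m')))"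
  proof -
    have "mapc e q
        = mapc e (\<Sum>m\<in>keys q. single m (lookup q m))"
      by (subst poly_mapping_expand[of q]) simp
    also have "\<dots> = (\<Sum>m\<in>keys q. single m (e (lookup q m)))"
      by (simp add: map_sum_hom[OF e] e)
    finally have mq: "mapc e q
        = (\<Sum>m\<in>keys q. single m (e (lookup q m)))" .
    have "p * mapc e q
        = (\<Sum>m\<in>keys p. single m (lookup p m))
          * (\<Sum>m\<in>keys q. single m (e (lookup q m)))"
      using poly_mapping_expand[of p] mq by simp
    then show ?thesis by (simp add: sum_product mult_single)
  qed
  have "mpoly_eval \<mu> a (p * mapc e q)
      = (\<Sum>m\<in>keys p. \<Sum>m'\<in>keys q.
          \<mu> (lookup p m) * h (lookup q m') * (monom_eval a m * monom_eval a m'))"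
    unfolding 1 by (simp add: m.eval_sum mpoly_eval_single m.zero lin monom_eval_add)
  also have "\<dots> = mpoly_eval \<mu> a p * mpoly_eval h a q"
    unfolding mpoly_eval_superset[where S = "keys p" and h = \<mu>, OF finite_keys order_refl m.zero]
      mpoly_eval_superset[where S = "keys q" and h = h, OF finite_keys order_refl h.zero]
    by (simp add: sum_product mult_ac)
  finally show ?thesis .
qed

lemma map_id: "mapc (\<lambda>x. x) p = p"
  by (rule poly_mapping_eqI) (simp add: lookup_map)

lemma mpoly_eval_hom:
  fixes h :: "'c::comm_ring_1 \<Rightarrow> 'b::comm_ring_1"
  assumes "comm_ring_hom h"
  shows "comm_ring_hom (mpoly_eval h a)"
proof -
  interpret comm_ring_hom h by fact
  interpret additive_map h by standard (rule hom_add)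
  show ?thesis
  proof
    show "mpoly_eval h a 1 = 1"
      using mpoly_eval_single[of h a 0 1] by (simp add: hom_one)
    show "mpoly_eval h a (p * q) = mpoly_eval h a p * mpoly_eval h a q" for p q
      using mpoly_eval_mult_map[OF additive_map_axioms additive_map_axioms, of "\<lambda>x. x" a p q]
      by (simp add: map_id hom_mult)
  qed (auto simp: eval_add)
qed

lemma map_hom:
  fixes e :: "'c::comm_ring_1 \<Rightarrow> 'b::comm_ring_1"
  assumes "comm_ring_hom e"
  shows "comm_ring_hom (mapc e :: 'c mpoly \<Rightarrow> 'b mpoly)"
proof -
  interpret comm_ring_hom e by fact
  note e = hom_add hom_zero
  show ?thesis
  proof
    show "mapc e (p * q) = mapc e p * mapc e q" for p q :: "'c mpoly"
    proof -
      have "mapc e (p * q) = mapc e ((\<Sum>m\<in>keys p. single m (lookup p m))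
        * (\<Sum>m\<in>keys q. single m (lookup q m)))"
        using poly_mapping_expand[of p] poly_mapping_expand[of q] by simp
      also have "\<dots> = mapc e (\<Sum>m\<in>keys p. single m (lookup p m))
        * mapc e (\<Sum>m\<in>keys q. single m (lookup q m))"
        by (simp add: sum_product mult_single map_sum_hom[OF e] hom_mult)
      also have "\<dots> = mapc e p * mapc e q"
        using poly_mapping_expand[of p] poly_mapping_expand[of q] by simp
      finally show ?thesis .
    qed
    show "mapc e 1 = 1"
      using map_single_hom[of e 0 1] by (simp add: hom_one)
  qed (auto simp: map_add_hom[OF e] map_eq_zero_iff)
qed

lemma mpoly_eval_map:
  assumes "e 0 = 0" "h 0 = 0"
  shows "mpoly_eval h a (mapc e p) = mpoly_eval (\<lambda>c. h (e c)) a p"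
proof -
  have "keys (mapc e p) \<subseteq> keys p"
    using assms by (auto simp: in_keys_iff lookup_map)
  then show ?thesis
    using assms mpoly_eval_superset[of "keys p" "mapc e p" h a]
      mpoly_eval_superset[of "keys p" p "\<lambda>c. h (e c)" a]
    by (simp add: lookup_map)
qed

lemma mpoly_eval_comp:
  assumes "comm_ring_hom g" "h 0 = 0"
  shows "g (mpoly_eval h a p) = mpoly_eval (\<lambda>c. g (h c)) (\<lambda>i. g (a i)) p"
proof -
  interpret comm_ring_hom g by fact
  show ?thesis by (simp add: mpoly_eval_def hom_sum hom_mult hom_prod hom_power)
qed

lemma mpoly_CHAR: "CHAR('a::comm_ring_1 mpoly) = CHAR('a)"
proof (rule dvd_antisym)
  have *: "of_nat n = (0::'a mpoly) \<longleftrightarrow> of_nat n = (0::'a)" for n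
  proof -
    have "of_nat n = (0::'a mpoly) \<longleftrightarrow> single 0 (of_nat n) = (0::'a mpoly)"
      by (simp only: single_of_nat)
    also have "\<dots> \<longleftrightarrow> of_nat n = (0::'a)"
      by (metis lookup_single_eq lookup_zero single_zero)
    finally show ?thesis .
  qed
  show "CHAR('a mpoly) dvd CHAR('a)" using *[of "CHAR('a)"] by (simp add: of_nat_eq_0_iff_char_dvd)
  show "CHAR('a) dvd CHAR('a mpoly)" using *[of "CHAR('a mpoly)"] by (simp add: of_nat_eq_0_iff_char_dvd)
qed

section \<open>The ring in n variables and its ideals\<close>

lemma mpoly_ring_simps [simp]:
  "monoid.mult (mpoly_ring n) = (*)" "ring.add (mpoly_ring n) = (+)"
  "monoid.one (mpoly_ring n) = 1" "ring.zero (mpoly_ring n) = 0"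
  by (simp_all add: mpoly_ring_def ring_of_type_algebra_def)

lemma carrier_mpoly_ring:
  "p \<in> mpolys n \<longleftrightarrow> (\<forall>m\<in>keys p. keys m \<subseteq> {..<n})"
  by (simp add: mpoly_ring_def)

lemma mpoly_ring_single [intro]:
  "keys m \<subseteq> {..<n} \<Longrightarrow> single m c \<in> mpolys n"
  by (auto simp: carrier_mpoly_ring split: if_splits)

lemma mpoly_ring_add: "p \<in> mpolys n \<Longrightarrow> q \<in> mpolys n \<Longrightarrow> p + q \<in> mpolys n"
  using Poly_Mapping.keys_add[of p q] by (auto simp: carrier_mpoly_ring)

lemma mpoly_ring_mult: 
  assumes "p \<in> mpolys n" "q \<in> mpolys n"
  shows "p * q \<in> mpolys n"
  unfolding carrier_mpoly_ring
proof
  fix m assume "m \<in> keys (p * q)"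
  then obtain a b where m: "m = a + b" "a \<in> keys p" "b \<in> keys q"
    using keys_mult[of p q] by blast
  then have "keys a \<subseteq> {..<n}" "keys b \<subseteq> {..<n}"
    using assms by (simp_all only: carrier_mpoly_ring)
  then show "keys m \<subseteq> {..<n}" using m Poly_Mapping.keys_add[of a b] by auto
qed

lemma mpoly_ring_0: "0 \<in> mpolys n"
  by (simp add: carrier_mpoly_ring)

lemma mpoly_ring_1: "1 \<in> mpolys n"
  using mpoly_ring_single[of 0 n 1] by simp

lemma mpoly_ring_uminus: "p \<in> mpolys n \<Longrightarrow> - p \<in> mpolys n"
  by (auto simp: carrier_mpoly_ring in_keys_iff)

lemma mpoly_ring_sum: "(\<And>i. i \<in> A \<Longrightarrow> f i \<in> mpolys n) \<Longrightarrow> sum f A \<in> mpolys n"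
  by (induction A rule: infinite_finite_induct) (auto intro: mpoly_ring_0 mpoly_ring_add)

lemma mpoly_ring_prod: "(\<And>i. i \<in> A \<Longrightarrow> f i \<in> mpolys n) \<Longrightarrow> prod f A \<in> mpolys n"
  by (induction A rule: infinite_finite_induct) (auto intro: mpoly_ring_1 mpoly_ring_mult)

lemma mpoly_ring_power: "p \<in> mpolys n \<Longrightarrow> p ^ k \<in> mpolys n"
  by (induction k) (auto intro: mpoly_ring_1 mpoly_ring_mult)

lemma mpoly_ring_map: "e 0 = 0 \<Longrightarrow> p \<in> mpolys n \<Longrightarrow> mapc e p \<in> mpolys n"
  by (metis carrier_mpoly_ring in_keys_iff lookup_map)

lemma cring_mpoly_ring: "cring (mpoly_ring n :: 'a::comm_ring_1 mpoly ring)"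
proof (rule cringI)
  show "abelian_group (mpoly_ring n :: 'a mpoly ring)"
  proof (rule abelian_groupI)
    fix x :: "'a mpoly" assume "x \<in> mpolys n"
    then show "\<exists>y\<in>mpolys n. y \<oplus>\<^bsub>mpoly_ring n\<^esub> x = \<zero>\<^bsub>mpoly_ring n\<^esub>"
      by (intro bexI[of _ "- x"]) (auto intro: mpoly_ring_uminus)
  qed (auto simp: add_ac intro: mpoly_ring_0 mpoly_ring_add)
  show "Group.comm_monoid (mpoly_ring n :: 'a mpoly ring)"
    by (rule comm_monoidI) (auto simp: mult_ac intro: mpoly_ring_1 mpoly_ring_mult)
qed (auto simp: distrib_right)

lemma ideal_mpolyD:
  assumes "ideal I (mpoly_ring n)"
  shows "p \<in> I \<Longrightarrow> p \<in> mpolys n" "0 \<in> I" "p \<in> I \<Longrightarrow> q \<in> I \<Longrightarrow> p + q \<in> I"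
    "p \<in> I \<Longrightarrow> q \<in> mpolys n \<Longrightarrow> q * p \<in> I"
proof -
  interpret ideal I "mpoly_ring n" by fact
  show "p \<in> I \<Longrightarrow> p \<in> mpolys n" by (rule a_Hcarr)
  show "0 \<in> I" using additive_subgroup.zero_closed[OF additive_subgroup_axioms] by simp
  show "p \<in> I \<Longrightarrow> q \<in> I \<Longrightarrow> p + q \<in> I" using additive_subgroup.a_closed[OF additive_subgroup_axioms, of p q] by simp
  show "p \<in> I \<Longrightarrow> q \<in> mpolys n \<Longrightarrow> q * p \<in> I" using I_l_closed by simp
qed

lemma ideal_mpolyI:
  fixes I :: "'a::comm_ring_1 mpoly set"
  assumes "I \<subseteq> mpolys n" "0 \<in> I" "\<And>p q. p \<in> I \<Longrightarrow> q \<in> I \<Longrightarrow> p + q \<in> I"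
    "\<And>p q. p \<in> I \<Longrightarrow> q \<in> mpolys n \<Longrightarrow> q * p \<in> I"
  shows "ideal I (mpoly_ring n)"
proof -
  interpret cring "mpoly_ring n :: 'a mpoly ring" by (rule cring_mpoly_ring)
  show ?thesis
  proof (rule idealI[OF ring_axioms])
    show "subgroup I (add_monoid (mpoly_ring n))"
    proof (rule add.subgroupI)
      show "I \<subseteq> mpolys n" "I \<noteq> {}" using assms by auto
      fix a assume a: "a \<in> I"
      have "- 1 * a \<in> I"
        using a by (rule assms(4)) (rule mpoly_ring_uminus[OF mpoly_ring_1])
      moreover have "\<ominus>\<^bsub>mpoly_ring n\<^esub> a = - a"
        using a assms(1) by (intro minus_equality) (auto intro: mpoly_ring_uminus)
      ultimately show "\<ominus>\<^bsub>mpoly_ring n\<^esub> a \<in> I" by simp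
    next
      fix a b assume "a \<in> I" "b \<in> I"
      then show "a \<oplus>\<^bsub>mpoly_ring n\<^esub> b \<in> I" using assms(3) by simp
    qed
  qed (use assms in \<open>auto simp: mult.commute\<close>)
qed

lemma primeideal_kernel:
  fixes h :: "'a::comm_ring_1 \<Rightarrow> 'b::idom"
  assumes "comm_ring_hom h"
  shows "primeideal {p \<in> mpolys n. mpoly_eval h a p = 0} (mpoly_ring n)" (is "primeideal ?I _")
proof -
  interpret comm_ring_hom "mpoly_eval h a" using assms by (rule mpoly_eval_hom)
  have "ideal ?I (mpoly_ring n)"
    by (rule ideal_mpolyI) (auto simp: hom_add hom_mult intro: mpoly_ring_0 mpoly_ring_add mpoly_ring_mult)
  then show ?thesis
  proof (rule primeidealI[OF _ cring_mpoly_ring])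
    have "1 \<notin> ?I" by (simp add: hom_one)
    then show "mpolys n \<noteq> ?I" using mpoly_ring_1 by metis
  qed (auto simp: hom_mult)
qed

lemma ideal_relation_ideal: "comm_ring_hom h \<Longrightarrow> ideal (relation_ideal h n x) (mpoly_ring n)"
proof -
  assume "comm_ring_hom h"
  then interpret comm_ring_hom "mpoly_eval h x" by (rule mpoly_eval_hom)
  show ?thesis
    unfolding relation_ideal_def
    by (rule ideal_mpolyI) (auto simp: hom_add hom_mult intro: mpoly_ring_0 mpoly_ring_add mpoly_ring_mult)
qed

section \<open>Base change to the algebraic closure\<close>

lemma to_ac_hom: "field_hom (to_ac :: 'k::field \<Rightarrow> 'k alg_closure)"
  by standard auto

lemma to_ac_algebraic_closure_ext: "algebraic_closure_ext (to_ac :: 'k::field \<Rightarrow> 'k alg_closure)"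
proof -
  interpret field_hom "to_ac :: 'k \<Rightarrow> 'k alg_closure" by (rule to_ac_hom)
  show ?thesis by standard (use alg_closure_algebraic in blast)
qed

interpretation ac: algebraic_closure_ext "to_ac :: 'k::field \<Rightarrow> 'k alg_closure"
  by (rule to_ac_algebraic_closure_ext)

lemma ideal_base_change:
  assumes "I \<subseteq> mpolys n"
  shows "ideal (base_change n I) (mpoly_ring n)"
    "g \<in> I \<Longrightarrow> mapc to_ac g \<in> base_change n I"
proof -
  interpret cring "mpoly_ring n :: 'a alg_closure mpoly ring" by (rule cring_mpoly_ring)
  have "mapc to_ac ` I \<subseteq> mpolys n"
    using assms by (auto intro!: mpoly_ring_map)
  then show "ideal (base_change n I) (mpoly_ring n)"
    "g \<in> I \<Longrightarrow> mapc to_ac g \<in> base_change n I"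
    unfolding base_change_def using genideal_ideal genideal_self by blast+
qed

lemma base_change_induct [consumes 2, case_names zero add mult]:
  assumes I: "I \<subseteq> mpolys n" and p: "p \<in> base_change n I"
    and P0: "P 0" and add: "\<And>p q. P p \<Longrightarrow> P q \<Longrightarrow> P (p + q)"
    and mult: "\<And>q g. q \<in> mpolys n \<Longrightarrow> g \<in> I \<Longrightarrow> P (q * mapc to_ac g)"
  shows "P p"
proof -
  interpret cring "mpoly_ring n :: 'a alg_closure mpoly ring" by (rule cring_mpoly_ring)
  \<comment> \<open>Quantifying over all multiples of p makes \<open>T\<close> an ideal, although P
    is not assumed stable under multiplication.\<close>
  define T where "T = {p \<in> mpolys n. \<forall>q\<in>mpolys n. P (q * p)}"
  have "ideal T (mpoly_ring n)"
  proof (rule ideal_mpolyI)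
    fix p q assume "p \<in> T" "q \<in> T"
    then show "p + q \<in> T" by (auto simp: T_def distrib_left intro: mpoly_ring_add add)
  next
    fix p q :: "'a alg_closure mpoly" assume "p \<in> T" "q \<in> mpolys n"
    then show "q * p \<in> T"
      by (auto simp: T_def mult.assoc[symmetric] intro: mpoly_ring_mult)
  qed (auto simp: T_def P0 intro: mpoly_ring_0)
  moreover have "mapc to_ac ` I \<subseteq> T"
    using I mult by (auto simp: T_def intro!: mpoly_ring_map)
  ultimately have "base_change n I \<subseteq> T"
    unfolding base_change_def by (rule genideal_minimal)
  then have "P (1 * p)" using p mpoly_ring_1 unfolding T_def by blast
  then show ?thesis by simp
qed

text \<open>Linearity of \<mu> over the base field is enough: on the product of q with a generator g
  the evaluation along \<mu> splits into that of q times the value of g, which is zero.\<close>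

lemma base_change_zero:
  assumes \<mu>: "additive_map \<mu>" and h: "additive_map h" "\<And>v c. \<mu> (v * to_ac c) = \<mu> v * h c"
    and I: "I \<subseteq> mpolys n" "\<And>g. g \<in> I \<Longrightarrow> mpoly_eval h y g = 0"
    and p: "p \<in> base_change n I"
  shows "mpoly_eval \<mu> y p = 0"
  using I(1) p
proof (induction rule: base_change_induct)
  case (mult q g)
  have "mpoly_eval \<mu> y (q * mapc to_ac g) = mpoly_eval \<mu> y q * mpoly_eval h y g"
    by (rule mpoly_eval_mult_map[OF \<mu> h(1) _ _ h(2)]) auto
  then show ?case using mult I(2) by simp
qed (auto simp: additive_map.eval_add[OF \<mu>])

lemma primeideal_prod:
  fixes J :: "'a::comm_ring_1 mpoly set"
  assumes J: "primeideal J (mpoly_ring n)" and "finite A"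
    and "\<And>i. i \<in> A \<Longrightarrow> f i \<in> mpolys n" "prod f A \<in> J"
  shows "\<exists>i\<in>A. f i \<in> J"
  using assms(2-4)
proof (induction A)
  case empty
  interpret primeideal J "mpoly_ring n" by fact
  have "J = mpolys n" using one_imp_carrier empty by simp
  then show ?case using I_notcarr by simp
next
  case (insert i A)
  interpret primeideal J "mpoly_ring n" by fact
  have "f i * prod f A \<in> J" using insert by simp
  then have "f i \<in> J \<or> prod f A \<in> J"
    using I_prime[of "f i" "prod f A"] insert.prems(1) mpoly_ring_prod[of A f n] by simp
  then show ?case using insert by auto
qed

text \<open>The generators have coefficients in the base field, so conjugation only changes their
  multipliers.\<close>

lemma base_change_map:
  assumes I: "I \<subseteq> mpolys n" and \<sigma>: "\<sigma> \<in> fixing (range to_ac)" and p: "p \<in> base_change n I"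
  shows "mapc \<sigma> p \<in> base_change n I"
proof -
  interpret s: field_hom \<sigma> using \<sigma> by (rule fixing_hom)
  interpret m: comm_ring_hom "mapc \<sigma> :: _ mpoly \<Rightarrow> _" by (rule map_hom) unfold_locales
  note J = ideal_mpolyD[OF ideal_base_change(1)[OF I]]
  show ?thesis
    using I p
  proof (induction rule: base_change_induct)
    case zero
    then show ?case using J(2) by simp
  next
    case (add p q)
    then show ?case using J(3) by (simp add: m.hom_add)
  next
    case (mult q g)
    have "mapc \<sigma> (mapc to_ac g) = mapc to_ac g"
      using fixing_fix[OF \<sigma>] by (intro poly_mapping_eqI) (simp add: lookup_map)
    then show ?case
      using mult J(4)[OF ideal_base_change(2)[OF I]] by (simp add: m.hom_mult mpoly_ring_map)
  qed
qed

text \<open>The norm of \<open>p\<close>, raised to a power of the characteristic exponent, has coefficients in the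
  base field.\<close>

theorem kernel_subset_base_change:
  fixes \<iota> :: "'k::field \<Rightarrow> 'r::comm_ring_1" and j :: "'k alg_closure \<Rightarrow> 'o::field" and h :: "'r \<Rightarrow> 'o"
  assumes \<iota>: "comm_ring_hom \<iota>" and j: "field_hom j" and h: "comm_ring_hom h" "\<And>r. h r = 0 \<Longrightarrow> r = 0"
    and jh: "\<And>c. j (to_ac c) = h (\<iota> c)"
    and prime: "primeideal (base_change n (relation_ideal \<iota> n x)) (mpoly_ring n)"
    and p: "p \<in> mpolys n" "mpoly_eval j (\<lambda>i. h (x i)) p = 0"
  shows "p \<in> base_change n (relation_ideal \<iota> n x)" (is "_ \<in> ?J")
proof -
  let ?I = "relation_ideal \<iota> n x"
  let ?\<Gamma> = "fixing (range (to_ac :: 'k \<Rightarrow> 'k alg_closure))"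
  let ?m = "\<lambda>\<sigma>. mapc \<sigma> :: 'k alg_closure mpoly \<Rightarrow> 'k alg_closure mpoly"
  interpret j: field_hom j by fact
  interpret h: comm_ring_hom h by fact
  interpret \<iota>: comm_ring_hom \<iota> by fact
  interpret ej: comm_ring_hom "mpoly_eval j (\<lambda>i. h (x i))" by (rule mpoly_eval_hom) unfold_locales
  have I: "?I \<subseteq> mpolys n" by (auto simp: relation_ideal_def)
  \<comment> \<open>The conjugates of p; they are finitely many because p has finitely many
    coefficients, each with a finite orbit. Their product N is the norm.\<close>
  define S where "S = (\<lambda>\<sigma>. ?m \<sigma> p) ` ?\<Gamma>"
  have S_carrier: "w \<in> mpolys n" if "w \<in> S" for w
  proof -
    obtain \<sigma> where \<sigma>: "\<sigma> \<in> ?\<Gamma>" "w = ?m \<sigma> p" using \<open>w \<in> S\<close> by (auto simp: S_def)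
    have "\<sigma> 0 = 0" using fixing_fix[OF \<sigma>(1), of "to_ac 0"] by simp
    then show ?thesis unfolding \<sigma>(2) using p(1) by (rule mpoly_ring_map)
  qed
  have finS: "finite S"
  proof -
    let ?W = "PiE (keys p) (\<lambda>m. (\<lambda>\<sigma>. \<sigma> (lookup p m)) ` ?\<Gamma>)"
    have "?m \<sigma> p \<in> (\<lambda>g. \<Sum>m\<in>keys p. single m (g m)) ` ?W" if \<sigma>: "\<sigma> \<in> ?\<Gamma>" for \<sigma>
    proof (rule image_eqI)
      interpret s: field_hom \<sigma> using \<sigma> by (rule fixing_hom)
      show "?m \<sigma> p = (\<Sum>m\<in>keys p. single m (restrict (\<lambda>m. \<sigma> (lookup p m)) (keys p) m))"
        by (subst poly_mapping_expand[of p]) (simp add: map_sum_hom s.hom_add)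
    qed (use \<sigma> in auto)
    then have "S \<subseteq> (\<lambda>g. \<Sum>m\<in>keys p. single m (g m)) ` ?W" by (auto simp: S_def)
    moreover have "finite ?W" by (intro finite_PiE) (auto intro: ac.finite_orbit)
    ultimately show ?thesis by (meson finite_imageI finite_subset)
  qed
  define N where "N = \<Prod>S"
  have stable: "?m \<sigma> N = N" if \<sigma>: "\<sigma> \<in> ?\<Gamma>" for \<sigma>
  proof -
    interpret s: field_hom \<sigma> using \<sigma> by (rule fixing_hom)
    interpret m: comm_ring_hom "?m \<sigma>" by (rule map_hom) unfold_locales
    have comp: "?m \<sigma> (?m \<tau> p) = ?m (\<lambda>c. \<sigma> (\<tau> c)) p" if "\<tau> 0 = 0" for \<tau>
      by (rule poly_mapping_eqI) (simp add: lookup_map that)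
    have t0: "\<tau> 0 = 0" if "\<tau> \<in> ?\<Gamma>" for \<tau>
      using fixing_fix[OF that, of "to_ac 0"] by simp
    have "?m \<sigma> ` S \<subseteq> S"
    proof
      fix w assume "w \<in> ?m \<sigma> ` S"
      then obtain \<tau> where \<tau>: "\<tau> \<in> ?\<Gamma>" "w = ?m \<sigma> (?m \<tau> p)" by (auto simp: S_def)
      then show "w \<in> S" using comp[of \<tau>, OF t0[OF \<tau>(1)]] fixing_comp[OF \<sigma> \<tau>(1)] by (auto simp: S_def)
    qed
    moreover have inj: "inj_on (?m \<sigma>) S"
    proof (rule inj_onI)
      fix u v assume uv: "?m \<sigma> u = ?m \<sigma> v"
      have "\<sigma> (lookup u k) = \<sigma> (lookup v k)" for k
        using arg_cong[OF uv, of "\<lambda>q. lookup q k"] by (simp add: lookup_map)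
      then show "u = v" by (intro poly_mapping_eqI) simp
    qed
    ultimately have im: "?m \<sigma> ` S = S" using finS by (intro endo_inj_surj)
    have "?m \<sigma> N = (\<Prod>w\<in>S. ?m \<sigma> w)" unfolding N_def by (rule m.hom_prod)
    also have "\<dots> = \<Prod>(?m \<sigma> ` S)" using inj by (simp add: prod.reindex)
    finally show ?thesis by (simp add: im N_def)
  qed
  let ?c = "char_exp TYPE('k alg_closure)"
  have "\<exists>k. lookup N m ^ (?c ^ k) \<in> range to_ac" for m
  proof (rule ac.fixed_power)
    fix \<sigma> assume \<sigma>: "\<sigma> \<in> ?\<Gamma>"
    interpret s: field_hom \<sigma> using \<sigma> by (rule fixing_hom)
    show "\<sigma> (lookup N m) = lookup N m"
      using arg_cong[OF stable[OF \<sigma>], of "\<lambda>q. lookup q m"] by (simp add: lookup_map)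
  qed
  then obtain k where "\<forall>m\<in>keys N. lookup N m ^ (?c ^ k) \<in> range to_ac"
    using ac.uniform_power[OF finite_keys, of N "lookup N"] by blast
  then have k: "\<exists>b. lookup N m ^ (?c ^ k) = to_ac b" if "m \<in> keys N" for m
    using that by blast
  have single_power: "\<exists>m'. single m a ^ i = single m' (a ^ i)"
    for m :: "nat \<Rightarrow>\<^sub>0 nat" and a :: "'k alg_closure" and i
  proof (induction i)
    case 0
    show ?case by (rule exI[of _ 0]) simp
  next
    case (Suc i)
    then obtain m' where "single m a ^ i = single m' (a ^ i)" by blast
    then show ?case by (intro exI[of _ "m + m'"]) (simp add: mult_single)
  qed
  have "\<exists>r. N ^ (?c ^ k) = mapc to_ac r"
  proof -
    have "N ^ (?c ^ k)
        = (\<Sum>m\<in>keys N. single m (lookup N m)) ^ (?c ^ k)"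
      using poly_mapping_expand[of N] by simp
    also have "\<dots> = (\<Sum>m\<in>keys N. single m (lookup N m) ^ (?c ^ k))"
      by (rule frobenius_sum) (rule mpoly_CHAR)
    finally have eq: "N ^ (?c ^ k)
        = (\<Sum>m\<in>keys N. single m (lookup N m) ^ (?c ^ k))" .
    have "\<exists>r. single m (lookup N m) ^ (?c ^ k) = mapc to_ac r"
      if m: "m \<in> keys N" for m
    proof -
      obtain m' where "single m (lookup N m) ^ (?c ^ k)
          = single m' (lookup N m ^ (?c ^ k))" using single_power by blast
      moreover obtain b where "lookup N m ^ (?c ^ k) = to_ac b" using k[OF m] by blast
      ultimately show ?thesis by (intro exI[of _ "single m' b"]) simp
    qed
    then obtain r where "\<And>m. m \<in> keys N \<Longrightarrow>
      single m (lookup N m) ^ (?c ^ k) = mapc to_ac (r m)" by metis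
    then have "N ^ (?c ^ k) = mapc to_ac (\<Sum>m\<in>keys N. r m)"
      unfolding eq by (simp add: map_sum_hom)
    then show ?thesis by blast
  qed
  then obtain r where r: "N ^ (?c ^ k) = mapc to_ac r" by blast
  have N_carrier: "N \<in> mpolys n"
    unfolding N_def using S_carrier by (intro mpoly_ring_prod) auto
  have "r \<in> ?I"
    unfolding relation_ideal_def
  proof (intro CollectI conjI)
    have "mapc to_ac r \<in> mpolys n"
      unfolding r[symmetric] using N_carrier by (rule mpoly_ring_power)
    then show "r \<in> mpolys n"
      by (simp add: carrier_mpoly_ring in_keys_iff lookup_map)
    have "p \<in> S" unfolding S_def by (rule image_eqI[OF _ id_fixing]) (simp add: map_id)
    then have "mpoly_eval j (\<lambda>i. h (x i)) N = 0"
      unfolding N_def ej.hom_prod using finS p(2) by (intro prod_zero) auto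
    then have "mpoly_eval j (\<lambda>i. h (x i)) (mapc to_ac r) = 0"
      unfolding r[symmetric] by (simp add: ej.hom_power char_exp_pos)
    also have "mpoly_eval j (\<lambda>i. h (x i)) (mapc to_ac r) = h (mpoly_eval \<iota> x r)"
      by (simp add: mpoly_eval_map mpoly_eval_comp[OF h(1)] jh)
    finally show "mpoly_eval \<iota> x r = 0" by (rule h(2))
  qed
  then have "mapc to_ac r \<in> ?J" by (rule ideal_base_change(2)[OF I])
  \<comment> \<open>Primality is used twice: for the power of N, written as a product, and for N
    itself. It yields a conjugate of p in the ideal, and the inverse automorphism brings back
    p.\<close>
  then have "(\<Prod>i<?c ^ k. N) \<in> ?J" by (simp add: r)
  then have "N \<in> ?J"
    using primeideal_prod[OF prime, of "{..<?c ^ k}" "\<lambda>_. N"] N_carrier by auto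
  then obtain w where "w \<in> S" "w \<in> ?J"
    using primeideal_prod[OF prime finS, of "\<lambda>w. w"] S_carrier by (auto simp: N_def)
  then obtain \<sigma> where \<sigma>: "\<sigma> \<in> ?\<Gamma>" "?m \<sigma> p \<in> ?J" by (auto simp: S_def)
  have "?m (inv_into UNIV \<sigma>) (?m \<sigma> p) \<in> ?J"
    using base_change_map[OF I ac.fixing_inv(1)[OF \<sigma>(1)] \<sigma>(2)] .
  also have "?m (inv_into UNIV \<sigma>) (?m \<sigma> p) = p"
  proof -
    have "\<sigma> 0 = 0" using fixing_fix[OF \<sigma>(1), of "to_ac 0"] by simp
    moreover have "inv_into UNIV \<sigma> 0 = 0"
      using fixing_fix[OF ac.fixing_inv(1)[OF \<sigma>(1)], of "to_ac 0"] by simp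
    ultimately show ?thesis
      by (intro poly_mapping_eqI) (simp add: lookup_map ac.fixing_inv(3)[OF \<sigma>(1)])
  qed
  finally show ?thesis .
qed

section \<open>Linear disjointness\<close>

text \<open>Linear disjointness of \<open>D\<close> and the algebraic closure over \<open>K\<close>: the map
  \<open>\<mu> \<otimes> 1\<close> on the tensor product factors through the compositum.\<close>

definition lin_disjoint :: "('k::field alg_closure \<Rightarrow> 'o::field) \<Rightarrow> 'o set \<Rightarrow> bool" where
  "lin_disjoint j D \<longleftrightarrow> (\<forall>(A :: nat set) v d \<mu>. finite A \<longrightarrow> (\<forall>i\<in>A. d i \<in> D) \<longrightarrow>
     (\<forall>x y. \<mu> (x + y) = \<mu> x + \<mu> y) \<longrightarrow> (\<forall>x c. \<mu> (x * to_ac c) = \<mu> x * j (to_ac c)) \<longrightarrow>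
     (\<Sum>i\<in>A. j (v i) * d i) = 0 \<longrightarrow> (\<Sum>i\<in>A. \<mu> (v i) * d i) = 0)"

text \<open>The definition fixes the index type \<open>nat\<close>, as it cannot quantify over
  types; a bijection with an initial segment removes the restriction.\<close>

lemma lin_disjointD:
  fixes A :: "'i set"
  assumes "lin_disjoint j D" "finite A" "\<And>i. i \<in> A \<Longrightarrow> d i \<in> D"
    "\<And>x y. \<mu> (x + y) = \<mu> x + \<mu> y" "\<And>x c. \<mu> (x * to_ac c) = \<mu> x * j (to_ac c)"
    "(\<Sum>i\<in>A. j (v i) * d i) = 0"
  shows "(\<Sum>i\<in>A. \<mu> (v i) * d i) = 0"
proof -
  obtain b where b: "bij_betw b {..<card A} A"
    using ex_bij_betw_nat_finite[OF assms(2)] by (auto simp: atLeast0LessThan)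
  have "(\<Sum>k<card A. j (v (b k)) * d (b k)) = 0"
    using sum.reindex_bij_betw[OF b, of "\<lambda>i. j (v i) * d i"] assms(6) by simp
  moreover have "\<forall>k\<in>{..<card A}. d (b k) \<in> D"
    using b assms(3) by (auto simp: bij_betw_def)
  ultimately have "(\<Sum>k<card A. \<mu> (v (b k)) * d (b k)) = 0"
    using assms(1)[unfolded lin_disjoint_def, rule_format, of "{..<card A}" "\<lambda>k. d (b k)" \<mu> "\<lambda>k. v (b k)"]
      assms(4,5) by auto
  then show ?thesis
    using sum.reindex_bij_betw[OF b, of "\<lambda>i. \<mu> (v i) * d i"] by simp
qed

text \<open>The relation is the value of a polynomial p over the algebraic closure. By absolute
  irreducibility p lies in the base-changed ideal (\<open>kernel_subset_base_change\<close>), and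
  there evaluation along \<mu> vanishes as well (\<open>base_change_zero\<close>).\<close>

lemma lin_disjoint_range:
  fixes \<iota> :: "'k::field \<Rightarrow> 'r::comm_ring_1" and j :: "'k alg_closure \<Rightarrow> 'o::field" and h :: "'r \<Rightarrow> 'o"
  assumes "affine_algebra \<iota> n x" and j: "field_hom j"
    and h: "comm_ring_hom h" "\<And>r. h r = 0 \<Longrightarrow> r = 0"
    and jh: "\<And>c. j (to_ac c) = h (\<iota> c)"
    and irr: "absolutely_irreducible n (relation_ideal \<iota> n x)"
  shows "lin_disjoint j (range h)"
  unfolding lin_disjoint_def
proof (intro allI impI)
  fix A :: "nat set" and v d \<mu>
  assume A: "finite A" and d: "\<forall>i\<in>A. d i \<in> range h" and add: "\<forall>x y. \<mu> (x + y) = \<mu> x + \<mu> y"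
    and lin: "\<forall>x c. \<mu> (x * to_ac c) = \<mu> x * j (to_ac c)" and zero: "(\<Sum>i\<in>A. j (v i) * d i) = 0"
  have \<iota>: "comm_ring_hom \<iota>" and surj: "mpoly_eval \<iota> x ` mpolys n = UNIV"
    using assms(1) by (auto simp: affine_algebra_def)
  interpret \<iota>: comm_ring_hom \<iota> by fact
  interpret h: comm_ring_hom h by fact
  interpret j: field_hom j by fact
  interpret \<mu>: additive_map \<mu> by standard (use add in blast)
  interpret ja: additive_map j by standard (rule j.hom_add)
  interpret ha: additive_map "\<lambda>c. h (\<iota> c)" by standard (simp add: \<iota>.hom_add h.hom_add)
  interpret jc: comm_ring_hom "mpoly_eval j (\<lambda>i. h (x i))" by (rule mpoly_eval_hom) unfold_locales
  have "\<forall>i\<in>A. \<exists>p. p \<in> mpolys n \<and> d i = h (mpoly_eval \<iota> x p)"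
    using d surj by (metis (no_types, lifting) imageE UNIV_I)
  then obtain P where P: "\<And>i. i \<in> A \<Longrightarrow> P i \<in> mpolys n"
    "\<And>i. i \<in> A \<Longrightarrow> d i = h (mpoly_eval \<iota> x (P i))" by metis
  define a where "a = (\<lambda>i. h (x i))"
  have ev: "h (mpoly_eval \<iota> x q) = mpoly_eval (\<lambda>c. h (\<iota> c)) a q" for q
    unfolding a_def by (rule mpoly_eval_comp[OF h(1)]) simp
  define p where "p = (\<Sum>i\<in>A. single 0 (v i) * mapc to_ac (P i))"
  have eval_p: "mpoly_eval \<nu> a p = (\<Sum>i\<in>A. \<nu> (v i) * d i)"
    if "additive_map \<nu>" "\<And>x c. \<nu> (x * to_ac c) = \<nu> x * h (\<iota> c)" for \<nu>
  proof -
    interpret n: additive_map \<nu> by fact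
    have "mpoly_eval \<nu> a (single 0 (v i) * mapc to_ac (P i))
        = \<nu> (v i) * mpoly_eval (\<lambda>c. h (\<iota> c)) a (P i)" for i
      by (subst mpoly_eval_mult_map[OF that(1) ha.additive_map_axioms _ _ that(2)])
         (simp_all add: mpoly_eval_single n.zero)
    then show ?thesis
      unfolding p_def n.eval_sum by (intro sum.cong refl) (simp add: P(2) ev)
  qed
  have I: "relation_ideal \<iota> n x \<subseteq> mpolys n" by (auto simp: relation_ideal_def)
  have "mpoly_eval j a p = 0"
    using eval_p[OF ja.additive_map_axioms] zero by (simp add: j.hom_mult jh)
  moreover have "p \<in> mpolys n"
    unfolding p_def by (intro mpoly_ring_sum mpoly_ring_mult mpoly_ring_map P) auto
  ultimately have pJ: "p \<in> base_change n (relation_ideal \<iota> n x)"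
    using kernel_subset_base_change[OF \<iota> j h jh irr[unfolded absolutely_irreducible_def]]
    by (simp add: a_def)
  have "mpoly_eval \<mu> a p = 0"
    by (rule base_change_zero[OF \<mu>.additive_map_axioms ha.additive_map_axioms _ I _ pJ])
       (use lin jh ev in \<open>auto simp: relation_ideal_def simp flip: ev\<close>)
  then show "(\<Sum>i\<in>A. \<mu> (v i) * d i) = 0"
    using eval_p[OF \<mu>.additive_map_axioms] lin jh by simp
qed

interpretation ac_pair: vector_space_pair "\<lambda>c (z :: 'k::field alg_closure). to_ac c * z" "(*) :: 'k \<Rightarrow> 'k \<Rightarrow> 'k"
  by standard (auto simp: algebra_simps)

text \<open>Expand the coefficients of p in a basis of their span over K, with coordinate
  functionals \<rho> b. Linear disjointness applied to \<kappa> \<circ> \<rho> b shows that each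
  coordinate polynomial is a relation over K, and p is a combination of these. As a kernel, the base
  change is then prime.\<close>

theorem kernel_eq_base_change:
  fixes \<kappa> :: "'k::field \<Rightarrow> 'o::field" and j :: "'k alg_closure \<Rightarrow> 'o"
  assumes j: "field_hom j" and \<kappa>: "\<And>c. \<kappa> c = j (to_ac c)"
    and D: "subalg \<kappa> D" "lin_disjoint j D" "\<And>i. i < n \<Longrightarrow> y i \<in> D"
  shows "base_change n (relation_ideal \<kappa> n y) = {p \<in> mpolys n. mpoly_eval j y p = 0}"
proof -
  let ?I = "relation_ideal \<kappa> n y"
  interpret j: field_hom j by fact
  interpret jc: comm_ring_hom "mpoly_eval j y" by (rule mpoly_eval_hom) unfold_locales
  interpret \<kappa>: field_hom \<kappa> unfolding \<kappa>[abs_def] by standard (auto simp: j.hom_add j.hom_mult)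
  have I: "?I \<subseteq> mpolys n" by (auto simp: relation_ideal_def)
  note J = ideal_mpolyD[OF ideal_base_change(1)[OF I]]
  have ker: "mpoly_eval j y p = 0" if "p \<in> base_change n ?I" for p
    by (rule base_change_zero[OF _ _ _ I _ that, where h = \<kappa>])
       (auto simp: relation_ideal_def additive_map_def j.hom_add j.hom_mult \<kappa>.hom_add \<kappa>)
  have "p \<in> base_change n ?I" if p: "p \<in> mpolys n" "mpoly_eval j y p = 0" for p
  proof -
    let ?V = "lookup p ` keys p"
    obtain B where B: "B \<subseteq> ?V" "ac.vs.independent B" "?V \<subseteq> ac.vs.span B"
      using ac.vs.maximal_independent_subset[of ?V] by blast
    have finB: "finite B" using B(1) by (rule finite_subset) auto
    have "\<exists>\<rho>. Vector_Spaces.linear (\<lambda>c z. to_ac c * z) (*) \<rho> \<and> (\<forall>b'\<in>B. \<rho> b' = (if b' = b then 1 else 0))" for b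
      by (rule ac_pair.linear_independent_extend[OF B(2)])
    then obtain \<rho> where \<rho>: "\<And>b. Vector_Spaces.linear (\<lambda>c z. to_ac c * z) (*) (\<rho> b)"
      "\<And>b b'. b' \<in> B \<Longrightarrow> \<rho> b b' = (if b' = b then 1 else 0)" by metis
    have \<rho>_add: "\<rho> b (x + y) = \<rho> b x + \<rho> b y" and \<rho>_scale: "\<rho> b (to_ac c * x) = c * \<rho> b x" for b x y c
      using \<rho>(1)[of b] by (auto simp: Vector_Spaces.linear_iff)
    have \<rho>0: "\<rho> b 0 = 0" for b using \<rho>_scale[of b 0 0] by simp
    have \<rho>_sum: "\<rho> b (sum f A) = (\<Sum>i\<in>A. \<rho> b (f i))" for b f and A :: "'k alg_closure set"
      by (induction A rule: infinite_finite_induct) (auto simp: \<rho>_add \<rho>0)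
    have expand: "v = (\<Sum>b\<in>B. b * to_ac (\<rho> b v))" if v: "v \<in> ac.vs.span B" for v
    proof -
      obtain g where g: "v = (\<Sum>b\<in>B. to_ac (g b) * b)" using v ac.vs.span_finite[OF finB] by auto
      have "\<rho> b v = g b" if "b \<in> B" for b
        unfolding g \<rho>_sum using that finB by (simp add: \<rho>_scale \<rho>(2) if_distrib cong: if_cong sum.cong)
      then show ?thesis by (simp add: g mult.commute cong: sum.cong)
    qed
    have in_span: "lookup p m \<in> ac.vs.span B" for m
      using B(3) by (cases "m \<in> keys p") (auto simp: in_keys_iff ac.vs.span_zero)
    have "p = (\<Sum>b\<in>B. single 0 b * mapc to_ac (mapc (\<rho> b) p))"
    proof (rule poly_mapping_eqI)
      fix m
      have "single 0 b * mapc to_ac (mapc (\<rho> b) p)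
          = mapc ((*) b) (mapc to_ac (mapc (\<rho> b) p))" for b
        by (rule mult_map_scale_conv_mult[symmetric])
      then show "lookup p m = lookup
          (\<Sum>b\<in>B. single 0 b * mapc to_ac (mapc (\<rho> b) p)) m"
        using expand[OF in_span] by (simp add: lookup_sum lookup_map \<rho>0)
    qed
    also have "\<dots> \<in> base_change n ?I"
    proof -
      have "single 0 b * mapc to_ac (mapc (\<rho> b) p) \<in> base_change n ?I" for b
      proof (rule J(4)[OF ideal_base_change(2)[OF I]])
        show "mapc (\<rho> b) p \<in> ?I"
          unfolding relation_ideal_def
        proof (intro CollectI conjI)
          show "mapc (\<rho> b) p \<in> mpolys n" using p(1) \<rho>0 by (rule_tac mpoly_ring_map)
          have mon: "monom_eval y m \<in> D" if "m \<in> keys p" for m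
            unfolding monom_eval_def
          proof (intro \<kappa>.subalg_prod[OF D(1)] \<kappa>.subalg_power[OF D(1)] D(3))
            fix i assume "i \<in> keys m"
            then show "i < n" using p(1) that by (auto simp: carrier_mpoly_ring)
          qed
          have "mpoly_eval \<kappa> y (mapc (\<rho> b) p)
              = (\<Sum>m\<in>keys p. \<kappa> (\<rho> b (lookup p m)) * monom_eval y m)"
            by (simp add: mpoly_eval_map \<rho>0) (rule mpoly_eval_superset, auto simp: \<rho>0)
          also have "\<dots> = 0"
          proof (rule lin_disjointD[OF D(2) finite_keys mon])
            show "\<kappa> (\<rho> b (x * to_ac c)) = \<kappa> (\<rho> b x) * j (to_ac c)" for x c
              using \<rho>_scale[of b c x] by (simp add: mult.commute \<kappa>.hom_mult \<kappa>[symmetric])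
            show "(\<Sum>m\<in>keys p. j (lookup p m) * monom_eval y m) = 0"
              using p(2) mpoly_eval_superset[of "keys p" p j y] by simp
          qed (auto simp: \<rho>_add \<kappa>.hom_add)
          finally show "mpoly_eval \<kappa> y (mapc (\<rho> b) p) = 0" .
        qed
      qed auto
      note single = this
      have "sum g A \<in> base_change n ?I" if "\<And>i. g i \<in> base_change n ?I"
        for g and A :: "'k alg_closure set"
        by (induction A rule: infinite_finite_induct) (auto intro: J(2,3) that)
      then show ?thesis using single .
    qed
    finally show ?thesis .
  qed
  then show ?thesis using ker J(1) by blast
qed

section \<open>Galois groups and the Krull topology\<close>

lemma ring_of_type_algebra_simps [simp]:
  "monoid.mult ring_of_type_algebra = (*)" "ring.add ring_of_type_algebra = (+)"
  "monoid.one ring_of_type_algebra = 1" "ring.zero ring_of_type_algebra = 0"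
  "carrier ring_of_type_algebra = UNIV"
  by (simp_all add: ring_of_type_algebra_def)

lemma ring_of_type_algebra_a_inv: "\<ominus>\<^bsub>ring_of_type_algebra\<^esub> (z::'a::comm_ring_1) = - z"
proof -
  interpret cring "ring_of_type_algebra :: 'a ring" by (rule cring_from_type_algebra)
  show ?thesis by (rule minus_equality) auto
qed

lemma ring_of_type_algebra_m_inv:
  assumes "z \<noteq> 0"
  shows "inv\<^bsub>ring_of_type_algebra\<^esub> (z::'a::field) = inverse z"
proof -
  interpret cring "ring_of_type_algebra :: 'a ring" by (rule cring_from_type_algebra)
  show ?thesis by (rule comm_inv_char) (use assms in auto)
qed

definition subfield_set :: "'a::field set \<Rightarrow> bool" where
  "subfield_set M \<longleftrightarrow> 0 \<in> M \<and> 1 \<in> M \<and> (\<forall>x\<in>M. - x \<in> M \<and> inverse x \<in> M) \<and>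
     (\<forall>x\<in>M. \<forall>y\<in>M. x + y \<in> M \<and> x * y \<in> M)"

lemma subfield_setD:
  assumes "subfield_set M"
  shows "0 \<in> M" "1 \<in> M" "x \<in> M \<Longrightarrow> - x \<in> M" "x \<in> M \<Longrightarrow> inverse x \<in> M"
    "x \<in> M \<Longrightarrow> y \<in> M \<Longrightarrow> x + y \<in> M" "x \<in> M \<Longrightarrow> y \<in> M \<Longrightarrow> x * y \<in> M"
  using assms by (auto simp: subfield_set_def)

lemma (in algebraic_ext) subfield_set_subalg: "subalg e N \<Longrightarrow> subfield_set N"
  by (auto simp: subfield_set_def intro: subalg_0 subalg_1 subalg_uminus subalg_inverse subalg_add subalg_mult)

lemma generate_field_least:
  fixes W :: "'a::field set"
  assumes "W \<subseteq> M" "subfield_set M"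
  shows "generate_field ring_of_type_algebra W \<subseteq> M"
proof
  fix z assume "z \<in> generate_field ring_of_type_algebra W"
  then show "z \<in> M"
    by induction (use assms in \<open>auto simp: subfield_set_def ring_of_type_algebra_a_inv ring_of_type_algebra_m_inv\<close>)
qed

lemma (in algebraic_ext) generate_field_eq_alg_gen:
  "generate_field ring_of_type_algebra (range e \<union> W) = alg_gen e W"
proof
  note N = subalg_alg_gen[of e W]
  show "generate_field ring_of_type_algebra (range e \<union> W) \<subseteq> alg_gen e W"
    by (rule generate_field_least) (auto intro: alg_gen.base alg_gen.gen subfield_set_subalg[OF N])
  show "alg_gen e W \<subseteq> generate_field ring_of_type_algebra (range e \<union> W)"
  proof (rule alg_gen_least[OF subalgI])
    fix x y assume xy: "x \<in> generate_field ring_of_type_algebra (range e \<union> W)"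
      "y \<in> generate_field ring_of_type_algebra (range e \<union> W)"
    show "x + y \<in> generate_field ring_of_type_algebra (range e \<union> W)"
      using generate_field.eng_add[OF xy] by simp
    show "x * y \<in> generate_field ring_of_type_algebra (range e \<union> W)"
      using generate_field.eng_mult[OF xy] by simp
  qed (auto intro: generate_field.incl)
qed

lemma Gal_carrier:
  "\<sigma> \<in> carrier (Gal M N) \<longleftrightarrow> \<sigma> \<in> extensional M \<and> bij_betw \<sigma> M M \<and>
     (\<forall>x\<in>M. \<forall>y\<in>M. \<sigma> (x + y) = \<sigma> x + \<sigma> y \<and> \<sigma> (x * y) = \<sigma> x * \<sigma> y) \<and> (\<forall>x\<in>N. \<sigma> x = x)"
  by (auto simp: Gal_def Bij_def)

text \<open>The multiplication is that of \<open>BijGroup M\<close>. The three fixed sets may differ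
  since a coset multiplies an element of one Galois group with elements of a smaller one.\<close>

lemma Gal_mult:
  assumes "\<sigma> \<in> carrier (Gal M N)" "\<tau> \<in> carrier (Gal M N')"
  shows "\<sigma> \<otimes>\<^bsub>Gal M N''\<^esub> \<tau> = compose M \<sigma> \<tau>"
  using assms by (simp add: Gal_def BijGroup_def)

lemma Gal_in: "\<sigma> \<in> carrier (Gal M N) \<Longrightarrow> z \<in> M \<Longrightarrow> \<sigma> z \<in> M"
  by (auto simp: Gal_carrier bij_betw_def)

lemma Gal_mult_closed:
  assumes M: "subfield_set M" "N \<subseteq> M"
    and \<sigma>: "\<sigma> \<in> carrier (Gal M N)" and \<tau>: "\<tau> \<in> carrier (Gal M N)"
  shows "compose M \<sigma> \<tau> \<in> carrier (Gal M N)"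
proof -
  have "bij_betw (compose M \<sigma> \<tau>) M M"
    using \<sigma> \<tau> by (intro bij_betw_compose[of \<tau> M M \<sigma> M]) (auto simp: Gal_carrier)
  then show ?thesis
    using \<sigma> \<tau> M(2) subfield_setD[OF M(1)] Gal_in[OF \<tau>] unfolding Gal_carrier by (auto simp: compose_def)
qed

lemma Gal_one:
  assumes M: "subfield_set M" "N \<subseteq> M"
  shows "restrict (\<lambda>z. z) M \<in> carrier (Gal M N)"
  using M(2) subfield_setD[OF M(1)] by (auto simp: Gal_carrier bij_betw_def inj_on_def)

lemma Gal_fix_generate_field:
  assumes M: "subfield_set M"
    and N: "N \<subseteq> M" "0 \<in> N" "1 \<in> N" and S: "S \<subseteq> M"
    and g: "g \<in> carrier (Gal M N)" "\<And>s. s \<in> S \<Longrightarrow> g s = s"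
  shows "g \<in> carrier (Gal M (generate_field ring_of_type_algebra (N \<union> S)))"
proof -
  note M = subfield_setD[OF M]
  have hom: "g (x + y) = g x + g y" "g (x * y) = g x * g y" if "x \<in> M" "y \<in> M" for x y
    using g that by (auto simp: Gal_carrier)
  have g01: "g 0 = 0" "g 1 = 1" using g(1) N by (auto simp: Gal_carrier)
  have "g (- x) = - x" "g (inverse x) = inverse x" if x: "x \<in> M" "g x = x" for x
  proof -
    have "x + g (- x) = 0" using hom(1)[of x "- x"] x M(3) g01 by simp
    then show "g (- x) = - x" by (simp add: eq_neg_iff_add_eq_0 add.commute)
    have "x * g (inverse x) = 1" if "x \<noteq> 0"
      using hom(2)[of x "inverse x"] x M(4) g01 that by simp
    then show "g (inverse x) = inverse x"
      using g01(1) inverse_unique[of x "g (inverse x)"] by (cases "x = 0") simp_all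
  qed
  then have "subfield_set {z \<in> M. g z = z}"
    unfolding subfield_set_def using M hom g01 by auto
  moreover have "N \<union> S \<subseteq> {z \<in> M. g z = z}" using N S g by (auto simp: Gal_carrier)
  ultimately have "generate_field ring_of_type_algebra (N \<union> S) \<subseteq> {z \<in> M. g z = z}"
    by (intro generate_field_least)
  then show ?thesis using g(1) unfolding Gal_carrier by blast
qed

text \<open>A basic coset that contains the identity contains the whole subgroup: if \<sigma> c = 1
  then g = \<sigma> (c g). That subgroup contains the pointwise stabilizer of the finite set of
  generators.\<close>

lemma krull_nbhd:
  assumes M: "subfield_set M"
    and N: "N \<subseteq> M" "0 \<in> N" "1 \<in> N"
    and U: "openin (krull M N) U" "restrict (\<lambda>z. z) M \<in> U"
  shows "\<exists>S. finite S \<and> S \<subseteq> M \<and> {g \<in> carrier (Gal M N). \<forall>s\<in>S. g s = s} \<subseteq> U"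
proof -
  let ?B = "{\<sigma> <#\<^bsub>Gal M N\<^esub> carrier (Gal M (generate_field ring_of_type_algebra (N \<union> S))) | \<sigma> S.
        \<sigma> \<in> carrier (Gal M N) \<and> finite S \<and> S \<subseteq> M}"
  have "generate_topology_on ?B U"
    using U(1) unfolding krull_def by (rule openin_topology_generated_by)
  then show ?thesis
    using U(2)
  proof induction
    case (Int a b)
    then obtain S T where S: "finite S" "S \<subseteq> M" "{g \<in> carrier (Gal M N). \<forall>s\<in>S. g s = s} \<subseteq> a"
      and T: "finite T" "T \<subseteq> M" "{g \<in> carrier (Gal M N). \<forall>s\<in>T. g s = s} \<subseteq> b" by blast
    show ?case by (intro exI[of _ "S \<union> T"]) (use S T in auto)
  next
    case (UN K)
    then obtain k where k: "k \<in> K" "restrict (\<lambda>z. z) M \<in> k" by blast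
    obtain S where S: "finite S" "S \<subseteq> M" "{g \<in> carrier (Gal M N). \<forall>s\<in>S. g s = s} \<subseteq> k"
      using UN.IH[OF k] by (elim exE conjE)
    have "k \<subseteq> \<Union>K" using k(1) by blast
    then show ?case using S by (intro exI[of _ S] conjI order_trans[OF S(3)])
  next
    case (Basis s)
    then obtain \<sigma> S where s: "s = \<sigma> <#\<^bsub>Gal M N\<^esub> carrier (Gal M (generate_field ring_of_type_algebra (N \<union> S)))"
      and \<sigma>: "\<sigma> \<in> carrier (Gal M N)" and S: "finite S" "S \<subseteq> M" by blast
    let ?C = "carrier (Gal M (generate_field ring_of_type_algebra (N \<union> S)))"
    from Basis(2) obtain c where c: "c \<in> ?C" "restrict (\<lambda>z. z) M = \<sigma> \<otimes>\<^bsub>Gal M N\<^esub> c"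
      unfolding s l_coset_def by blast
    have gen: "generate_field ring_of_type_algebra (N \<union> S) \<subseteq> M"
      by (rule generate_field_least) (use M N S in auto)
    have id: "compose M \<sigma> c = restrict (\<lambda>z. z) M" using c(2) Gal_mult[OF \<sigma> c(1)] by simp
    have "g \<in> s" if g: "g \<in> carrier (Gal M N)" "\<forall>s\<in>S. g s = s" for g
    proof -
      have gC: "g \<in> ?C" by (rule Gal_fix_generate_field[OF M N S(2) g(1)]) (use g in auto)
      have cg: "compose M c g \<in> ?C"
        by (rule Gal_mult_closed[OF M gen c(1) gC])
      have "\<sigma> \<otimes>\<^bsub>Gal M N\<^esub> compose M c g = compose M \<sigma> (compose M c g)"
        by (rule Gal_mult[OF \<sigma> cg])
      also have "\<dots> = g"
      proof
        fix z
        show "compose M \<sigma> (compose M c g) z = g z"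
        proof (cases "z \<in> M")
          case True
          then have "g z \<in> M" using Gal_in[OF g(1)] by blast
          then have "\<sigma> (c (g z)) = g z" using fun_cong[OF id, of "g z"] by (simp add: compose_def)
          then show ?thesis using True by (simp add: compose_def)
        next
          case False
          then show ?thesis using g(1) by (simp add: Gal_carrier compose_def extensional_def)
        qed
      qed
      finally have "g = \<sigma> \<otimes>\<^bsub>Gal M N\<^esub> compose M c g" by (rule sym)
      then show ?thesis unfolding s l_coset_def by (intro UN_I[OF cg]) (rule iffD2[OF singleton_iff])
    qed
    then show ?case using S by blast
  qed simp
qed

section \<open>Polynomials over algebraically closed fields\<close>

text \<open>P already splits over the smaller algebraically closed field, so the larger field adds
  no roots.\<close>

lemma map_poly_root:
  fixes j :: "'c::alg_closed_field \<Rightarrow> 'o::field"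
  assumes j: "field_hom j" and P: "P \<noteq> 0" "poly (map_poly j P) z = 0"
  shows "\<exists>v. z = j v \<and> poly P v = 0"
  using P
proof (induction "degree P" arbitrary: P rule: less_induct)
  case less
  interpret j: field_hom j by fact
  interpret m: map_poly_inj_idom_hom j ..
  have "degree P \<noteq> 0"
  proof
    assume "degree P = 0"
    then obtain c where "P = [:c:]" by (rule degree_eq_zeroE)
    then show False using less.prems by (simp add: map_poly_pCons)
  qed
  then obtain a where a: "poly P a = 0" using alg_closed_imp_poly_has_root[of P] by auto
  then obtain Q where Q: "P = [:- a, 1:] * Q" by (auto simp: poly_eq_0_iff_dvd)
  then have "Q \<noteq> 0" using less.prems by auto
  have "degree Q < degree P" unfolding Q using \<open>Q \<noteq> 0\<close> by (subst degree_mult_eq) auto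
  have "map_poly j P = [:- j a, 1:] * map_poly j Q"
    unfolding Q m.hom_mult by (simp add: map_poly_pCons j.hom_uminus)
  then have "z = j a \<or> poly (map_poly j Q) z = 0"
    using less.prems(2) by (simp del: mult_pCons_left)
  then show ?case
  proof
    assume "poly (map_poly j Q) z = 0"
    then obtain v where "z = j v" "poly Q v = 0"
      using less.hyps[OF \<open>degree Q < degree P\<close> \<open>Q \<noteq> 0\<close>] by blast
    then show ?thesis unfolding Q by (auto simp del: mult_pCons_left)
  qed (use a in blast)
qed

text \<open>Every root comes from the smaller field, where root orders are the same.\<close>

lemma rsquarefree_map_poly:
  fixes j :: "'c::alg_closed_field \<Rightarrow> 'o::field"
  assumes j: "field_hom j" and P: "rsquarefree P"
  shows "rsquarefree (map_poly j P)"
proof -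
  interpret j: field_hom j by fact
  interpret m: map_poly_inj_idom_divide_hom j ..
  have nz: "P \<noteq> 0" using P by (simp add: rsquarefree_def)
  then have nz': "map_poly j P \<noteq> 0" by simp
  show ?thesis
    unfolding rsquarefree_def
  proof (intro conjI allI)
    fix a
    show "order a (map_poly j P) = 0 \<or> order a (map_poly j P) = 1"
    proof (cases "poly (map_poly j P) a = 0")
      case True
      then obtain v where "a = j v" using map_poly_root[OF j nz] by blast
      then show ?thesis using P m.order_hom[of v P] by (auto simp: rsquarefree_def)
    qed (auto intro: order_0I)
  qed (rule nz')
qed

lemma rsquarefree_split:
  fixes P :: "'c::alg_closed_field poly"
  assumes P: "rsquarefree P" "lead_coeff P = 1"
  shows "P = (\<Prod>a\<in>{a. poly P a = 0}. [:- a, 1:])"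
  using assms
proof (induction "degree P" arbitrary: P rule: less_induct)
  case less
  show ?case
  proof (cases "degree P = 0")
    case True
    then obtain c where "P = [:c:]" by (rule degree_eq_zeroE)
    then have "P = 1" using less.prems(2) by (simp add: one_pCons)
    then show ?thesis by simp
  next
    case False
    then obtain a where a: "poly P a = 0" using alg_closed_imp_poly_has_root[of P] by auto
    then obtain Q where Q: "P = [:- a, 1:] * Q" by (auto simp: poly_eq_0_iff_dvd)
    have nz: "P \<noteq> 0" using less.prems by auto
    then have Qnz: "Q \<noteq> 0" using Q by auto
    have ord: "order b P = order b [:- a, 1:] + order b Q" for b
      using nz unfolding Q by (rule order_mult)
    have "order a [:- a, 1:] = 1" using order_power_n_n[of a 1] by simp
    moreover have "order a P = 0 \<or> order a P = 1" using less.prems(1) unfolding rsquarefree_def by blast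
    ultimately have "order a Q = 0" using ord[of a] by linarith
    then have Qa: "poly Q a \<noteq> 0" using Qnz by (simp add: order_root)
    have "order b Q \<le> 1" for b
    proof -
      have "order b P = 0 \<or> order b P = 1" using less.prems(1) unfolding rsquarefree_def by blast
      then show ?thesis using ord[of b] by linarith
    qed
    then have "rsquarefree Q" using Qnz unfolding rsquarefree_def by (metis le_0_eq le_Suc_eq One_nat_def)
    moreover have "lead_coeff Q = 1" using less.prems(2) unfolding Q lead_coeff_mult by simp
    moreover have "degree Q < degree P" unfolding Q using Qnz by (subst degree_mult_eq) auto
    ultimately have IH: "Q = (\<Prod>a\<in>{a. poly Q a = 0}. [:- a, 1:])" using less.hyps by blast
    have roots: "{b. poly P b = 0} = insert a {b. poly Q b = 0}"
      unfolding Q by (auto simp del: mult_pCons_left)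
    have "finite {b. poly Q b = 0}" using Qnz by (rule poly_roots_finite)
    then have "(\<Prod>b\<in>{b. poly P b = 0}. [:- b, 1:]) = [:- a, 1:] * (\<Prod>b\<in>{b. poly Q b = 0}. [:- b, 1:])"
      unfolding roots using Qa by (subst prod.insert) auto
    also have "\<dots> = P" using IH Q by simp
    finally show ?thesis by simp
  qed
qed

lemma degree_prod_linear:
  fixes S :: "'c::field set"
  shows "degree (\<Prod>a\<in>S. [:- a, 1:]) = card S" "lead_coeff (\<Prod>a\<in>S. [:- a, 1:]) = 1"
proof -
  show "lead_coeff (\<Prod>a\<in>S. [:- a, 1:]) = 1" by (simp add: lead_coeff_prod)
  show "degree (\<Prod>a\<in>S. [:- a, 1:]) = card S" by (subst degree_prod_eq_sum_degree) auto
qed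

section \<open>The coordinate ring inside the algebraic closure of its fraction field\<close>

lemma to_geom_hom: "comm_ring_hom (to_geom :: 'r::idom \<Rightarrow> 'r geom)"
  by standard (auto simp: to_geom_def)

lemma to_geom_eq_0_iff [simp]: "to_geom r = 0 \<longleftrightarrow> r = 0"
  by (simp add: to_geom_def)

lemma function_field_quotient:
  assumes "z \<in> range (to_ac :: 'r::idom fract \<Rightarrow> 'r geom)"
  obtains a b where "b \<noteq> 0" "z * to_geom b = to_geom a"
proof -
  obtain q where q: "z = to_ac q" using assms by blast
  obtain a b where "q = Fract a b" "b \<noteq> 0" by (cases q)
  then have "b \<noteq> 0" "z * to_geom b = to_geom a"
    by (simp_all add: q to_geom_def Fract_conv_to_fract)
  then show thesis by (rule that)
qed

section \<open>The cover defined by a separable polynomial\<close>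

locale geom_cover =
  fixes \<iota> :: "'k::field \<Rightarrow> 'r::idom" and n :: nat and x :: "nat \<Rightarrow> 'r" and f :: "'r poly"
  assumes aff: "affine_algebra \<iota> n x"
    and irr: "absolutely_irreducible n (relation_ideal \<iota> n x)"
    and monic: "lead_coeff f = 1"
    and sepf: "separable (map_poly to_fract f)"
begin

sublocale \<iota>: comm_ring_hom \<iota>
  using aff by (simp add: affine_algebra_def)

sublocale tg: comm_ring_hom "to_geom :: 'r \<Rightarrow> 'r geom"
  by (rule to_geom_hom)

definition \<kappa> :: "'k \<Rightarrow> 'r geom" where "\<kappa> c = to_geom (\<iota> c)"

lemma \<kappa>_hom: "field_hom \<kappa>"
  by standard (simp_all add: \<kappa>_def \<iota>.hom_add tg.hom_add \<iota>.hom_mult tg.hom_mult)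

sublocale \<kappa>: field_hom \<kappa>
  by (rule \<kappa>_hom)

sublocale kv: vector_space "\<lambda>c z. \<kappa> c * z"
  by standard
    (simp_all only: distrib_left distrib_right mult.assoc \<kappa>.hom_add \<kappa>.hom_mult \<kappa>.hom_one mult_1_left)

abbreviation E :: "'r geom set" where "E \<equiv> range to_ac"
abbreviation Ks :: "'r geom set" where "Ks \<equiv> base_sep_closure \<iota>"
abbreviation F :: "'r geom set" where "F \<equiv> splitting_field f"
abbreviation Rt :: "'r geom set" where "Rt \<equiv> geom_roots f"

lemma \<kappa>_E: "\<kappa> c \<in> E"
  by (simp add: \<kappa>_def to_geom_def)

text \<open>Two models of the algebraic closure of K occur: the type \<open>'k alg_closure\<close>
  and the subfield \<open>base_alg_closure \<iota>\<close> of the closure of E. An arbitrary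
  extension of \<kappa> identifies them (\<open>range_j\<close>).\<close>

definition j :: "'k alg_closure \<Rightarrow> 'r geom" where
  "j = (SOME j. field_hom j \<and> (\<forall>c. j (to_ac c) = \<kappa> c))"

lemma j: "field_hom j" and j_ac: "j (to_ac c) = \<kappa> c"
proof -
  interpret k: algebraic_ext_closed "to_ac :: 'k \<Rightarrow> 'k alg_closure" \<kappa> by unfold_locales
  have "partial_hom to_ac \<kappa> {(to_ac c, \<kappa> c) | c. True}"
    unfolding partial_hom_def
  proof (intro conjI allI impI)
    fix a b c d
    assume "(a, b) \<in> {(to_ac c, \<kappa> c) | c. True}" "(c, d) \<in> {(to_ac c, \<kappa> c) | c. True}"
    then obtain u v where "a = to_ac u" "b = \<kappa> u" "c = to_ac v" "d = \<kappa> v" by auto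
    then show "(a + c, b + d) \<in> {(to_ac c, \<kappa> c) | c. True}" "(a * c, b * d) \<in> {(to_ac c, \<kappa> c) | c. True}"
      by (auto intro: exI[of _ "u + v"] exI[of _ "u * v"] simp: \<kappa>.hom_add \<kappa>.hom_mult)
  qed auto
  from k.extend_hom[OF this] have "\<exists>j. field_hom j \<and> (\<forall>c. j (to_ac c) = \<kappa> c)" by blast
  from someI_ex[OF this] show "field_hom j" "j (to_ac c) = \<kappa> c" by (simp_all add: j_def)
qed

sublocale j: field_hom j by (rule j)

lemma map_poly_\<kappa>: "map_poly \<kappa> p = map_poly j (map_poly to_ac p)"
  by (intro poly_eqI) (simp add: coeff_map_poly j_ac)

lemma range_j: "base_alg_closure \<iota> = range j"
proof (intro equalityI subsetI)
  fix z assume "z \<in> base_alg_closure \<iota>"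
  then obtain p where p: "p \<noteq> 0" "poly (map_poly j (map_poly to_ac p)) z = 0"
    unfolding base_alg_closure_def map_poly_\<kappa>[symmetric] by (auto simp: \<kappa>_def[abs_def])
  then show "z \<in> range j" using map_poly_root[OF j, of "map_poly to_ac p" z] by (auto simp: map_poly_eq_0_iff)
next
  fix z assume "z \<in> range j"
  then obtain v where v: "z = j v" by blast
  obtain p where p: "p \<noteq> 0" "poly (map_poly to_ac p) v = 0" using alg_closure_algebraic by blast
  then have "poly (map_poly \<kappa> p) z = 0" unfolding map_poly_\<kappa> v by simp
  then show "z \<in> base_alg_closure \<iota>" unfolding base_alg_closure_def using p(1) by (auto simp: \<kappa>_def[abs_def])
qed

lemma Ks_alt: "Ks = {z. \<exists>p. rsquarefree (map_poly to_ac p) \<and> poly (map_poly \<kappa> p) z = 0}"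
  by (simp add: base_sep_closure_def separable_def \<kappa>_def[abs_def])

lemma Ks_eq: "Ks = j ` ac.sep"
proof (intro equalityI subsetI)
  fix z assume "z \<in> Ks"
  then obtain p where p: "rsquarefree (map_poly to_ac p)" "poly (map_poly j (map_poly to_ac p)) z = 0"
    unfolding Ks_alt map_poly_\<kappa> by blast
  then obtain v where "z = j v" "poly (map_poly to_ac p) v = 0"
    using map_poly_root[OF j, of "map_poly to_ac p" z] by (auto simp: rsquarefree_def)
  then show "z \<in> j ` ac.sep" using p(1) unfolding ac.sep_def by blast
next
  fix z assume "z \<in> j ` ac.sep"
  then obtain p v where v: "z = j v" "rsquarefree (map_poly to_ac p)" "poly (map_poly to_ac p) v = 0"
    unfolding ac.sep_def by blast
  then have "poly (map_poly \<kappa> p) z = 0" unfolding map_poly_\<kappa> by simp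
  then show "z \<in> Ks" unfolding Ks_alt using v(2) by blast
qed

text \<open>Here \<open>ac.sep\<close> is the separable closure of E, whereas in
  \<open>Ks_eq\<close> it is that of K in \<open>'k alg_closure\<close>; the types decide.\<close>

lemma Ks_sep: "Ks \<subseteq> ac.sep"
proof
  fix z assume "z \<in> Ks"
  then obtain p where p: "rsquarefree (map_poly to_ac p)" "poly (map_poly \<kappa> p) z = 0"
    unfolding Ks_alt by blast
  let ?p = "map_poly (\<lambda>c. to_fract (\<iota> c)) p"
  have "map_poly to_ac ?p = map_poly \<kappa> p"
    by (intro poly_eqI) (simp add: coeff_map_poly \<kappa>_def to_geom_def)
  moreover have "rsquarefree (map_poly \<kappa> p)"
    unfolding map_poly_\<kappa> by (rule rsquarefree_map_poly[OF j p(1)])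
  ultimately show "z \<in> ac.sep" unfolding ac.sep_def using p(2) by (intro CollectI exI[of _ ?p]) simp
qed

lemma Ks_closed:
  "a \<in> Ks \<Longrightarrow> b \<in> Ks \<Longrightarrow> a + b \<in> Ks" "a \<in> Ks \<Longrightarrow> b \<in> Ks \<Longrightarrow> a * b \<in> Ks"
  "a \<in> Ks \<Longrightarrow> - a \<in> Ks" "a \<in> Ks \<Longrightarrow> inverse a \<in> Ks" "0 \<in> Ks" "1 \<in> Ks" "\<kappa> c \<in> Ks"
proof -
  have N: "subalg to_ac (ac.sep :: 'k alg_closure set)" by (rule ac.subalg_sep)
  show "a \<in> Ks \<Longrightarrow> b \<in> Ks \<Longrightarrow> a + b \<in> Ks"
    unfolding Ks_eq using subalg_add[OF N] by (auto simp flip: j.hom_add)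
  show "a \<in> Ks \<Longrightarrow> b \<in> Ks \<Longrightarrow> a * b \<in> Ks"
    unfolding Ks_eq using subalg_mult[OF N] by (auto simp flip: j.hom_mult)
  show "a \<in> Ks \<Longrightarrow> - a \<in> Ks"
    unfolding Ks_eq using ac.subalg_uminus[OF N] by (auto simp flip: j.hom_uminus)
  show "a \<in> Ks \<Longrightarrow> inverse a \<in> Ks"
    unfolding Ks_eq using ac.subalg_inverse[OF N] by (auto simp flip: j.hom_inverse)
  show c: "\<kappa> c \<in> Ks" for c
    unfolding Ks_eq j_ac[symmetric] using subalg_base[OF N] by (rule imageI)
  show "0 \<in> Ks" "1 \<in> Ks" using c[of 0] c[of 1] by simp_all
qed

lemma subfield_set_Ks: "subfield_set Ks"
  using Ks_closed by (simp add: subfield_set_def)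

lemma roots_sep: "Rt \<subseteq> ac.sep" and finite_roots: "finite Rt"
  and roots_split: "map_poly to_geom f = (\<Prod>r\<in>Rt. [:- r, 1:])"
proof -
  have eq: "map_poly to_ac (map_poly to_fract f) = map_poly to_geom f"
    by (intro poly_eqI) (simp add: coeff_map_poly to_geom_def)
  have sq: "rsquarefree (map_poly to_geom f)" using sepf by (simp add: separable_def eq)
  show "Rt \<subseteq> ac.sep"
    unfolding ac.sep_def geom_roots_def using sq
    by (auto intro!: exI[of _ "map_poly to_fract f"] simp: eq)
  have nz: "map_poly to_geom f \<noteq> 0" using sq by (simp add: rsquarefree_def)
  then show "finite Rt" unfolding geom_roots_def by (rule poly_roots_finite)
  have "degree (map_poly to_geom f) = degree f" by (rule degree_map_poly) simp
  then have "lead_coeff (map_poly to_geom f) = 1" using monic by (simp add: coeff_map_poly)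
  then show "map_poly to_geom f = (\<Prod>r\<in>Rt. [:- r, 1:])"
    unfolding geom_roots_def by (rule rsquarefree_split[OF sq])
qed

lemma F_eq: "F = alg_gen to_ac Rt"
  unfolding splitting_field_def function_field_def by (rule ac.generate_field_eq_alg_gen)

lemma F_sep: "F \<subseteq> ac.sep"
  unfolding F_eq by (rule alg_gen_least[OF ac.subalg_sep roots_sep])

lemma subalg_F: "subalg to_ac F"
  unfolding F_eq by (rule subalg_alg_gen)

definition xa :: "nat \<Rightarrow> 'r geom" where "xa i = to_geom (x i)"

lemma ev_map:
  assumes "field_hom j'" "\<And>c. j' (to_ac c) = \<kappa> c"
  shows "mpoly_eval j' xa (mapc to_ac p) = to_geom (mpoly_eval \<iota> x p)"
proof -
  interpret j': field_hom j' by fact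
  show ?thesis
    by (simp add: mpoly_eval_map mpoly_eval_comp[OF to_geom_hom] assms(2) \<kappa>_def xa_def[abs_def])
qed

text \<open>The right-hand side does not mention \<open>j'\<close>: all embeddings over K have the
  same kernel, which makes the graph in \<open>extend_alg\<close> single valued.\<close>

lemma ker_base_change:
  assumes "field_hom j'" "\<And>c. j' (to_ac c) = \<kappa> c" and p: "p \<in> mpolys n"
  shows "mpoly_eval j' xa p = 0 \<longleftrightarrow> p \<in> base_change n (relation_ideal \<iota> n x)"
proof
  interpret j': field_hom j' by fact
  assume "mpoly_eval j' xa p = 0"
  then show "p \<in> base_change n (relation_ideal \<iota> n x)"
    using kernel_subset_base_change[OF \<iota>.comm_ring_hom_axioms assms(1) to_geom_hom _ _
      irr[unfolded absolutely_irreducible_def] p] assms(2)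
    by (simp add: \<kappa>_def xa_def[abs_def])
next
  interpret j': field_hom j' by fact
  assume pJ: "p \<in> base_change n (relation_ideal \<iota> n x)"
  show "mpoly_eval j' xa p = 0"
  proof (rule base_change_zero[OF _ _ _ _ _ pJ, where h = \<kappa>])
    show "additive_map j'" "additive_map \<kappa>" by (simp_all only: additive_map_def j'.hom_add \<kappa>.hom_add simp_thms)
    show "j' (v * to_ac c) = j' v * \<kappa> c" for v c by (simp only: j'.hom_mult assms(2))
    fix g assume "g \<in> relation_ideal \<iota> n x"
    then show "mpoly_eval \<kappa> xa g = 0"
      using mpoly_eval_comp[OF to_geom_hom, of \<iota> x g]
      by (simp add: relation_ideal_def \<kappa>_def[abs_def] xa_def[abs_def])
  qed (auto simp: relation_ideal_def)
qed

lemma R_poly: "\<exists>p\<in>mpolys n. mpoly_eval \<iota> x p = r"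
  using aff unfolding affine_algebra_def by (metis UNIV_I imageE)

text \<open>The graph consists of fractions with a numerator in the compositum of the algebraic closure of \<open>K\<close> and
  the coordinate ring, and a denominator in the coordinate ring.\<close>

lemma extend_alg:
  assumes \<sigma>: "\<sigma> \<in> fixing (range to_ac)"
  shows "\<exists>\<gamma>\<in>fixing E. \<forall>v. \<gamma> (j v) = j (\<sigma> v)"
proof -
  interpret s: field_hom \<sigma> using \<sigma> by (rule fixing_hom)
  define j' where "j' v = j (\<sigma> v)" for v
  interpret j': field_hom j'
    unfolding j'_def by standard (auto simp: s.hom_add s.hom_mult j.hom_add j.hom_mult)
  have j'c: "j' (to_ac c) = \<kappa> c" for c
    using fixing_fix[OF \<sigma>, of "to_ac c"] by (simp add: j'_def j_ac)
  note j'h = j'.field_hom_axioms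
  interpret e: comm_ring_hom "mpoly_eval j xa" by (rule mpoly_eval_hom) unfold_locales
  interpret e': comm_ring_hom "mpoly_eval j' xa" by (rule mpoly_eval_hom) unfold_locales
  have Rp: "\<exists>p\<in>mpolys n. mpoly_eval j xa p = to_geom r \<and> mpoly_eval j' xa p = to_geom r" for r
  proof -
    obtain p where p: "p \<in> mpolys n" "mpoly_eval \<iota> x p = r" using R_poly by blast
    then show ?thesis
      using ev_map[OF j j_ac, of p] ev_map[OF j'h j'c, of p]
      by (intro bexI[of _ "mapc to_ac p"]) (auto intro: mpoly_ring_map)
  qed
  define G where "G = {(a, b). \<exists>p r. p \<in> mpolys n \<and> r \<noteq> 0 \<and>
    a * to_geom r = mpoly_eval j xa p \<and> b * to_geom r = mpoly_eval j' xa p}"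
  have GI: "(a, b) \<in> G" if "p \<in> mpolys n" "r \<noteq> 0"
    "a * to_geom r = mpoly_eval j xa p" "b * to_geom r = mpoly_eval j' xa p" for a b p r
    using that unfolding G_def by blast
  have "partial_hom to_ac to_ac G"
    unfolding partial_hom_def
  proof (intro conjI allI impI)
    fix c :: "'r fract"
    obtain a b where ab: "b \<noteq> 0" "to_ac c * to_geom b = to_geom a"
      using function_field_quotient[of "to_ac c"] by blast
    obtain p where "p \<in> mpolys n" "mpoly_eval j xa p = to_geom a" "mpoly_eval j' xa p = to_geom a"
      using Rp by blast
    then show "(to_ac c, to_ac c) \<in> G" using ab by (intro GI[of p b]) auto
  next
    fix a b c d assume "(a, b) \<in> G" "(c, d) \<in> G"
    then obtain p r q s where pr: "p \<in> mpolys n" "r \<noteq> 0" "a * to_geom r = mpoly_eval j xa p"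
        "b * to_geom r = mpoly_eval j' xa p"
      and qs: "q \<in> mpolys n" "s \<noteq> 0" "c * to_geom s = mpoly_eval j xa q"
        "d * to_geom s = mpoly_eval j' xa q"
      unfolding G_def by blast
    obtain r' where r': "r' \<in> mpolys n" "mpoly_eval j xa r' = to_geom r" "mpoly_eval j' xa r' = to_geom r"
      using Rp by blast
    obtain s' where s': "s' \<in> mpolys n" "mpoly_eval j xa s' = to_geom s" "mpoly_eval j' xa s' = to_geom s"
      using Rp by blast
    have sum: "(u + v) * to_geom (r * s) = (u * to_geom r) * to_geom s + (v * to_geom s) * to_geom r"
      and prod: "(u * v) * to_geom (r * s) = (u * to_geom r) * (v * to_geom s)" for u v
      unfolding tg.hom_mult by (simp_all only: distrib_left distrib_right mult_ac)
    show "(a + c, b + d) \<in> G"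
      by (rule GI[of "p * s' + q * r'" "r * s"])
         (simp_all only: sum pr qs r' s' e.hom_add e.hom_mult e'.hom_add e'.hom_mult mpoly_ring_add
            mpoly_ring_mult mult_eq_0_iff de_Morgan_disj not_False_eq_True simp_thms)
    show "(a * c, b * d) \<in> G"
      by (rule GI[of "p * q" "r * s"])
         (simp_all only: prod pr qs e.hom_mult e'.hom_mult mpoly_ring_mult mult_eq_0_iff de_Morgan_disj
            not_False_eq_True simp_thms)
  next
    fix b assume "(0, b) \<in> G"
    then obtain p r where pr: "p \<in> mpolys n" "r \<noteq> 0" "mpoly_eval j xa p = 0"
      "b * to_geom r = mpoly_eval j' xa p" unfolding G_def by auto
    then have "b * to_geom r = 0"
      using ker_base_change[OF j j_ac pr(1)] ker_base_change[OF j'h j'c pr(1)] by simp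
    then show "b = 0" using pr(2) by simp
  qed
  from ac.self.extend_hom[OF this] obtain \<gamma> where \<gamma>: "field_hom \<gamma>" "\<And>a b. (a, b) \<in> G \<Longrightarrow> \<gamma> a = b" by blast
  interpret g: field_hom \<gamma> by (rule \<gamma>(1))
  have "\<gamma> z = z" if z: "z \<in> E" for z
  proof -
    obtain a b where ab: "b \<noteq> 0" "z * to_geom b = to_geom a"
      using function_field_quotient[OF z] by blast
    obtain p where "p \<in> mpolys n" "mpoly_eval j xa p = to_geom a" "mpoly_eval j' xa p = to_geom a"
      using Rp by blast
    then have "(z, z) \<in> G" using ab by (intro GI[of p b]) auto
    then show ?thesis by (rule \<gamma>(2))
  qed
  moreover have "\<gamma> (j v) = j (\<sigma> v)" for v
    by (rule \<gamma>(2), rule GI[of "single 0 v" 1])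
       (auto simp: mpoly_eval_single tg.hom_one j'_def)
  ultimately show ?thesis using \<gamma>(1) by (auto simp: fixing_def)
qed

lemma fixing_range_j:
  assumes \<gamma>: "\<gamma> \<in> fixing E"
  shows "\<exists>w. \<gamma> (j v) = j w" "v \<in> ac.sep \<Longrightarrow> \<exists>w\<in>ac.sep. \<gamma> (j v) = j w"
proof -
  interpret g: field_hom \<gamma> using \<gamma> by (rule fixing_hom)
  have root: "\<exists>w. \<gamma> (j v) = j w \<and> poly (map_poly to_ac p) w = 0"
    if "map_poly to_ac p \<noteq> 0" "poly (map_poly to_ac p) v = 0" for p
  proof -
    have "map_poly \<gamma> (map_poly \<kappa> p) = map_poly \<kappa> p"
      using fixing_fix[OF \<gamma> \<kappa>_E] by (intro poly_eqI) (simp add: coeff_map_poly)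
    moreover have "poly (map_poly \<kappa> p) (j v) = 0" using that unfolding map_poly_\<kappa> by simp
    ultimately have "poly (map_poly \<kappa> p) (\<gamma> (j v)) = 0"
      using g.poly_map_poly[of "map_poly \<kappa> p" "j v"] by simp
    then show ?thesis using map_poly_root[OF j that(1)] unfolding map_poly_\<kappa> by auto
  qed
  obtain p where "p \<noteq> 0" "poly (map_poly to_ac p) v = 0" using alg_closure_algebraic by blast
  then show "\<exists>w. \<gamma> (j v) = j w" using root[of p] by (auto simp: map_poly_eq_0_iff)
  show "\<exists>w\<in>ac.sep. \<gamma> (j v) = j w" if v: "v \<in> ac.sep"
  proof -
    obtain p where p: "rsquarefree (map_poly to_ac p)" "poly (map_poly to_ac p) v = 0"
      using v unfolding ac.sep_def by blast
    then obtain w where "\<gamma> (j v) = j w" "poly (map_poly to_ac p) w = 0"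
      using root[of p] by (auto simp: rsquarefree_def)
    then show ?thesis using p(1) unfolding ac.sep_def by blast
  qed
qed

lemma fixing_Ks: "\<gamma> \<in> fixing E \<Longrightarrow> z \<in> Ks \<Longrightarrow> \<gamma> z \<in> Ks"
  unfolding Ks_eq using fixing_range_j(2) by blast

lemma fixing_roots:
  assumes \<gamma>: "\<gamma> \<in> fixing E" and z: "z \<in> Rt"
  shows "\<gamma> z \<in> Rt"
proof -
  interpret g: field_hom \<gamma> using \<gamma> by (rule fixing_hom)
  have "map_poly \<gamma> (map_poly to_geom f) = map_poly to_geom f"
    using fixing_fix[OF \<gamma>] by (intro poly_eqI) (simp add: coeff_map_poly to_geom_def)
  then show ?thesis
    using z g.poly_map_poly[of "map_poly to_geom f" z] by (simp add: geom_roots_def)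
qed

lemma fixing_F: "\<gamma> \<in> fixing E \<Longrightarrow> z \<in> F \<Longrightarrow> \<gamma> z \<in> F"
  unfolding F_eq by (rule ac.fixing_alg_gen) (auto intro: alg_gen.gen fixing_roots)

lemma restrict_fixing_Gal:
  assumes \<gamma>: "\<gamma> \<in> fixing E" and M: "\<And>\<delta> z. \<delta> \<in> fixing E \<Longrightarrow> z \<in> M \<Longrightarrow> \<delta> z \<in> M"
    "\<And>x y. x \<in> M \<Longrightarrow> y \<in> M \<Longrightarrow> x + y \<in> M" "\<And>x y. x \<in> M \<Longrightarrow> y \<in> M \<Longrightarrow> x * y \<in> M"
    and N: "N \<subseteq> M" "N \<subseteq> E"
  shows "restrict \<gamma> M \<in> carrier (Gal M N)"
proof -
  interpret g: field_hom \<gamma> using \<gamma> by (rule fixing_hom)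
  have "bij_betw (restrict \<gamma> M) M M"
    unfolding bij_betw_restrict_eq
  proof (rule bij_betwI[where g = "inv_into UNIV \<gamma>"])
    show "\<gamma> \<in> M \<rightarrow> M" using M(1)[OF \<gamma>] by auto
    show "inv_into UNIV \<gamma> \<in> M \<rightarrow> M" using M(1)[OF ac.fixing_inv(1)[OF \<gamma>]] by auto
  qed (use ac.fixing_inv(2,3)[OF \<gamma>] in auto)
  then show ?thesis
    unfolding Gal_carrier using M(2,3) N fixing_fix[OF \<gamma>] by (auto simp: g.hom_add g.hom_mult)
qed

lemma base_field_alt: "base_field \<iota> = range \<kappa>"
  by (simp add: base_field_def \<kappa>_def)

lemma restrict_absolute_Gal: "\<gamma> \<in> fixing E \<Longrightarrow> restrict \<gamma> Ks \<in> carrier (absolute_Gal \<iota>)"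
  unfolding absolute_Gal_def base_field_alt
  by (rule restrict_fixing_Gal) (auto intro: fixing_Ks Ks_closed(1,2,7) simp: \<kappa>_E)

text \<open>Together with \<open>gal_of\<close> this identifies Gal(K), given by maps on
  \<open>Ks\<close>, with the restrictions of automorphisms of \<open>'k alg_closure\<close>. The
  latter are total and can be fed to \<open>extend_alg\<close>.\<close>

lemma gal_extends:
  assumes g: "g \<in> carrier (absolute_Gal \<iota>)"
  shows "\<exists>\<sigma>\<in>fixing (range to_ac). \<forall>v\<in>ac.sep. g (j v) = j (\<sigma> v)"
proof -
  have g_hom: "g (a + b) = g a + g b" "g (a * b) = g a * g b" if "a \<in> Ks" "b \<in> Ks" for a b
    using g that unfolding absolute_Gal_def Gal_carrier by blast+
  have g_\<kappa>: "g (\<kappa> c) = \<kappa> c" for c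
    using g unfolding absolute_Gal_def Gal_carrier base_field_alt by blast
  define G where "G = {(v, w). v \<in> ac.sep \<and> g (j v) = j w}"
  have N: "subalg to_ac (ac.sep :: 'k alg_closure set)" by (rule ac.subalg_sep)
  have jKs: "j v \<in> Ks" if "v \<in> ac.sep" for v using that unfolding Ks_eq by blast
  have "partial_hom to_ac to_ac G"
    unfolding partial_hom_def
  proof (intro conjI allI impI)
    show "(to_ac c, to_ac c) \<in> G" for c
      using subalg_base[OF N] by (simp add: G_def j_ac g_\<kappa>)
    fix a b c d assume "(a, b) \<in> G" "(c, d) \<in> G"
    then have "a \<in> ac.sep" "c \<in> ac.sep" "g (j a) = j b" "g (j c) = j d" by (auto simp: G_def)
    then show "(a + c, b + d) \<in> G" "(a * c, b * d) \<in> G"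
      using subalg_add[OF N] subalg_mult[OF N] jKs
      by (simp_all add: G_def j.hom_add j.hom_mult g_hom)
  next
    fix b assume "(0, b) \<in> G"
    then show "b = 0" using g_\<kappa>[of 0] by (simp add: G_def)
  qed
  from ac.self.extend_hom[OF this] obtain \<sigma> where \<sigma>: "field_hom \<sigma>" "\<And>a b. (a, b) \<in> G \<Longrightarrow> \<sigma> a = b" by blast
  have "\<sigma> (to_ac c) = to_ac c" for c
    by (rule \<sigma>(2)) (use subalg_base[OF N] in \<open>simp add: G_def j_ac g_\<kappa>\<close>)
  moreover have "g (j v) = j (\<sigma> v)" if v: "v \<in> ac.sep" for v
  proof -
    have "g (j v) \<in> Ks" using Gal_in g jKs[OF v] unfolding absolute_Gal_def by blast
    then obtain w where w: "g (j v) = j w" unfolding Ks_eq by blast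
    then have "\<sigma> v = w" using v by (intro \<sigma>(2)) (simp add: G_def)
    then show ?thesis using w by simp
  qed
  ultimately show ?thesis using \<sigma>(1) by (auto simp: fixing_def)
qed

lemma gal_of:
  assumes \<sigma>: "\<sigma> \<in> fixing (range to_ac)"
  shows "\<exists>g\<in>carrier (absolute_Gal \<iota>). \<forall>v\<in>ac.sep. g (j v) = j (\<sigma> v)"
proof -
  obtain \<gamma> where \<gamma>: "\<gamma> \<in> fixing E" "\<forall>v. \<gamma> (j v) = j (\<sigma> v)" using extend_alg[OF \<sigma>] by blast
  have "j v \<in> Ks" if "v \<in> ac.sep" for v using that unfolding Ks_eq by blast
  then show ?thesis
    using \<gamma>(2) by (intro bexI[OF _ restrict_absolute_Gal[OF \<gamma>(1)]]) auto
qed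

subsection \<open>Linear disjointness over the base field\<close>

text \<open>A common denominator B clears all fractions, which moves the relation into the
  coordinate ring, where \<open>lin_disjoint_range\<close> applies.\<close>

lemma lin_disjoint_E: "lin_disjoint j E"
  unfolding lin_disjoint_def
proof (intro allI impI)
  fix A :: "nat set" and v d \<mu>
  assume A: "finite A" and d: "\<forall>i\<in>A. d i \<in> E" and add: "\<forall>x y. \<mu> (x + y) = \<mu> x + \<mu> y"
    and lin: "\<forall>x c. \<mu> (x * to_ac c) = \<mu> x * j (to_ac c)" and zero: "(\<Sum>i\<in>A. j (v i) * d i) = 0"
  have "\<forall>i\<in>A. \<exists>b. b \<noteq> 0 \<and> (\<exists>a. d i * to_geom b = to_geom a)"
    using d function_field_quotient by metis
  then obtain b where b: "\<And>i. i \<in> A \<Longrightarrow> b i \<noteq> 0" "\<And>i. i \<in> A \<Longrightarrow> \<exists>a. d i * to_geom (b i) = to_geom a" by metis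
  define B where "B = prod b A"
  have "B \<noteq> 0" using b(1) A by (simp add: B_def)
  have mem: "d i * to_geom B \<in> range to_geom" if i: "i \<in> A" for i
  proof -
    obtain a where a: "d i * to_geom (b i) = to_geom a" using b(2)[OF i] by blast
    have "B = b i * prod b (A - {i})" unfolding B_def using A i by (rule prod.remove)
    then have "d i * to_geom B = to_geom (a * prod b (A - {i}))"
      using a by (simp add: tg.hom_mult mult.assoc[symmetric])
    then show ?thesis by blast
  qed
  have LD: "lin_disjoint j (range to_geom)"
    by (rule lin_disjoint_range[OF aff j to_geom_hom _ _ irr]) (auto simp: j_ac \<kappa>_def)
  have "(\<Sum>i\<in>A. j (v i) * (d i * to_geom B)) = (\<Sum>i\<in>A. j (v i) * d i) * to_geom B"
    by (simp only: sum_distrib_right mult.assoc)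
  then have zero': "(\<Sum>i\<in>A. j (v i) * (d i * to_geom B)) = 0" by (simp only: zero mult_zero_left)
  have "(\<Sum>i\<in>A. \<mu> (v i) * (d i * to_geom B)) = 0"
    by (rule lin_disjointD[OF LD A mem add[rule_format] lin[rule_format] zero'])
  moreover have "(\<Sum>i\<in>A. \<mu> (v i) * (d i * to_geom B)) = (\<Sum>i\<in>A. \<mu> (v i) * d i) * to_geom B"
    by (simp only: sum_distrib_right mult.assoc)
  ultimately show "(\<Sum>i\<in>A. \<mu> (v i) * d i) = 0" using \<open>B \<noteq> 0\<close> by simp
qed

lemma functional_exists:
  assumes "w \<noteq> 0"
  obtains \<rho> :: "'k alg_closure \<Rightarrow> 'k"
    where "\<And>x y. \<rho> (x + y) = \<rho> x + \<rho> y" "\<And>x c. \<rho> (x * to_ac c) = \<rho> x * c" "\<rho> w = 1"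
proof -
  have "ac.vs.independent {w}" using assms by simp
  from ac_pair.linear_independent_extend[OF this, of "\<lambda>_. 1"] obtain \<rho>
    where \<rho>: "Vector_Spaces.linear (\<lambda>c z. to_ac c * z) (*) \<rho>" "\<rho> w = (1::'k)" by auto
  have add: "\<rho> (x + y) = \<rho> x + \<rho> y" and scale: "\<rho> (to_ac c * x) = c * \<rho> x" for x y c
    using \<rho>(1) by (auto simp: Vector_Spaces.linear_iff)
  have "\<rho> (x * to_ac c) = \<rho> x * c" for x c
    using scale[of c x] by (simp only: mult.commute)
  then show thesis using that add \<rho>(2) by blast
qed

text \<open>A K-linear functional with value 1 at the nonzero coefficient turns the relation into a
  nontrivial one over K.\<close>

lemma lin_disjoint_indep:
  assumes D: "lin_disjoint j D" and A: "finite A" "A \<subseteq> D" "kv.independent A"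
    and zero: "(\<Sum>d\<in>A. j (v d) * d) = 0" and d: "d \<in> A"
  shows "v d = 0"
proof (rule ccontr)
  assume "v d \<noteq> 0"
  then obtain \<rho> where \<rho>: "\<And>x y. \<rho> (x + y) = \<rho> x + \<rho> y" "\<And>x c. \<rho> (x * to_ac c) = \<rho> x * c" "\<rho> (v d) = 1"
    using functional_exists by blast
  have "(\<Sum>d\<in>A. \<kappa> (\<rho> (v d)) * d) = 0"
    by (rule lin_disjointD[OF D A(1), where \<mu> = "\<lambda>v. \<kappa> (\<rho> v)" and v = v])
       (use A(2) zero in \<open>auto simp: \<rho>(1,2) \<kappa>.hom_add \<kappa>.hom_mult j_ac\<close>)
  then have "\<rho> (v d) = 0" using kv.independentD[OF A(3,1) order_refl, of "\<lambda>d. \<rho> (v d)" d] d by simp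
  then show False using \<rho>(3) by simp
qed

lemma basis_expand:
  assumes "finite I"
  obtains A c where "finite A" "A \<subseteq> d ` I" "kv.independent A" "\<And>i. i \<in> I \<Longrightarrow> d i = (\<Sum>a\<in>A. \<kappa> (c i a) * a)"
proof -
  obtain A where A: "A \<subseteq> d ` I" "kv.independent A" "d ` I \<subseteq> kv.span A"
    using kv.maximal_independent_subset[of "d ` I"] by blast
  have fin: "finite A" using A(1) assms by (meson finite_imageI finite_subset)
  have "\<forall>i\<in>I. \<exists>c. d i = (\<Sum>a\<in>A. \<kappa> (c a) * a)"
    using A(3) kv.span_finite[OF fin] by blast
  then obtain c where "\<And>i. i \<in> I \<Longrightarrow> d i = (\<Sum>a\<in>A. \<kappa> (c i a) * a)" by metis
  then show thesis using that fin A by blast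
qed

text \<open>Converse of \<open>lin_disjoint_indep\<close>: after expansion in a K-basis of the span
  of the d i, all collected coefficients vanish, so the relation holds already in the tensor
  product.\<close>

lemma lin_disjointI:
  assumes indep: "\<And>A v d. finite A \<Longrightarrow> A \<subseteq> D \<Longrightarrow> kv.independent A \<Longrightarrow> (\<Sum>d\<in>A. j (v d) * d) = 0 \<Longrightarrow> d \<in> A \<Longrightarrow> v d = 0"
  shows "lin_disjoint j D"
  unfolding lin_disjoint_def
proof (intro allI impI)
  fix I :: "nat set" and v d \<mu>
  assume I: "finite I" and d: "\<forall>i\<in>I. d i \<in> D" and add: "\<forall>x y. \<mu> (x + y) = \<mu> x + \<mu> y"
    and lin: "\<forall>x c. \<mu> (x * to_ac c) = \<mu> x * j (to_ac c)" and zero: "(\<Sum>i\<in>I. j (v i) * d i) = 0"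
  obtain A c where A: "finite A" "A \<subseteq> d ` I" "kv.independent A" "\<And>i. i \<in> I \<Longrightarrow> d i = (\<Sum>a\<in>A. \<kappa> (c i a) * a)"
    using basis_expand[OF I] by blast
  have \<mu>0: "\<mu> 0 = 0" using lin[rule_format, of 0 0] by (simp add: j_ac)
  have \<mu>_sum: "\<mu> (sum g B) = (\<Sum>i\<in>B. \<mu> (g i))" for g and B :: "nat set"
    by (induction B rule: infinite_finite_induct) (auto simp: \<mu>0 add)
  define u where "u a = (\<Sum>i\<in>I. v i * to_ac (c i a))" for a
  have swap: "(\<Sum>i\<in>I. \<nu> (v i) * d i) = (\<Sum>a\<in>A. \<nu> (u a) * a)"
    if "\<And>g. \<nu> (sum g I) = (\<Sum>i\<in>I. \<nu> (g i))" "\<And>x c. \<nu> (x * to_ac c) = \<nu> x * \<kappa> c" for \<nu>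
  proof -
    have "(\<Sum>i\<in>I. \<nu> (v i) * d i) = (\<Sum>i\<in>I. \<Sum>a\<in>A. \<nu> (v i) * \<kappa> (c i a) * a)"
      by (intro sum.cong refl) (subst A(4), assumption, simp only: sum_distrib_left mult.assoc)
    also have "\<dots> = (\<Sum>a\<in>A. \<Sum>i\<in>I. \<nu> (v i) * \<kappa> (c i a) * a)" by (rule sum.swap)
    also have "\<dots> = (\<Sum>a\<in>A. \<nu> (u a) * a)"
      by (simp only: u_def that sum_distrib_right)
    finally show ?thesis .
  qed
  have "(\<Sum>a\<in>A. j (u a) * a) = 0"
    using swap[of j] zero by (simp add: j.hom_sum j.hom_mult j_ac)
  then have "u a = 0" if "a \<in> A" for a
    using indep[OF A(1) _ A(3), of u a] A(2) d that by blast
  then have "(\<Sum>a\<in>A. \<mu> (u a) * a) = 0" by (simp add: \<mu>0)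
  then show "(\<Sum>i\<in>I. \<mu> (v i) * d i) = 0"
    using swap[of \<mu>] \<mu>_sum lin by (simp add: j_ac)
qed

text \<open>Lists allow repetitions, so sums become concatenations and automorphisms act entrywise
  on the coefficients.\<close>

abbreviation lincomb :: "('k alg_closure \<times> 'r geom) list \<Rightarrow> 'r geom" where
  "lincomb xs \<equiv> (\<Sum>(v, d)\<leftarrow>xs. j v * d)"

text \<open>Such sums of products form a ring because D and \<open>Ks\<close> are rings; they
  contain both, hence all that is generated.\<close>

lemma alg_gen_Ks_rep:
  assumes D: "subalg to_ac D" and z: "z \<in> alg_gen to_ac (D \<union> Ks)"
  shows "\<exists>xs. set xs \<subseteq> ac.sep \<times> D \<and> z = lincomb xs"
proof -
  have N: "subalg to_ac (ac.sep :: 'k alg_closure set)" by (rule ac.subalg_sep)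
  let ?S = "{\<Sum>(v, d)\<leftarrow>xs. j v * d | xs. set xs \<subseteq> ac.sep \<times> D}"
  have single: "j v * d \<in> ?S" if "v \<in> ac.sep" "d \<in> D" for v d
    by (intro CollectI exI[of _ "[(v, d)]"]) (use that in auto)
  have add: "a + b \<in> ?S" if "a \<in> ?S" "b \<in> ?S" for a b
  proof -
    obtain xs ys where "a = lincomb xs" "b = lincomb ys"
      "set xs \<subseteq> ac.sep \<times> D" "set ys \<subseteq> ac.sep \<times> D" using \<open>a \<in> ?S\<close> \<open>b \<in> ?S\<close> by blast
    then show ?thesis by (intro CollectI exI[of _ "xs @ ys"]) auto
  qed
  have mult1: "j v * d * b \<in> ?S" if vd: "v \<in> ac.sep" "d \<in> D" and b: "b \<in> ?S" for v d b
  proof -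
    obtain xs where xs: "b = lincomb xs" "set xs \<subseteq> ac.sep \<times> D" using b by blast
    have "j v * d * b = (\<Sum>(w, c)\<leftarrow>map (\<lambda>(w, c). (v * w, d * c)) xs. j w * c)"
      unfolding xs(1)
    proof (induction xs)
      case (Cons p xs)
      obtain w c where p: "p = (w, c)" by (cases p)
      have "j v * d * (j w * c) = j (v * w) * (d * c)"
        by (simp only: j.hom_mult mult_ac)
      then show ?case using Cons by (simp only: p list.map prod.case sum_list.Cons distrib_left)
    qed simp
    moreover have "set (map (\<lambda>(w, c). (v * w, d * c)) xs) \<subseteq> ac.sep \<times> D"
      using xs(2) vd subalg_mult[OF N] subalg_mult[OF D] by auto
    ultimately show ?thesis by blast
  qed
  have zero: "0 \<in> ?S" by (intro CollectI exI[of _ "[]"]) simp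
  have mult: "a * b \<in> ?S" if a: "a \<in> ?S" and b: "b \<in> ?S" for a b
  proof -
    obtain xs where "a = lincomb xs" "set xs \<subseteq> ac.sep \<times> D" using a by blast
    then show ?thesis
    proof (induction xs arbitrary: a)
      case (Cons p xs)
      obtain v d where p: "p = (v, d)" by (cases p)
      have "a * b = j v * d * b + lincomb xs * b"
        using Cons.prems(1) by (simp add: p distrib_right)
      moreover have "j v * d * b \<in> ?S" using Cons.prems(2) p by (intro mult1 b) auto
      moreover have "lincomb xs * b \<in> ?S" using Cons by auto
      ultimately show ?case using add by simp
    qed (use zero in simp)
  qed
  have "alg_gen to_ac (D \<union> Ks) \<subseteq> ?S"
  proof (rule alg_gen_least[OF subalgI])
    show "to_ac c \<in> ?S" for c
      using single[OF ac.subalg_1[OF N] subalg_base[OF D]] by simp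
    show "D \<union> Ks \<subseteq> ?S"
      using single[OF ac.subalg_1[OF N]] single[OF _ ac.subalg_1[OF D]] unfolding Ks_eq by auto
  qed (use add mult in blast)+
  then show ?thesis using z by blast
qed

end

section \<open>The field cut out by a solution of the embedding problem\<close>

locale geom_solution = geom_cover \<iota> n x f
  for \<iota> :: "'k::field \<Rightarrow> 'r::idom" and n x f +
  fixes \<theta> :: "('r geom \<Rightarrow> 'r geom) \<Rightarrow> ('r geom \<Rightarrow> 'r geom)"
  assumes sol: "embedding_solution \<iota> f \<theta>"
begin

section \<open>Gluing the values of a solution with the Galois action\<close>

abbreviation GK where "GK \<equiv> absolute_Gal \<iota>"

lemma \<theta>_in: "g \<in> carrier GK \<Longrightarrow> \<theta> g \<in> carrier (Gal F E)"
  using sol by (auto simp: embedding_solution_def hom_def function_field_def)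

lemma GK_mult: "g \<in> carrier GK \<Longrightarrow> h \<in> carrier GK \<Longrightarrow> g \<otimes>\<^bsub>GK\<^esub> h = compose Ks g h"
  unfolding absolute_Gal_def by (rule Gal_mult)

lemma \<theta>_compose:
  assumes "g \<in> carrier GK" "h \<in> carrier GK" "z \<in> F"
  shows "\<theta> (compose Ks g h) z = \<theta> g (\<theta> h z)"
proof -
  have "\<theta> (g \<otimes>\<^bsub>GK\<^esub> h) = \<theta> g \<otimes>\<^bsub>Gal F E\<^esub> \<theta> h"
    using sol assms(1,2) by (auto simp: embedding_solution_def hom_def function_field_def)
  then have "\<theta> (compose Ks g h) = \<theta> g \<otimes>\<^bsub>Gal F E\<^esub> \<theta> h"
    by (simp only: GK_mult[OF assms(1,2)])
  also have "\<dots> = compose F (\<theta> g) (\<theta> h)" by (rule Gal_mult[OF \<theta>_in \<theta>_in]) fact+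
  finally show ?thesis using assms(3) by (simp add: compose_def)
qed

text \<open>The form in which \<alpha> \<circ> \<theta> = \<pi> enters the gluing in
  \<open>lift\<close>.\<close>

lemma \<theta>_constant:
  assumes g: "g \<in> carrier GK" and z: "z \<in> F" "z \<in> range j"
  shows "\<theta> g z = g z"
proof -
  have "embed_\<alpha> \<iota> f (\<theta> g) = embed_\<pi> \<iota> f g"
    using sol g by (auto simp: embedding_solution_def)
  then have "restrict (\<theta> g) (constant_field \<iota> f) = restrict g (constant_field \<iota> f)"
    using g \<theta>_in[OF g] by (simp add: embed_\<alpha>_def embed_\<pi>_def function_field_def)
  moreover have "z \<in> constant_field \<iota> f"
    using z by (simp add: constant_field_def range_j)
  ultimately show ?thesis by (metis restrict_apply')
qed

text \<open>Elements of F fixed by all automorphisms over E Ks lie in E Ks, as F is separable over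
  E. With the d chosen independent over K, an automorphism fixing F fixes z and can only alter the
  coefficients; linear disjointness of E makes these unique, so they are fixed and lie in F.\<close>

lemma fixed_E_Ks_rep:
  assumes z: "z \<in> F" and fixed: "\<And>b. b \<in> fixing (E \<union> Ks) \<Longrightarrow> b z = z"
  obtains A v where "finite A" "A \<subseteq> E" "z = (\<Sum>d\<in>A. j (v d) * d)"
    "\<And>d. d \<in> A \<Longrightarrow> v d \<in> ac.sep" "\<And>d. d \<in> A \<Longrightarrow> j (v d) \<in> F"
proof -
  have E: "subalg to_ac E" by (rule ac.subalg_range)
  have N: "subalg to_ac (alg_gen to_ac (E \<union> Ks))" by (rule subalg_alg_gen)
  have "z \<in> alg_gen to_ac (E \<union> Ks)"
  proof (rule ac.sep_fixed_mem[OF N])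
    show "z \<in> ac.sep" using z F_sep by blast
    fix \<psi> assume "\<psi> \<in> fixing (alg_gen to_ac (E \<union> Ks))"
    moreover have "E \<union> Ks \<subseteq> alg_gen to_ac (E \<union> Ks)" by (auto intro: alg_gen.gen)
    ultimately show "\<psi> z = z" using fixed fixing_mono by blast
  qed
  then obtain xs where xs: "set xs \<subseteq> ac.sep \<times> E" "z = lincomb xs"
    using alg_gen_Ks_rep[OF E] by blast
  have zsum: "z = (\<Sum>i<length xs. j (fst (xs ! i)) * snd (xs ! i))"
    unfolding xs(2) sum_list_sum_nth by (simp add: case_prod_beta atLeast0LessThan)
  obtain A c where A: "finite A" "A \<subseteq> (\<lambda>i. snd (xs ! i)) ` {..<length xs}" "kv.independent A"
    "\<And>i. i \<in> {..<length xs} \<Longrightarrow> snd (xs ! i) = (\<Sum>a\<in>A. \<kappa> (c i a) * a)"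
    using basis_expand[of "{..<length xs}" "\<lambda>i. snd (xs ! i)"] by blast
  define v where "v a = (\<Sum>i<length xs. fst (xs ! i) * to_ac (c i a))" for a
  have S: "subalg to_ac (ac.sep :: 'k alg_closure set)" by (rule ac.subalg_sep)
  have "A \<subseteq> E" using A(2) xs(1) by (force dest: nth_mem)
  have vsep: "v a \<in> ac.sep" for a
    unfolding v_def using xs(1)
    by (intro ac.subalg_sum[OF S] subalg_mult[OF S] subalg_base[OF S]) (force dest: nth_mem)
  have "z = (\<Sum>i<length xs. \<Sum>a\<in>A. j (fst (xs ! i)) * \<kappa> (c i a) * a)"
    unfolding zsum by (intro sum.cong refl, subst A(4)) (simp, simp only: sum_distrib_left mult.assoc)
  also have "\<dots> = (\<Sum>a\<in>A. \<Sum>i<length xs. j (fst (xs ! i)) * \<kappa> (c i a) * a)" by (rule sum.swap)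
  also have "\<dots> = (\<Sum>a\<in>A. j (v a) * a)"
    by (simp only: v_def j.hom_sum j.hom_mult j_ac sum_distrib_right)
  finally have zA: "z = (\<Sum>a\<in>A. j (v a) * a)" .
  have "j (v a) \<in> F" if a: "a \<in> A" for a
  proof (rule ac.sep_fixed_mem[OF subalg_F])
    show "j (v a) \<in> ac.sep" using vsep Ks_sep unfolding Ks_eq by blast
    fix \<psi> assume \<psi>: "\<psi> \<in> fixing F"
    have EF: "E \<subseteq> F" using subalg_F by (auto simp: subalg_def)
    then have \<psi>E: "\<psi> \<in> fixing E" using \<psi> fixing_mono by blast
    interpret p: field_hom \<psi> using \<psi> by (rule fixing_hom)
    have "\<forall>a. \<exists>u. \<psi> (j (v a)) = j u" using fixing_range_j(1)[OF \<psi>E] by blast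
    then obtain w where w: "\<And>a. \<psi> (j (v a)) = j (w a)" by metis
    have "\<psi> z = (\<Sum>a\<in>A. \<psi> (j (v a)) * \<psi> a)"
      unfolding zA by (simp only: p.hom_sum p.hom_mult)
    also have "\<dots> = (\<Sum>a\<in>A. j (w a) * a)"
      using \<open>A \<subseteq> E\<close> fixing_fix[OF \<psi>E] by (intro sum.cong refl) (auto simp: w)
    finally have "(\<Sum>a\<in>A. j (w a) * a) = (\<Sum>a\<in>A. j (v a) * a)"
      using zA fixing_fix[OF \<psi> z] by simp
    then have "(\<Sum>a\<in>A. j (w a - v a) * a) = 0"
      by (simp only: j.hom_minus left_diff_distrib sum_subtractf diff_self)
    from lin_disjoint_indep[OF lin_disjoint_E A(1) \<open>A \<subseteq> E\<close> A(3) this a] show "\<psi> (j (v a)) = j (v a)"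
      by (simp add: w)
  qed
  then show thesis using that A(1) \<open>A \<subseteq> E\<close> zA vsep by blast
qed

text \<open>Let \<gamma>1 extend g and \<tau> extend \<theta> g. Then \<delta> = \<gamma>1^-1 \<tau>
  is the identity on F \<inter> E Ks by \<open>fixed_E_Ks_rep\<close> and
  \<open>\<theta>_constant\<close>, so by \<open>artin\<close> it agrees on the roots, hence on F,
  with some b fixing E Ks; \<gamma>1 b is the glued automorphism.\<close>

lemma lift:
  assumes g: "g \<in> carrier GK"
  shows "\<exists>\<gamma>\<in>fixing E. (\<forall>z\<in>Ks. \<gamma> z = g z) \<and> (\<forall>z\<in>F. \<gamma> z = \<theta> g z)"
proof -
  obtain \<sigma> where \<sigma>: "\<sigma> \<in> fixing (range to_ac)" "\<forall>v\<in>ac.sep. g (j v) = j (\<sigma> v)"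
    using gal_extends[OF g] by blast
  obtain \<gamma>1 where \<gamma>1: "\<gamma>1 \<in> fixing E" "\<forall>v. \<gamma>1 (j v) = j (\<sigma> v)" using extend_alg[OF \<sigma>(1)] by blast
  have \<gamma>1_Ks: "\<gamma>1 z = g z" if "z \<in> Ks" for z using that \<sigma>(2) \<gamma>1(2) unfolding Ks_eq by auto
  note t = \<theta>_in[OF g]
  have "partial_hom to_ac to_ac {(z, \<theta> g z) | z. z \<in> F}"
    unfolding partial_hom_def
  proof (intro conjI allI impI)
    show "(to_ac c, to_ac c) \<in> {(z, \<theta> g z) | z. z \<in> F}" for c
      using t subalg_base[OF subalg_F, of c] by (auto simp: Gal_carrier)
    fix a b c d assume "(a, b) \<in> {(z, \<theta> g z) | z. z \<in> F}" "(c, d) \<in> {(z, \<theta> g z) | z. z \<in> F}"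
    then have "a \<in> F" "c \<in> F" "b = \<theta> g a" "d = \<theta> g c" by auto
    then show "(a + c, b + d) \<in> {(z, \<theta> g z) | z. z \<in> F}" "(a * c, b * d) \<in> {(z, \<theta> g z) | z. z \<in> F}"
      using t subalg_add[OF subalg_F] subalg_mult[OF subalg_F] unfolding Gal_carrier by auto
  next
    fix b assume "(0, b) \<in> {(z, \<theta> g z) | z. z \<in> F}"
    moreover have "\<theta> g (to_ac 0) = to_ac 0" using t unfolding Gal_carrier by blast
    ultimately show "b = 0" by auto
  qed
  from ac.self.extend_hom[OF this] obtain \<tau> where \<tau>: "field_hom \<tau>"
    "\<And>a b. (a, b) \<in> {(z, \<theta> g z) | z. z \<in> F} \<Longrightarrow> \<tau> a = b" by blast
  have \<tau>F: "\<tau> z = \<theta> g z" if "z \<in> F" for z by (rule \<tau>(2)) (use that in blast)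
  have \<tau>E: "\<tau> z = z" if "z \<in> E" for z
    using \<tau>F[of z] that t subalg_F unfolding Gal_carrier subalg_def by auto
  then have \<tau>fix: "\<tau> \<in> fixing E" using \<tau>(1) by (simp add: fixing_def)
  define \<delta> where "\<delta> z = inv_into UNIV \<gamma>1 (\<tau> z)" for z
  have \<delta>fix: "\<delta> \<in> fixing E"
    unfolding \<delta>_def by (rule fixing_comp[OF ac.fixing_inv(1)[OF \<gamma>1(1)] \<tau>fix])
  interpret d: field_hom \<delta> using \<delta>fix by (rule fixing_hom)
  have "\<exists>b\<in>fixing (E \<union> Ks). \<forall>u\<in>Rt. \<delta> u = b u"
  proof (rule ac.artin[OF subalg_F])
    show "fixing (E \<union> Ks) \<subseteq> fixing E" by (rule fixing_mono) blast
    show "(\<lambda>x. x) \<in> fixing (E \<union> Ks)" by (rule id_fixing)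
    show "(\<lambda>x. a (b x)) \<in> fixing (E \<union> Ks)" if "a \<in> fixing (E \<union> Ks)" "b \<in> fixing (E \<union> Ks)" for a b
      using that by (rule fixing_comp)
    show "finite Rt" by (rule finite_roots)
    show "b u \<in> F" if b: "b \<in> fixing (E \<union> Ks)" and u: "u \<in> Rt" for b u
    proof -
      have "b \<in> fixing E" using b fixing_mono[of E "E \<union> Ks"] by blast
      then have "b u \<in> Rt" using u by (rule fixing_roots)
      then show ?thesis unfolding F_eq by (rule alg_gen.gen)
    qed
    show "field_hom \<delta>" by unfold_locales
    fix z assume z: "z \<in> F" and "\<And>b. b \<in> fixing (E \<union> Ks) \<Longrightarrow> b z = z"
    then obtain A v where A: "finite A" "A \<subseteq> E" "z = (\<Sum>d\<in>A. j (v d) * d)"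
      "\<And>d. d \<in> A \<Longrightarrow> v d \<in> ac.sep" "\<And>d. d \<in> A \<Longrightarrow> j (v d) \<in> F"
      using fixed_E_Ks_rep by blast
    have "\<delta> (j (v d)) = j (v d)" if d: "d \<in> A" for d
    proof -
      have "\<tau> (j (v d)) = g (j (v d))"
        using \<tau>F[OF A(5)[OF d]] \<theta>_constant[OF g A(5)[OF d]] by simp
      also have "\<dots> = \<gamma>1 (j (v d))" using \<sigma>(2) \<gamma>1(2) A(4)[OF d] by simp
      finally show ?thesis by (simp add: \<delta>_def ac.fixing_inv(3)[OF \<gamma>1(1)])
    qed
    then have "\<delta> (j (v d) * d) = j (v d) * d" if "d \<in> A" for d
      using that A(2) fixing_fix[OF \<delta>fix] by (auto simp: d.hom_mult)
    then show "\<delta> z = z" unfolding A(3) d.hom_sum by (intro sum.cong refl)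
  qed
  then obtain b where b: "b \<in> fixing (E \<union> Ks)" "\<forall>u\<in>Rt. \<delta> u = b u" by blast
  then have bE: "b \<in> fixing E" using fixing_mono[of E "E \<union> Ks"] by blast
  interpret b: field_hom b using bE by (rule fixing_hom)
  have bF: "b z = \<delta> z" if "z \<in> F" for z
    using that unfolding F_eq
  proof induction
    case (base c)
    then show ?case using fixing_fix[OF bE] fixing_fix[OF \<delta>fix] by simp
  qed (use b(2) in \<open>auto simp: b.hom_add b.hom_mult d.hom_add d.hom_mult\<close>)
  show ?thesis
  proof (intro bexI[of _ "\<lambda>z. \<gamma>1 (b z)"] conjI ballI)
    show "(\<lambda>z. \<gamma>1 (b z)) \<in> fixing E" by (rule fixing_comp[OF \<gamma>1(1) bE])
    show "\<gamma>1 (b z) = g z" if "z \<in> Ks" for z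
      using that \<gamma>1_Ks fixing_fix[OF b(1)] by simp
    show "\<gamma>1 (b z) = \<theta> g z" if "z \<in> F" for z
      using that by (simp add: bF \<delta>_def ac.fixing_inv(2)[OF \<gamma>1(1)] \<tau>F)
  qed
qed

section \<open>The group H and the function field of the twisted cover\<close>

definition H :: "('r geom \<Rightarrow> 'r geom) set" where
  "H = {\<gamma> \<in> fixing E. \<forall>z\<in>F. \<gamma> z = \<theta> (restrict \<gamma> Ks) z}"

lemma H_fixing: "H \<subseteq> fixing E"
  by (auto simp: H_def)

lemma H_lift:
  assumes g: "g \<in> carrier GK"
  shows "\<exists>\<gamma>\<in>H. (\<forall>z\<in>Ks. \<gamma> z = g z) \<and> (\<forall>z\<in>F. \<gamma> z = \<theta> g z)"
proof -
  obtain \<gamma> where \<gamma>: "\<gamma> \<in> fixing E" "\<forall>z\<in>Ks. \<gamma> z = g z" "\<forall>z\<in>F. \<gamma> z = \<theta> g z" using lift[OF g] by blast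
  have "g \<in> extensional Ks" using g unfolding absolute_Gal_def Gal_carrier by blast
  then have "restrict \<gamma> Ks = g" using \<gamma>(2) by (auto simp: fun_eq_iff extensional_def restrict_def)
  then show ?thesis using \<gamma> by (intro bexI[of _ \<gamma>]) (auto simp: H_def)
qed

lemma GK_one: "restrict (\<lambda>z. z) Ks \<in> carrier GK"
  by (rule restrict_absolute_Gal[OF id_fixing])

text \<open>The identity is idempotent, and so is its image; an injective idempotent map is the
  identity.\<close>

lemma \<theta>_one:
  assumes "z \<in> F"
  shows "\<theta> (restrict (\<lambda>z. z) Ks) z = z"
proof -
  let ?e = "restrict (\<lambda>z. z) Ks"
  have e: "?e \<in> carrier GK" by (rule GK_one)
  have "compose Ks ?e ?e = ?e" by (auto simp: compose_def)
  then have "\<theta> ?e z = \<theta> ?e (\<theta> ?e z)" using \<theta>_compose[OF e e assms] by simp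
  moreover have "inj_on (\<theta> ?e) F" "\<theta> ?e z \<in> F"
    using \<theta>_in[OF e] assms Gal_in[OF \<theta>_in[OF e]] by (auto simp: Gal_carrier bij_betw_def)
  ultimately show ?thesis using assms by (metis inj_onD)
qed

lemma H_id: "(\<lambda>z. z) \<in> H"
  using \<theta>_one by (simp add: H_def id_fixing)

lemma H_comp:
  assumes a: "a \<in> H" and b: "b \<in> H"
  shows "(\<lambda>z. a (b z)) \<in> H"
proof -
  have aE: "a \<in> fixing E" and bE: "b \<in> fixing E" using a b H_fixing by auto
  have "a (b z) = \<theta> (restrict (\<lambda>z. a (b z)) Ks) z" if z: "z \<in> F" for z
  proof -
    have "restrict (\<lambda>z. a (b z)) Ks = compose Ks (restrict a Ks) (restrict b Ks)"
      using fixing_Ks[OF bE] by (auto simp: compose_def fun_eq_iff)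
    then have "\<theta> (restrict (\<lambda>z. a (b z)) Ks) z = \<theta> (restrict a Ks) (\<theta> (restrict b Ks) z)"
      using \<theta>_compose[OF restrict_absolute_Gal[OF aE] restrict_absolute_Gal[OF bE] z] by simp
    also have "\<dots> = a (b z)"
      using a b z fixing_F[OF bE z] by (simp add: H_def)
    finally show ?thesis by simp
  qed
  then show ?thesis using fixing_comp[OF aE bE] by (simp add: H_def)
qed

text \<open>The compositum of F and \<open>Ks\<close>; since F is generated over E by the roots,
  \<open>Rt\<close> suffices.\<close>

definition Z :: "'r geom set" where "Z = alg_gen to_ac (Rt \<union> Ks)"

definition D :: "'r geom set" where "D = {z \<in> Z. \<forall>\<gamma>\<in>H. \<gamma> z = z}"

lemma subalg_Z: "subalg to_ac Z"
  unfolding Z_def by (rule subalg_alg_gen)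

lemma subalg_D: "subalg to_ac D"
proof (rule subalgI)
  show "to_ac c \<in> D" for c
    using subalg_base[OF subalg_Z] fixing_fix[OF subsetD[OF H_fixing]] by (simp add: D_def)
  fix a b assume ab: "a \<in> D" "b \<in> D"
  have "\<gamma> (a + b) = a + b" "\<gamma> (a * b) = a * b" if \<gamma>: "\<gamma> \<in> H" for \<gamma>
  proof -
    interpret g: field_hom \<gamma> using \<gamma> H_fixing fixing_hom by blast
    have "\<gamma> a = a" "\<gamma> b = b" using ab \<gamma> by (auto simp: D_def)
    then show "\<gamma> (a + b) = a + b" "\<gamma> (a * b) = a * b" by (simp_all only: g.hom_add g.hom_mult)
  qed
  then show "a + b \<in> D" "a * b \<in> D"
    using ab subalg_add[OF subalg_Z] subalg_mult[OF subalg_Z] by (simp_all add: D_def)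
qed

lemma subalg_\<kappa>_D: "subalg \<kappa> D"
  using subalg_D \<kappa>_E unfolding subalg_def by blast

text \<open>H maps onto Gal(K) by \<open>H_lift\<close>, so a separable power of w is fixed by all
  automorphisms over K. Only a power of w descends, as K may be imperfect.\<close>

lemma H_fixed_power:
  assumes w: "\<And>\<gamma>. \<gamma> \<in> H \<Longrightarrow> \<gamma> (j w) = j w"
  shows "\<exists>k. w ^ (char_exp TYPE('k alg_closure) ^ k) \<in> range to_ac"
proof -
  obtain k where k: "w ^ (char_exp TYPE('k alg_closure) ^ k) \<in> ac.sep" (is "?u \<in> _")
    using ac.power_in_sep by blast
  have "?u \<in> range to_ac"
  proof (rule ac.sep_fixed_mem[OF ac.subalg_range k])
    fix \<psi> :: "'k alg_closure \<Rightarrow> 'k alg_closure" assume "\<psi> \<in> fixing (range to_ac)"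
    then obtain g where g: "g \<in> carrier GK" "\<forall>v\<in>ac.sep. g (j v) = j (\<psi> v)" using gal_of by blast
    obtain \<gamma> where \<gamma>: "\<gamma> \<in> H" "\<forall>z\<in>Ks. \<gamma> z = g z" using H_lift[OF g(1)] by blast
    interpret g: field_hom \<gamma> using \<gamma>(1) H_fixing fixing_hom by blast
    have "j ?u \<in> Ks" using k unfolding Ks_eq by blast
    then have "j (\<psi> ?u) = \<gamma> (j ?u)" using g(2) \<gamma>(2) k by simp
    also have "\<dots> = j ?u" using w[OF \<gamma>(1)] by (simp only: j.hom_power g.hom_power)
    finally show "\<psi> ?u = ?u" by simp
  qed
  then show ?thesis by blast
qed

text \<open>A relation with purely inseparable coefficients is raised to the power \<open>q\<close>; by separability, elements
  that are independent over \<open>E\<close> have independent \<open>q\<close>-th powers.\<close>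

lemma D_indep_power:
  assumes A: "finite A" "A \<subseteq> Z" "kv.independent A"
    and zero: "(\<Sum>d\<in>A. j (w d) * d) = 0"
    and pow: "\<And>d. d \<in> A \<Longrightarrow> w d ^ (char_exp TYPE('k alg_closure) ^ k) \<in> range to_ac" and d: "d \<in> A"
  shows "w d = 0"
proof (rule ccontr)
  assume "w d \<noteq> 0"
  have CH: "char_exp TYPE('k alg_closure) = char_exp TYPE('r geom)"
    using field_hom_CHAR[OF \<kappa>_hom] by (simp add: char_exp_def)
  define q where "q = char_exp TYPE('r geom) ^ k"
  obtain c where c: "\<And>d. d \<in> A \<Longrightarrow> w d ^ q = to_ac (c d)"
    using pow unfolding q_def CH image_iff by metis
  have U: "Rt \<union> Ks \<subseteq> ac.sep" using roots_sep Ks_sep by blast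
  \<comment> \<open>\<open>A\<close> is known to be independent over K only; coordinates with
    respect to a maximal E-independent subset \<open>B\<close> reduce the relation to relations
    inside E.\<close>
  obtain B where B: "B \<subseteq> A" "ac.vs.independent B" "A \<subseteq> ac.vs.span B"
    using ac.vs.maximal_independent_subset[of A] by blast
  have finB: "finite B" using B(1) A(1) by (rule finite_subset)
  have "\<forall>d\<in>A. \<exists>e. d = (\<Sum>b\<in>B. to_ac (e b) * b)"
    using B(3) ac.vs.span_finite[OF finB] by blast
  then obtain e where e: "\<And>d. d \<in> A \<Longrightarrow> d = (\<Sum>b\<in>B. to_ac (e d b) * b)" by metis
  have frob: "sum g S ^ q = (\<Sum>i\<in>S. g i ^ q)" for g :: "'r geom \<Rightarrow> 'r geom" and S
    unfolding q_def by (rule frobenius_sum[OF refl])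
  have "(\<Sum>d\<in>A. j (w d) * d) ^ q = 0"
    unfolding zero q_def using char_exp_pos[where 'a="'r geom"] by (intro zero_power) simp
  then have "(\<Sum>d\<in>A. j (w d) ^ q * d ^ q) = 0"
    by (simp only: frob power_mult_distrib)
  moreover have "j (w d) ^ q * d ^ q = (\<Sum>b\<in>B. to_ac (to_fract (\<iota> (c d)) * e d b ^ q) * b ^ q)" if d: "d \<in> A" for d
  proof -
    have 1: "j (w d) ^ q = to_ac (to_fract (\<iota> (c d)))"
      using c[OF d] j_ac[of "c d"] by (simp only: j.hom_power[symmetric]) (simp only: \<kappa>_def to_geom_def)
    have "d ^ q = (\<Sum>b\<in>B. (to_ac (e d b) * b) ^ q)" by (subst e[OF d]) (rule frob)
    then have "j (w d) ^ q * d ^ q = (\<Sum>b\<in>B. to_ac (to_fract (\<iota> (c d))) * (to_ac (e d b) * b) ^ q)"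
      by (simp only: 1 sum_distrib_left)
    then show ?thesis by (simp only: to_ac_mult to_ac_power power_mult_distrib mult.assoc)
  qed
  ultimately have "(\<Sum>d\<in>A. \<Sum>b\<in>B. to_ac (to_fract (\<iota> (c d)) * e d b ^ q) * b ^ q) = 0" by simp
  then have "(\<Sum>b\<in>B. \<Sum>d\<in>A. to_ac (to_fract (\<iota> (c d)) * e d b ^ q) * b ^ q) = 0" by (subst sum.swap)
  then have sumB: "(\<Sum>b\<in>B. to_ac (\<Sum>d\<in>A. to_fract (\<iota> (c d)) * e d b ^ q) * b ^ q) = 0"
    by (simp only: to_ac_sum sum_distrib_right)
  have BZ: "B \<subseteq> alg_gen to_ac (Rt \<union> Ks)" using B(1) A(2) by (simp add: Z_def)
  \<comment> \<open>Comparing coefficients at the independent powers b^q and extracting q-th roots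
    gives a relation with the original coefficients w d, now between elements of E.\<close>
  have coeff0: "(\<Sum>d\<in>A. j (w d) * to_ac (e d b)) = 0" if b: "b \<in> B" for b
  proof -
    have "(\<Sum>d\<in>A. to_fract (\<iota> (c d)) * e d b ^ q) = 0"
      by (rule ac.sep_power_independent[OF U q_def finB BZ B(2) sumB b])
    then have "to_ac (\<Sum>d\<in>A. to_fract (\<iota> (c d)) * e d b ^ q) = 0" by simp
    then have "(\<Sum>d\<in>A. to_ac (to_fract (\<iota> (c d))) * to_ac (e d b) ^ q) = 0"
      by (simp only: to_ac_sum to_ac_mult to_ac_power)
    moreover have "to_ac (to_fract (\<iota> (c d))) * to_ac (e d b) ^ q = (j (w d) * to_ac (e d b)) ^ q"
      if d: "d \<in> A" for d
      using c[OF d] j_ac[of "c d"]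
      by (simp only: power_mult_distrib j.hom_power[symmetric]) (simp only: \<kappa>_def to_geom_def)
    ultimately have "(\<Sum>d\<in>A. (j (w d) * to_ac (e d b)) ^ q) = 0" by simp
    then have "(\<Sum>d\<in>A. j (w d) * to_ac (e d b)) ^ q = 0" by (simp only: frob)
    then show ?thesis by simp
  qed
  \<comment> \<open>Linear disjointness of E lets a functional normalised at w d replace the
    coefficients; reassembling along \<open>B\<close> contradicts independence of \<open>A\<close>
    over K.\<close>
  obtain \<rho> :: "'k alg_closure \<Rightarrow> 'k" where \<rho>: "\<And>x y. \<rho> (x + y) = \<rho> x + \<rho> y"
    "\<And>x c. \<rho> (x * to_ac c) = \<rho> x * c" "\<rho> (w d) = 1"
    using functional_exists[OF \<open>w d \<noteq> 0\<close>] by blast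
  have "(\<Sum>d\<in>A. \<kappa> (\<rho> (w d)) * to_ac (e d b)) = 0" if b: "b \<in> B" for b
    by (rule lin_disjointD[OF lin_disjoint_E A(1) _ _ _ coeff0[OF b], where \<mu> = "\<lambda>v. \<kappa> (\<rho> v)"])
       (auto simp: \<rho>(1,2) \<kappa>.hom_add \<kappa>.hom_mult j_ac)
  then have "(\<Sum>b\<in>B. (\<Sum>d\<in>A. \<kappa> (\<rho> (w d)) * to_ac (e d b)) * b) = 0" by simp
  then have "(\<Sum>b\<in>B. \<Sum>d\<in>A. \<kappa> (\<rho> (w d)) * (to_ac (e d b) * b)) = 0"
    by (simp only: sum_distrib_right mult.assoc)
  then have "(\<Sum>d\<in>A. \<Sum>b\<in>B. \<kappa> (\<rho> (w d)) * (to_ac (e d b) * b)) = 0" by (subst sum.swap)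
  then have "(\<Sum>d\<in>A. \<kappa> (\<rho> (w d)) * (\<Sum>b\<in>B. to_ac (e d b) * b)) = 0"
    by (simp only: sum_distrib_left)
  moreover have "(\<Sum>d\<in>A. \<kappa> (\<rho> (w d)) * (\<Sum>b\<in>B. to_ac (e d b) * b)) = (\<Sum>d\<in>A. \<kappa> (\<rho> (w d)) * d)"
    by (intro sum.cong refl) (simp only: e[symmetric])
  ultimately have "(\<Sum>d\<in>A. \<kappa> (\<rho> (w d)) * d) = 0" by simp
  then have "\<rho> (w d) = 0" using kv.independentD[OF A(3,1) order_refl, of "\<lambda>d. \<rho> (w d)" d] d by simp
  then show False using \<rho>(3) by simp
qed

text \<open>In a relation of minimal length with one coefficient equal to 1 all coefficients are fixed by \<open>H\<close>.\<close>

lemma D_indep: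
  assumes "finite A" "A \<subseteq> D" "kv.independent A" "(\<Sum>d\<in>A. j (v d) * d) = 0" "d \<in> A"
  shows "v d = 0"
  using assms
proof (induction "card A" arbitrary: A v d rule: less_induct)
  case less
  show ?case
  proof (rule ccontr)
    assume nz: "v d \<noteq> 0"
    define w where "w a = v a * inverse (v d)" for a
    have wd: "w d = 1" using nz by (simp add: w_def)
    have "(\<Sum>a\<in>A. j (w a) * a) = (\<Sum>a\<in>A. j (v a) * a) * j (inverse (v d))"
      unfolding w_def j.hom_mult sum_distrib_right by (intro sum.cong refl) (simp only: mult_ac)
    then have zero: "(\<Sum>a\<in>A. j (w a) * a) = 0" using less.prems(4) by simp
    have fixed: "\<gamma> (j (w a)) = j (w a)" if \<gamma>: "\<gamma> \<in> H" and a: "a \<in> A" for \<gamma> a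
    proof -
      have \<gamma>E: "\<gamma> \<in> fixing E" using \<gamma> H_fixing by blast
      interpret g: field_hom \<gamma> using \<gamma>E by (rule fixing_hom)
      have "\<forall>a. \<exists>u. \<gamma> (j (w a)) = j u" using fixing_range_j(1)[OF \<gamma>E] by blast
      then obtain w' where w': "\<And>a. \<gamma> (j (w a)) = j (w' a)" by metis
      have "w' d = 1" using w'[of d] wd by (metis g.hom_one j.hom_one j.injectivity)
      have "\<gamma> (\<Sum>a\<in>A. j (w a) * a) = (\<Sum>a\<in>A. \<gamma> (j (w a)) * \<gamma> a)" by (simp only: g.hom_sum g.hom_mult)
      also have "\<dots> = (\<Sum>a\<in>A. j (w' a) * a)"
        using less.prems(2) \<gamma> by (intro sum.cong refl) (auto simp: w' D_def)
      finally have "(\<Sum>a\<in>A. j (w' a) * a) = 0" using zero by simp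
      \<comment> \<open>The conjugate relation also has coefficient 1 at d, so the difference is
        shorter and vanishes coefficientwise by induction.\<close>
      then have "(\<Sum>a\<in>A. j (w' a - w a) * a) = 0"
        using zero by (simp only: j.hom_minus left_diff_distrib sum_subtractf diff_self)
      moreover have "(\<Sum>a\<in>A. j (w' a - w a) * a)
          = j (w' d - w d) * d + (\<Sum>a\<in>A - {d}. j (w' a - w a) * a)"
        using less.prems(1,5) by (rule sum.remove)
      ultimately have zero': "(\<Sum>a\<in>A - {d}. j (w' a - w a) * a) = 0" using wd \<open>w' d = 1\<close> by simp
      have "w' a - w a = 0"
      proof (cases "a = d")
        case False
        have "card (A - {d}) < card A" using less.prems(1,5) by (rule card_Diff1_less)
        then show ?thesis
          using less.hyps[of "A - {d}" "\<lambda>a. w' a - w a" a] zero' less.prems(1,2) a False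
            kv.independent_mono[OF less.prems(3)] by blast
      qed (simp add: wd \<open>w' d = 1\<close>)
      then show ?thesis using w'[of a] by simp
    qed
    let ?c = "char_exp TYPE('k alg_closure)"
    obtain k where "\<forall>a\<in>A. w a ^ (?c ^ k) \<in> range to_ac"
      using ac.uniform_power[OF less.prems(1), of w] H_fixed_power fixed by blast
    moreover have "A \<subseteq> Z" using less.prems(2) by (auto simp: D_def)
    ultimately have "w d = 0"
      using D_indep_power[OF less.prems(1) _ less.prems(3) zero _ less.prems(5)] by blast
    then show False using wd by simp
  qed
qed

lemma lin_disjoint_D: "lin_disjoint j D"
  by (rule lin_disjointI) (rule D_indep)

text \<open>F is generated over E by finitely many roots, so the identity is isolated in its Galois
  group and its preimage under \<theta> is open; by \<open>krull_nbhd\<close> that preimage contains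
  the stabilizer of a finite set.\<close>

lemma \<theta>_continuous:
  obtains S where "finite S" "S \<subseteq> Ks"
    "\<And>g z. g \<in> carrier GK \<Longrightarrow> (\<And>s. s \<in> S \<Longrightarrow> g s = s) \<Longrightarrow> z \<in> F \<Longrightarrow> \<theta> g z = z"
proof -
  let ?oF = "restrict (\<lambda>z. z) F" and ?oK = "restrict (\<lambda>z. z) Ks"
  have F: "subalg to_ac F" by (rule subalg_F)
  have EF: "E \<subseteq> F" using F by (auto simp: subalg_def)
  have RF: "Rt \<subseteq> F" unfolding F_eq by (auto intro: alg_gen.gen)
  have one: "?oF \<in> carrier (Gal F E)" "?oF \<in> carrier (Gal F F)"
    using ac.subfield_set_subalg[OF F] EF by (auto intro!: Gal_one)
  have GFF: "g = ?oF" if "g \<in> carrier (Gal F F)" for g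
    using that by (auto simp: Gal_carrier extensional_def fun_eq_iff)
  have "?oF <#\<^bsub>Gal F E\<^esub> carrier (Gal F F) = {?oF}"
  proof -
    have "?oF \<otimes>\<^bsub>Gal F E\<^esub> ?oF = ?oF"
      using Gal_mult[OF one(1) one(1)] by (auto simp: compose_def fun_eq_iff)
    moreover have "carrier (Gal F F) = {?oF}" using GFF one(2) by blast
    ultimately show ?thesis unfolding l_coset_def by (simp only: UN_insert UN_empty Un_empty_right)
  qed
  moreover have "generate_field ring_of_type_algebra (E \<union> Rt) = F"
    by (simp add: splitting_field_def function_field_def)
  ultimately have "openin (krull F E) {?oF}"
    unfolding krull_def using one(1) finite_roots RF
    by (intro topology_generated_by_Basis CollectI exI[of _ ?oF] exI[of _ Rt]) auto
  then have op: "openin (absolute_krull \<iota>) {g \<in> topspace (absolute_krull \<iota>). \<theta> g \<in> {?oF}}"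
    using sol unfolding embedding_solution_def continuous_map_def function_field_def by blast
  have oK: "?oK \<in> carrier (Gal Ks (base_field \<iota>))"
    using GK_one by (simp add: absolute_Gal_def)
  have bf: "base_field \<iota> \<subseteq> Ks" "0 \<in> base_field \<iota>" "1 \<in> base_field \<iota>"
    unfolding base_field_alt using Ks_closed(7) \<kappa>.hom_zero \<kappa>.hom_one by (auto intro: rangeI)
  \<comment> \<open>The topology is given by generators, so its points are those of the basic
    cosets; the coset for the empty set contains the identity.\<close>
  have "?oK \<in> topspace (absolute_krull \<iota>)"
  proof -
    have "?oK \<in> carrier (Gal Ks (generate_field ring_of_type_algebra (base_field \<iota> \<union> {})))"
      by (rule Gal_fix_generate_field[OF subfield_set_Ks bf _ oK]) auto
    moreover have "?oK \<otimes>\<^bsub>Gal Ks (base_field \<iota>)\<^esub> ?oK = ?oK"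
      using Gal_mult[OF oK oK] by (auto simp: compose_def fun_eq_iff)
    ultimately have "?oK \<in> ?oK <#\<^bsub>Gal Ks (base_field \<iota>)\<^esub>
        carrier (Gal Ks (generate_field ring_of_type_algebra (base_field \<iota> \<union> {})))"
      unfolding l_coset_def by (metis (no_types, lifting) UN_iff singletonI)
    then show ?thesis
      unfolding absolute_krull_def krull_def topology_generated_by_topspace
      using oK by (intro UnionI[rotated]) (auto intro!: exI[of _ ?oK] exI[of _ "{}"])
  qed
  moreover have "\<theta> ?oK = ?oF"
  proof
    fix z
    have "\<theta> ?oK \<in> extensional F" using \<theta>_in[OF GK_one] by (simp add: Gal_carrier)
    then show "\<theta> ?oK z = ?oF z" using \<theta>_one by (cases "z \<in> F") (auto simp: extensional_def)
  qed
  ultimately have mem: "?oK \<in> {g \<in> topspace (absolute_krull \<iota>). \<theta> g \<in> {?oF}}" by simp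
  obtain S where S: "finite S" "S \<subseteq> Ks"
    "{g \<in> carrier (Gal Ks (base_field \<iota>)). \<forall>s\<in>S. g s = s} \<subseteq> {g \<in> topspace (absolute_krull \<iota>). \<theta> g \<in> {?oF}}"
    using krull_nbhd[OF subfield_set_Ks bf op[unfolded absolute_krull_def] mem[unfolded absolute_krull_def]]
    unfolding absolute_krull_def by blast
  show thesis
  proof (rule that[OF S(1,2)])
    fix g z assume "g \<in> carrier GK" "\<And>s. s \<in> S \<Longrightarrow> g s = s" "z \<in> F"
    then have "\<theta> g = ?oF" using S(3) unfolding absolute_Gal_def by blast
    then show "\<theta> g z = z" using \<open>z \<in> F\<close> by simp
  qed
qed

text \<open>An automorphism \<psi> over D Ks agrees on the roots and on S with some b in H, by
  \<open>artin\<close>. As \<psi> fixes Ks, b fixes S, so \<theta> of its restriction is trivial and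
  b, hence \<psi>, fixes r. Separability turns this into membership.\<close>

lemma roots_rep:
  assumes r: "r \<in> Rt"
  shows "\<exists>xs. set xs \<subseteq> ac.sep \<times> D \<and> r = lincomb xs"
proof (rule alg_gen_Ks_rep[OF subalg_D])
  obtain S where S: "finite S" "S \<subseteq> Ks"
    "\<And>g z. g \<in> carrier GK \<Longrightarrow> (\<And>s. s \<in> S \<Longrightarrow> g s = s) \<Longrightarrow> z \<in> F \<Longrightarrow> \<theta> g z = z"
    using \<theta>_continuous by metis
  show "r \<in> alg_gen to_ac (D \<union> Ks)"
  proof (rule ac.sep_fixed_mem[OF subalg_alg_gen])
    show "r \<in> ac.sep" using r roots_sep by blast
    fix \<psi> assume \<psi>: "\<psi> \<in> fixing (alg_gen to_ac (D \<union> Ks))"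
    have \<psi>fix: "\<psi> z = z" if "z \<in> D \<union> Ks" for z
      by (rule fixing_fix[OF \<psi>]) (use that in \<open>rule alg_gen.gen\<close>)
    have "\<exists>b\<in>H. \<forall>u\<in>Rt \<union> S. \<psi> u = b u"
    proof (rule ac.artin[OF subalg_Z H_fixing H_id])
      show "(\<lambda>x. a (b x)) \<in> H" if "a \<in> H" "b \<in> H" for a b using that by (rule H_comp)
      show "finite (Rt \<union> S)" using finite_roots S(1) by blast
      show "b u \<in> Z" if "b \<in> H" "u \<in> Rt \<union> S" for b u
      proof -
        have "b \<in> fixing E" using that(1) H_fixing by blast
        then have "b u \<in> Rt \<union> Ks" using that(2) S(2) fixing_roots[of b u] fixing_Ks[of b u] by blast
        then show ?thesis unfolding Z_def by (rule alg_gen.gen)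
      qed
      show "field_hom \<psi>" using \<psi> by (rule fixing_hom)
      show "\<psi> z = z" if "z \<in> Z" "\<And>b. b \<in> H \<Longrightarrow> b z = z" for z
        using that by (intro \<psi>fix) (simp add: D_def)
    qed
    then obtain b where b: "b \<in> H" "\<And>u. u \<in> Rt \<union> S \<Longrightarrow> \<psi> u = b u" by blast
    have rF: "r \<in> F" using r unfolding F_eq by (rule alg_gen.gen)
    have "b r = \<theta> (restrict b Ks) r" using b(1) rF by (simp add: H_def)
    also have "\<dots> = r"
    proof (rule S(3)[OF restrict_absolute_Gal _ rF])
      show "b \<in> fixing E" using b(1) H_fixing by blast
      fix s assume s: "s \<in> S"
      then show "restrict b Ks s = s" using b(2)[of s] \<psi>fix[of s] S(2) by auto
    qed
    finally show "\<psi> r = r" using b(2)[of r] r by simp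
  qed
qed

end

section \<open>Specialization at a rational point\<close>

text \<open>A homomorphism \<phi> on a ring A over the algebraic closure of K, lying over a
  K-rational point of V. Equivariance says that on the roots the action through \<theta> becomes the
  natural action of Gal(K).\<close>

locale specialization = geom_solution \<iota> n x f \<theta>
  for \<iota> :: "'k::field \<Rightarrow> 'r::idom" and n x f \<theta> +
  fixes \<phi> :: "'r geom \<Rightarrow> 'k alg_closure" and A :: "'r geom set"
  assumes A_j: "j v \<in> A" and A_add: "a \<in> A \<Longrightarrow> b \<in> A \<Longrightarrow> a + b \<in> A" and A_mult: "a \<in> A \<Longrightarrow> b \<in> A \<Longrightarrow> a * b \<in> A"
    and \<phi>_j: "\<phi> (j v) = v" and \<phi>_add: "a \<in> A \<Longrightarrow> b \<in> A \<Longrightarrow> \<phi> (a + b) = \<phi> a + \<phi> b"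
    and \<phi>_mult: "a \<in> A \<Longrightarrow> b \<in> A \<Longrightarrow> \<phi> (a * b) = \<phi> a * \<phi> b"
    and A_R: "to_geom r \<in> A" and \<phi>_R: "\<phi> (to_geom r) \<in> range to_ac"
    and roots_A: "Rt \<subseteq> A" and inj: "inj_on \<phi> Rt"
    and equivariant: "g \<in> carrier GK \<Longrightarrow> \<sigma> \<in> fixing (range to_ac) \<Longrightarrow> (\<And>v. v \<in> ac.sep \<Longrightarrow> g (j v) = j (\<sigma> v)) \<Longrightarrow>
      z \<in> Rt \<Longrightarrow> \<phi> (\<theta> g z) = \<sigma> (\<phi> z)"
begin

section \<open>The rational point under a specialization\<close>

lemma A_0: "0 \<in> A" and \<phi>_0: "\<phi> 0 = 0" and A_1: "1 \<in> A" and \<phi>_1: "\<phi> 1 = 1"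
  using A_j[of 0] \<phi>_j[of 0] A_j[of 1] \<phi>_j[of 1] by simp_all

lemma A_uminus: "a \<in> A \<Longrightarrow> - a \<in> A" and \<phi>_uminus: "a \<in> A \<Longrightarrow> \<phi> (- a) = - \<phi> a"
  using A_mult[OF A_j[of "- 1"], of a] \<phi>_mult[OF A_j[of "- 1"], of a] \<phi>_j[of "- 1"]
  by (simp_all add: j.hom_uminus)

text \<open>The evaluation of R at the point; \<open>\<phi>_R\<close> makes the inverse
  \<open>of_ac\<close> meaningful.\<close>

definition \<rho> :: "'r \<Rightarrow> 'k" where "\<rho> r = of_ac (\<phi> (to_geom r))"

lemma \<rho>: "to_ac (\<rho> r) = \<phi> (to_geom r)"
  unfolding \<rho>_def by (rule to_ac_of_ac[OF \<phi>_R])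

lemma \<rho>_hom: "comm_ring_hom \<rho>"
proof
  show "\<rho> 0 = 0" "\<rho> 1 = 1"
    using \<rho>[of 0] \<rho>[of 1] \<phi>_0 \<phi>_1 by (simp_all add: tg.hom_one)
  fix a b
  have "to_ac (\<rho> (a + b)) = to_ac (\<rho> a + \<rho> b)" "to_ac (\<rho> (a * b)) = to_ac (\<rho> a * \<rho> b)"
    by (simp_all only: \<rho> to_ac_add to_ac_mult tg.hom_add tg.hom_mult \<phi>_add[OF A_R A_R] \<phi>_mult[OF A_R A_R])
  then show "\<rho> (a + b) = \<rho> a + \<rho> b" "\<rho> (a * b) = \<rho> a * \<rho> b" by (simp_all only: to_ac_eq_iff)
qed

lemma \<rho>_\<iota>: "\<rho> (\<iota> c) = c"
proof -
  have "to_ac (\<rho> (\<iota> c)) = \<phi> (j (to_ac c))" by (simp only: \<rho> j_ac \<kappa>_def)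
  then show ?thesis by (simp only: \<phi>_j to_ac_eq_iff)
qed

definition pt :: "'r set" where "pt = {r. \<rho> r = 0}"

lemma pt_iff: "r - \<iota> c \<in> pt \<longleftrightarrow> c = \<rho> r"
proof -
  interpret r: comm_ring_hom \<rho> by (rule \<rho>_hom)
  show ?thesis by (auto simp: pt_def r.hom_minus \<rho>_\<iota>)
qed

lemma residue_pt: "residue \<iota> pt r = \<rho> r"
  by (simp add: residue_def pt_iff)

lemma pt_maximal: "maximalideal pt ring_of_type_algebra"
proof -
  interpret R: cring "ring_of_type_algebra :: 'r ring" by (rule cring_from_type_algebra)
  interpret r: comm_ring_hom \<rho> by (rule \<rho>_hom)
  have "ideal pt ring_of_type_algebra"
  proof (rule idealI[OF R.ring_axioms])
    show "subgroup pt (add_monoid ring_of_type_algebra)"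
      by (rule R.add.subgroupI)
         (auto simp: pt_def r.hom_add ring_of_type_algebra_a_inv r.hom_uminus intro: exI[of _ 0])
  qed (auto simp: pt_def r.hom_mult)
  then show ?thesis
  proof (rule maximalidealI)
    have "1 \<notin> pt" by (simp add: pt_def r.hom_one)
    then show "carrier ring_of_type_algebra \<noteq> pt" by auto
    fix J assume J: "ideal J (ring_of_type_algebra :: 'r ring)" "pt \<subseteq> J"
    interpret J: ideal J "ring_of_type_algebra :: 'r ring" by (rule J(1))
    show "J = pt \<or> J = carrier ring_of_type_algebra"
    proof (cases "J \<subseteq> pt")
      case False
      then obtain r where r: "r \<in> J" "\<rho> r \<noteq> 0" by (auto simp: pt_def)
      \<comment> \<open>Modulo the point, r equals the nonzero constant \<rho> r, so a larger ideal
        contains a unit.\<close>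
      have "r - \<iota> (\<rho> r) \<in> J" using J(2) pt_iff by blast
      then have "- (r - \<iota> (\<rho> r)) \<in> J"
        using additive_subgroup.a_inv_closed[OF J.additive_subgroup_axioms]
        by (simp add: ring_of_type_algebra_a_inv del: minus_diff_eq)
      from additive_subgroup.a_closed[OF J.additive_subgroup_axioms r(1) this]
      have "r + - (r - \<iota> (\<rho> r)) \<in> J" by (simp only: ring_of_type_algebra_simps)
      then have "\<iota> (\<rho> r) \<in> J" by simp
      then have "\<iota> (inverse (\<rho> r)) * \<iota> (\<rho> r) \<in> J"
        using J.I_l_closed[of "\<iota> (\<rho> r)" "\<iota> (inverse (\<rho> r))"] by simp
      moreover have "\<iota> (inverse (\<rho> r)) * \<iota> (\<rho> r) = 1"
        using r(2) by (simp flip: \<iota>.hom_mult)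
      ultimately show ?thesis using J.one_imp_carrier by simp
    qed (use J(2) in blast)
  qed
qed

lemma pt_rational: "pt \<in> rational_points \<iota>"
  using pt_maximal pt_iff by (auto simp: rational_points_def)

abbreviation g0 where "g0 \<equiv> reduce_poly \<iota> pt f"

text \<open>\<phi> is known to be additive and multiplicative on A only, so membership of the
  coefficients in A is carried through the induction.\<close>

lemma map_\<phi>_prod:
  assumes "finite S" "S \<subseteq> A"
  shows "(\<forall>i. coeff (\<Prod>r\<in>S. [:- r, 1:]) i \<in> A) \<and> map_poly \<phi> (\<Prod>r\<in>S. [:- r, 1:]) = (\<Prod>r\<in>S. [:- \<phi> r, 1:])"
  using assms
proof (induction S)
  case empty
  then show ?case using A_0 A_1 \<phi>_1 by (simp add: map_poly_1' coeff_1 )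
next
  case (insert r S)
  let ?P = "\<Prod>r\<in>S. [:- r, 1:]" and ?Q = "\<Prod>r\<in>S. [:- \<phi> r, 1:]"
  have rA: "r \<in> A" and IH: "\<And>i. coeff ?P i \<in> A" "map_poly \<phi> ?P = ?Q" using insert by auto
  have c: "coeff ([:- a, 1:] * p) i = (case i of 0 \<Rightarrow> 0 | Suc k \<Rightarrow> coeff p k) + - a * coeff p i"
    for a and p :: "'c::comm_ring_1 poly" and i
    by (simp add: coeff_pCons split: nat.split)
  have cA: "(case i of 0 \<Rightarrow> 0 | Suc k \<Rightarrow> coeff ?P k) \<in> A" for i
    using IH(1) A_0 by (simp split: nat.split)
  have mA: "- r * coeff ?P i \<in> A" for i by (intro A_mult A_uminus rA IH)
  have "coeff ([:- r, 1:] * ?P) i \<in> A" for i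
    unfolding c by (rule A_add[OF cA mA])
  moreover have "map_poly \<phi> ([:- r, 1:] * ?P) = [:- \<phi> r, 1:] * ?Q"
  proof (rule poly_eqI)
    fix i
    have Q: "coeff ?Q i = \<phi> (coeff ?P i)" for i unfolding IH(2)[symmetric] by (simp add: coeff_map_poly \<phi>_0)
    have "coeff (map_poly \<phi> ([:- r, 1:] * ?P)) i
        = \<phi> ((case i of 0 \<Rightarrow> 0 | Suc k \<Rightarrow> coeff ?P k) + - r * coeff ?P i)"
      unfolding coeff_map_poly[of \<phi>, OF \<phi>_0] c ..
    also have "\<dots> = \<phi> (case i of 0 \<Rightarrow> 0 | Suc k \<Rightarrow> coeff ?P k) + \<phi> (- r * coeff ?P i)"
      by (rule \<phi>_add[OF cA mA])
    also have "\<dots> = (case i of 0 \<Rightarrow> 0 | Suc k \<Rightarrow> coeff ?Q k) + - \<phi> r * coeff ?Q i"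
      using \<phi>_mult[OF A_uminus[OF rA] IH(1)] \<phi>_uminus[OF rA]
      by (cases i) (simp_all only: nat.case \<phi>_0 Q)
    finally show "coeff (map_poly \<phi> ([:- r, 1:] * ?P)) i = coeff ([:- \<phi> r, 1:] * ?Q) i"
      unfolding c .
  qed
  ultimately show ?case by (simp only: prod.insert[OF insert.hyps]) blast
qed

lemma map_g0: "map_poly to_ac g0 = (\<Prod>s\<in>\<phi> ` Rt. [:- s, 1:])"
proof -
  interpret r: comm_ring_hom \<rho> by (rule \<rho>_hom)
  have "residue \<iota> pt = \<rho>" by (rule ext) (rule residue_pt)
  then have "map_poly to_ac g0 = map_poly \<phi> (map_poly to_geom f)"
    by (intro poly_eqI) (simp add: reduce_poly_def coeff_map_poly \<rho> \<phi>_0)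
  also have "\<dots> = (\<Prod>r\<in>Rt. [:- \<phi> r, 1:])"
    unfolding roots_split using map_\<phi>_prod[OF finite_roots roots_A] by blast
  also have "\<dots> = (\<Prod>s\<in>\<phi> ` Rt. [:- s, 1:])"
    using prod.reindex[OF inj, of "\<lambda>s. [:- s, 1:]"] by (simp add: o_def)
  finally show ?thesis .
qed

lemma finite_\<phi>_roots: "finite (\<phi> ` Rt)"
  using finite_roots by simp

lemma separable_g0: "separable g0"
  unfolding separable_def map_g0 by (rule rsquarefree_prod_linear[OF finite_\<phi>_roots])

lemma g0_root_iff: "poly (map_poly to_ac g0) s = 0 \<longleftrightarrow> s \<in> \<phi> ` Rt"
  unfolding map_g0 poly_prod using finite_\<phi>_roots by (simp add: prod_zero_iff)

lemma \<phi>_roots_sep: "\<phi> ` Rt \<subseteq> ac.sep"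
  unfolding ac.sep_def using separable_g0 g0_root_iff unfolding separable_def by blast

section \<open>Galois action on the roots of the reduction\<close>

lemma \<theta>_roots: "g \<in> carrier GK \<Longrightarrow> r \<in> Rt \<Longrightarrow> \<theta> g r \<in> Rt"
proof -
  assume g: "g \<in> carrier GK" and r: "r \<in> Rt"
  obtain \<gamma> where \<gamma>: "\<gamma> \<in> H" "\<forall>z\<in>F. \<gamma> z = \<theta> g z" using H_lift[OF g] by blast
  have "r \<in> F" using r unfolding F_eq by (rule alg_gen.gen)
  then have "\<theta> g r = \<gamma> r" using \<gamma>(2) by simp
  then show "\<theta> g r \<in> Rt" using fixing_roots[OF subsetD[OF H_fixing \<gamma>(1)] r] by simp
qed

text \<open>The right-hand side is the set of conjugates of \<phi> r over K. Equivariance gives both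
  inclusions, with \<sigma> obtained from g by \<open>gal_extends\<close> and g from \<sigma> by
  \<open>gal_of\<close>.\<close>

lemma orbit_conj:
  assumes r: "r \<in> Rt"
  shows "\<phi> ` orbit GK \<theta> r = (\<lambda>\<sigma>. \<sigma> (\<phi> r)) ` fixing (range to_ac)"
proof (intro equalityI subsetI)
  fix s assume "s \<in> \<phi> ` orbit GK \<theta> r"
  then obtain g where g: "g \<in> carrier GK" "s = \<phi> (\<theta> g r)" by (auto simp: orbit_def)
  obtain \<sigma> where \<sigma>: "\<sigma> \<in> fixing (range to_ac)" "\<forall>v\<in>ac.sep. g (j v) = j (\<sigma> v)" using gal_extends[OF g(1)] by blast
  have "s = \<sigma> (\<phi> r)" unfolding g(2) using \<sigma>(2) by (intro equivariant[OF g(1) \<sigma>(1) _ r]) blast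
  then show "s \<in> (\<lambda>\<sigma>. \<sigma> (\<phi> r)) ` fixing (range to_ac)" using \<sigma>(1) by blast
next
  fix s assume "s \<in> (\<lambda>\<sigma>. \<sigma> (\<phi> r)) ` fixing (range to_ac)"
  then obtain \<sigma> where \<sigma>: "\<sigma> \<in> fixing (range to_ac)" "s = \<sigma> (\<phi> r)" by blast
  obtain g where g: "g \<in> carrier GK" "\<forall>v\<in>ac.sep. g (j v) = j (\<sigma> v)" using gal_of[OF \<sigma>(1)] by blast
  have "s = \<phi> (\<theta> g r)" unfolding \<sigma>(2) using g(2) by (intro equivariant[OF g(1) \<sigma>(1) _ r, symmetric]) blast
  then show "s \<in> \<phi> ` orbit GK \<theta> r" using g(1) by (auto simp: orbit_def)
qed

lemma orbit_roots: "r \<in> Rt \<Longrightarrow> orbit GK \<theta> r \<subseteq> Rt"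
  using \<theta>_roots by (auto simp: orbit_def)

text \<open>The coefficients are fixed by all automorphisms and also separable, since the roots of
  the reduction are; together this places them in K.\<close>

lemma orbit_poly:
  assumes r: "r \<in> Rt"
  obtains q where "map_poly to_ac q = (\<Prod>s\<in>\<phi> ` orbit GK \<theta> r. [:- s, 1:])"
proof -
  let ?S = "\<phi> ` orbit GK \<theta> r"
  let ?P = "\<Prod>s\<in>?S. [:- s, 1:]"
  have sub: "?S \<subseteq> \<phi> ` Rt" using orbit_roots[OF r] by blast
  have fin: "finite ?S" using sub finite_\<phi>_roots by (rule finite_subset)
  have cP: "coeff ?P i \<in> range to_ac" for i
  proof (rule ac.sep_fixed_mem[OF ac.subalg_range])
    show "coeff ?P i \<in> ac.sep"
      by (rule coeff_prod_linear_mem[OF _ ac.subalg_sep]) (unfold_locales, use sub \<phi>_roots_sep in blast)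
    fix \<psi> :: "'k alg_closure \<Rightarrow> 'k alg_closure" assume \<psi>: "\<psi> \<in> fixing (range to_ac)"
    interpret f: field_hom \<psi> using \<psi> by (rule fixing_hom)
    have "\<psi> ` ?S \<subseteq> ?S" unfolding orbit_conj[OF r] using fixing_comp[OF \<psi>] by auto
    then have "map_poly \<psi> ?P = ?P" by (rule map_poly_prod_linear_stable[OF f.field_hom_axioms fin])
    then show "\<psi> (coeff ?P i) = coeff ?P i" by (metis f.coeff_map_poly_hom)
  qed
  have "map_poly to_ac (map_poly of_ac ?P) = ?P"
    by (intro poly_eqI) (simp add: coeff_map_poly to_ac_of_ac[OF cP])
  then show thesis by (rule that)
qed

lemma stable_roots:
  assumes "poly (map_poly to_ac p) (\<phi> r) = 0" and r: "r \<in> Rt" and z: "z \<in> orbit GK \<theta> r"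
  shows "poly (map_poly to_ac p) (\<phi> z) = 0"
proof -
  have "\<phi> z \<in> (\<lambda>\<sigma>. \<sigma> (\<phi> r)) ` fixing (range to_ac)" using z orbit_conj[OF r] by blast
  then obtain \<sigma> where \<sigma>: "\<sigma> \<in> fixing (range to_ac)" "\<phi> z = \<sigma> (\<phi> r)" by blast
  then show ?thesis using ac.fixing_root[OF \<sigma>(1) assms(1)] by simp
qed

lemma orbit_refl: "r \<in> Rt \<Longrightarrow> r \<in> orbit GK \<theta> r"
proof -
  assume r: "r \<in> Rt"
  then have "r \<in> F" unfolding F_eq by (rule alg_gen.gen)
  then have "\<theta> (restrict (\<lambda>z. z) Ks) r = r" by (rule \<theta>_one)
  then show ?thesis using GK_one by (auto simp: orbit_def) metis
qed

section \<open>Irreducible factors and orbits\<close>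

definition Irr :: "'k poly set" where "Irr = {p. irreducible p \<and> lead_coeff p = 1 \<and> p dvd g0}"

text \<open>The bijection between irreducible factors and orbits, see \<open>\<Psi>_image\<close>
  and \<open>\<Psi>_inj\<close>.\<close>

definition \<Psi> :: "'k poly \<Rightarrow> 'r geom set" where "\<Psi> p = {r \<in> Rt. poly (map_poly to_ac p) (\<phi> r) = 0}"

lemma to_ac_dvd: "map_poly to_ac p dvd map_poly to_ac q \<longleftrightarrow> p dvd q" for p q :: "'k poly"
proof -
  interpret m: map_poly_inj_idom_divide_hom "to_ac :: 'k \<Rightarrow> 'k alg_closure" ..
  show ?thesis by (rule m.hom_dvd_iff)
qed

lemma map_to_ac_inj: "map_poly to_ac p = map_poly to_ac q \<Longrightarrow> p = q" for p q :: "'k poly"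
  by (auto simp: poly_eq_iff coeff_map_poly)

lemma monic_divisor_split:
  assumes p: "p dvd g0" "lead_coeff p = 1"
  shows "map_poly to_ac p = (\<Prod>s\<in>\<phi> ` \<Psi> p. [:- s, 1:])" "degree p = card (\<Psi> p)"
proof -
  let ?p = "map_poly to_ac p"
  have dvd: "?p dvd map_poly to_ac g0" using p(1) by (simp add: to_ac_dvd)
  have sq: "rsquarefree (map_poly to_ac g0)" using separable_g0 by (simp add: separable_def)
  then have g0: "map_poly to_ac g0 \<noteq> 0" by (simp add: rsquarefree_def)
  have deg: "degree ?p = degree p" by simp
  have lead: "lead_coeff ?p = 1" using p(2) by (simp add: coeff_map_poly)
  then have "?p \<noteq> 0" by auto
  have "order a ?p \<le> order a (map_poly to_ac g0)" for a
    using dvd g0 by (metis dvd_trans order_1 order_divides)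
  moreover have "order a (map_poly to_ac g0) \<le> 1" for a
    using sq unfolding rsquarefree_def by (metis le_numeral_extra(3,4) zero_le)
  ultimately have "order a ?p \<le> 1" for a by (rule order_trans)
  then have "rsquarefree ?p" using \<open>?p \<noteq> 0\<close> unfolding rsquarefree_def by (metis One_nat_def le_0_eq le_Suc_eq)
  then have split: "?p = (\<Prod>s\<in>{s. poly ?p s = 0}. [:- s, 1:])" using lead by (rule rsquarefree_split)
  have roots: "{s. poly ?p s = 0} = \<phi> ` \<Psi> p"
  proof (intro equalityI subsetI)
    fix s assume s: "s \<in> {s. poly ?p s = 0}"
    then have "poly (map_poly to_ac g0) s = 0" using dvd by (auto elim!: dvdE simp: poly_mult)
    then have "s \<in> \<phi> ` Rt" by (simp only: g0_root_iff)
    then show "s \<in> \<phi> ` \<Psi> p" using s by (auto simp: \<Psi>_def)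
  qed (auto simp: \<Psi>_def)
  show eq: "?p = (\<Prod>s\<in>\<phi> ` \<Psi> p. [:- s, 1:])" using split unfolding roots .
  have "degree p = card (\<phi> ` \<Psi> p)" using arg_cong[OF eq, of degree] by (simp add: degree_prod_linear)
  also have "\<dots> = card (\<Psi> p)" using inj by (intro card_image) (auto simp: \<Psi>_def intro: inj_on_subset)
  finally show "degree p = card (\<Psi> p)" .
qed

text \<open>A factor that vanishes at \<phi> r vanishes at all its conjugates and thus has full
  degree, so the cofactor is a unit.\<close>

lemma orbit_poly_Irr:
  assumes r: "r \<in> Rt" and q: "map_poly to_ac q = (\<Prod>s\<in>\<phi> ` orbit GK \<theta> r. [:- s, 1:])"
  shows "q \<in> Irr" "\<Psi> q = orbit GK \<theta> r"
proof -
  let ?O = "orbit GK \<theta> r"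
  have fin: "finite (\<phi> ` ?O)" using finite_\<phi>_roots orbit_roots[OF r] by (meson finite_subset image_mono)
  have root: "poly (map_poly to_ac q) s = 0 \<longleftrightarrow> s \<in> \<phi> ` ?O" for s
    unfolding q poly_prod using fin by (simp add: prod_zero_iff)
  have deg: "degree q = card (\<phi> ` ?O)"
    using arg_cong[OF q, of degree] by (simp add: degree_prod_linear)
  have lead: "lead_coeff q = 1"
    using arg_cong[OF q, of lead_coeff] by (simp add: degree_prod_linear(2) coeff_map_poly)
  have "map_poly to_ac q dvd map_poly to_ac g0"
    unfolding q map_g0 by (rule prod_dvd_prod_subset[OF finite_\<phi>_roots]) (use orbit_roots[OF r] in blast)
  then have dvd: "q dvd g0" by (simp only: to_ac_dvd)
  have "q \<noteq> 0" using lead by auto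
  have unit: "b dvd 1" if ab: "q = a * b" "poly (map_poly to_ac a) (\<phi> r) = 0" for a b
  proof -
    have nz: "a \<noteq> 0" "b \<noteq> 0" using ab(1) \<open>q \<noteq> 0\<close> by auto
    have "\<phi> ` ?O \<subseteq> {s. poly (map_poly to_ac a) s = 0}" using stable_roots[OF ab(2) r] by auto
    moreover have nza: "map_poly to_ac a \<noteq> 0" using nz(1) by (simp add: map_poly_eq_0_iff)
    ultimately have "card (\<phi> ` ?O) \<le> card {s. poly (map_poly to_ac a) s = 0}"
      by (intro card_mono poly_roots_finite)
    also have "\<dots> \<le> degree (map_poly to_ac a)" using nza by (rule card_poly_roots_bound)
    also have "\<dots> = degree a" by simp
    finally have "degree q \<le> degree a" using deg by simp
    moreover have "degree q = degree a + degree b" unfolding ab(1) using nz by (rule degree_mult_eq)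
    ultimately show ?thesis using nz(2) by (simp add: is_unit_iff_degree)
  qed
  have "irreducible q"
  proof (rule irreducibleI)
    show "q \<noteq> 0" by fact
    have "card (\<phi> ` ?O) \<noteq> 0" using fin orbit_refl[OF r] by auto
    then show "\<not> q dvd 1" using deg \<open>q \<noteq> 0\<close> by (simp add: is_unit_iff_degree)
    fix a b assume ab: "q = a * b"
    interpret m: map_poly_inj_idom_hom "to_ac :: 'k \<Rightarrow> 'k alg_closure" ..
    have "poly (map_poly to_ac q) (\<phi> r) = 0" using root orbit_refl[OF r] by blast
    then have "poly (map_poly to_ac a) (\<phi> r) = 0 \<or> poly (map_poly to_ac b) (\<phi> r) = 0"
      unfolding ab m.hom_mult by simp
    then show "a dvd 1 \<or> b dvd 1" using unit[of a b] unit[of b a] ab by (auto simp: mult.commute)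
  qed
  then show "q \<in> Irr" using lead dvd by (simp add: Irr_def)
  show "\<Psi> q = ?O"
  proof (intro equalityI subsetI)
    fix z assume "z \<in> \<Psi> q"
    then have z: "z \<in> Rt" "\<phi> z \<in> \<phi> ` ?O" using root by (auto simp: \<Psi>_def)
    then show "z \<in> ?O" using inj orbit_roots[OF r] by (metis (no_types, lifting) imageE inj_onD subsetD)
  qed (use root orbit_roots[OF r] in \<open>auto simp: \<Psi>_def\<close>)
qed

text \<open>The orbit polynomial of one root divides p, because p vanishes on the whole orbit; p
  being irreducible and both monic, they coincide.\<close>

lemma Irr_orbit:
  assumes p: "p \<in> Irr"
  shows "\<Psi> p \<in> orbits GK Rt \<theta>"
proof -
  have irr: "irreducible p" "lead_coeff p = 1" "p dvd g0" using p by (auto simp: Irr_def)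
  note split = monic_divisor_split[OF irr(3,2)]
  have "p \<noteq> 0" using irr(2) by auto
  have "degree p \<noteq> 0" using irr(1) \<open>p \<noteq> 0\<close> by (metis irreducible_not_unit is_unit_iff_degree)
  then have "\<Psi> p \<noteq> {}" using split(2) by auto
  then obtain r where r: "r \<in> Rt" "poly (map_poly to_ac p) (\<phi> r) = 0" by (auto simp: \<Psi>_def)
  obtain q where q: "map_poly to_ac q = (\<Prod>s\<in>\<phi> ` orbit GK \<theta> r. [:- s, 1:])" using orbit_poly[OF r(1)] by blast
  have qI: "q \<in> Irr" by (rule orbit_poly_Irr(1)[OF r(1) q])
  have "orbit GK \<theta> r \<subseteq> \<Psi> p"
    using stable_roots[OF r(2,1)] orbit_roots[OF r(1)] by (auto simp: \<Psi>_def)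
  then have "map_poly to_ac q dvd map_poly to_ac p"
    unfolding q split(1) using finite_\<phi>_roots
    by (intro prod_dvd_prod_subset) (auto simp: \<Psi>_def elim: finite_subset[rotated])
  then have "q dvd p" by (simp only: to_ac_dvd)
  then obtain c where c: "p = q * c" by (rule dvdE)
  have "\<not> q dvd 1" using qI by (auto simp: Irr_def irreducible_def)
  then have "c dvd 1" using irreducibleD[OF irr(1) c] by blast
  then obtain c0 where "c = [:c0:]" using is_unit_poly_iff by blast
  moreover have "lead_coeff p = lead_coeff q * lead_coeff c" unfolding c by (rule lead_coeff_mult)
  ultimately have "c = 1" using irr(2) qI by (auto simp: Irr_def one_pCons)
  then have "\<Psi> p = orbit GK \<theta> r" using orbit_poly_Irr(2)[OF r(1) q] c by simp
  then show ?thesis using r(1) by (auto simp: orbits_def)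
qed

lemma \<Psi>_image: "\<Psi> ` Irr = orbits GK Rt \<theta>"
proof (intro equalityI subsetI)
  fix Q assume "Q \<in> orbits GK Rt \<theta>"
  then obtain r where r: "r \<in> Rt" "Q = orbit GK \<theta> r" by (auto simp: orbits_def)
  obtain q where q: "map_poly to_ac q = (\<Prod>s\<in>\<phi> ` orbit GK \<theta> r. [:- s, 1:])" using orbit_poly[OF r(1)] by blast
  show "Q \<in> \<Psi> ` Irr"
    unfolding r(2) using orbit_poly_Irr[OF r(1) q] by (intro image_eqI[of _ _ q]) auto
qed (use Irr_orbit in blast)

lemma \<Psi>_inj: "inj_on \<Psi> Irr"
proof (rule inj_onI)
  fix p q assume pq: "p \<in> Irr" "q \<in> Irr" "\<Psi> p = \<Psi> q"
  then have "map_poly to_ac p = map_poly to_ac q"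
    using monic_divisor_split(1)[of p] monic_divisor_split(1)[of q] by (simp add: Irr_def)
  then show "p = q" by (rule map_to_ac_inj)
qed

theorem factorization_type_g0: "factorization_type g0 = orbit_type \<iota> f \<theta>"
proof -
  have "factorization_type g0 = image_mset degree (mset_set Irr)"
    by (simp add: factorization_type_def Irr_def)
  also have "\<dots> = image_mset (\<lambda>p. card (\<Psi> p)) (mset_set Irr)"
  \<comment> \<open>\<open>mset_set\<close> of an infinite set is empty, so both sides agree in that
    case too.\<close>
  proof (cases "finite Irr")
    case True
    then show ?thesis using monic_divisor_split(2) by (intro image_mset_cong) (auto simp: Irr_def)
  qed simp
  also have "\<dots> = image_mset card (image_mset \<Psi> (mset_set Irr))" by (simp add: image_mset.compositionality o_def)
  also have "image_mset \<Psi> (mset_set Irr) = mset_set (orbits GK Rt \<theta>)"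
    using image_mset_mset_set[OF \<Psi>_inj] \<Psi>_image by simp
  finally show ?thesis by (simp add: orbit_type_def)
qed

end

section \<open>Rational points of the twisted cover\<close>

lemma mpoly_eval_cong:
  assumes "p \<in> mpolys n" "\<And>i. i < n \<Longrightarrow> a i = b i"
  shows "mpoly_eval h a p = mpoly_eval h b p"
  unfolding mpoly_eval_def
proof (intro sum.cong refl arg_cong2[where f = "(*)"] prod.cong)
  fix m i assume "m \<in> keys p" "i \<in> keys m"
  then have "i < n" using assms(1) by (auto simp: carrier_mpoly_ring)
  then show "a i ^ lookup m i = b i ^ lookup m i" using assms(2) by simp
qed

lemma mpoly_ring_mono: "n \<le> m \<Longrightarrow> p \<in> mpolys n \<Longrightarrow> p \<in> mpolys m"
  by (fastforce simp: carrier_mpoly_ring)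

context geom_solution
begin

text \<open>Over ordered pairs this is the discriminant of f up to sign; automorphisms permute the
  factors, so it is fixed by H. A nonzero value at the point keeps the roots distinct.\<close>

definition disc :: "'r geom" where
  "disc = (\<Prod>(r, s)\<in>{(r, s). r \<in> Rt \<and> s \<in> Rt \<and> r \<noteq> s}. r - s)"

lemma finite_pairs: "finite {(r, s). r \<in> Rt \<and> s \<in> Rt \<and> r \<noteq> s}"
  by (rule finite_subset[of _ "Rt \<times> Rt"]) (auto intro: finite_roots)

lemma disc_nz: "disc \<noteq> 0"
  unfolding disc_def using finite_pairs by (auto simp: prod_zero_iff)

lemma disc_D: "disc \<in> D"
proof -
  let ?P = "{(r, s). r \<in> Rt \<and> s \<in> Rt \<and> r \<noteq> s}"
  have RZ: "r \<in> Z" if "r \<in> Rt" for r unfolding Z_def using that by (intro alg_gen.gen) blast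
  have "disc \<in> Z"
    unfolding disc_def
  proof (rule ac.subalg_prod[OF subalg_Z])
    fix p assume "p \<in> ?P"
    then show "(case p of (r, s) \<Rightarrow> r - s) \<in> Z" using RZ ac.subalg_diff[OF subalg_Z] by auto
  qed
  moreover have "\<gamma> disc = disc" if \<gamma>: "\<gamma> \<in> H" for \<gamma>
  proof -
    have \<gamma>E: "\<gamma> \<in> fixing E" using \<gamma> H_fixing by blast
    interpret g: field_hom \<gamma> using \<gamma>E by (rule fixing_hom)
    have inj: "inj_on (map_prod \<gamma> \<gamma>) ?P" by (rule inj_onI) auto
    have "map_prod \<gamma> \<gamma> ` ?P \<subseteq> ?P" using fixing_roots[OF \<gamma>E] by auto
    then have im: "map_prod \<gamma> \<gamma> ` ?P = ?P" using finite_pairs inj by (intro endo_inj_surj)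
    have "\<gamma> disc = (\<Prod>p\<in>?P. \<gamma> (case p of (r, s) \<Rightarrow> r - s))"
      unfolding disc_def by (rule g.hom_prod)
    also have "\<dots> = (\<Prod>p\<in>?P. (\<lambda>(r, s). r - s) (map_prod \<gamma> \<gamma> p))"
      by (intro prod.cong refl) (auto simp: g.hom_minus)
    also have "\<dots> = (\<Prod>p\<in>map_prod \<gamma> \<gamma> ` ?P. (\<lambda>(r, s). r - s) p)"
      unfolding prod.reindex[OF inj] by (simp only: o_def)
    finally show ?thesis unfolding im disc_def .
  qed
  ultimately show ?thesis by (simp add: D_def)
qed

theorem specialization_exists:
  assumes PAC: "PAC TYPE('k)" and h: "h \<noteq> 0"
  obtains \<phi> A where "specialization \<iota> n x f \<theta> \<phi> A" "\<phi> (to_geom h) \<noteq> 0"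
proof -
  have "\<forall>r\<in>Rt. \<exists>xs. set xs \<subseteq> ac.sep \<times> D \<and> r = lincomb xs" using roots_rep by blast
  then obtain xs where xs: "\<And>r. r \<in> Rt \<Longrightarrow> set (xs r) \<subseteq> ac.sep \<times> D"
    "\<And>r. r \<in> Rt \<Longrightarrow> r = lincomb (xs r)" by metis
  have "finite (\<Union>r\<in>Rt. snd ` set (xs r))" using finite_roots by blast
  from finite_list[OF this] obtain ys where ys: "set ys = (\<Union>r\<in>Rt. snd ` set (xs r))" by (elim exE)
  have ysD: "set ys \<subseteq> D"
  proof
    fix d assume "d \<in> set ys"
    then obtain r v where "r \<in> Rt" "(v, d) \<in> set (xs r)" unfolding ys by auto
    then show "d \<in> D" using xs(1)[of r] by blast
  qed
  \<comment> \<open>Adjoining the inverse of \<open>hh\<close> keeps both factors nonzero at the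
    point: h selects the open set, and \<open>disc\<close> gives separability.\<close>
  define hh where "hh = to_geom h * disc"
  have hh_nz: "hh \<noteq> 0" using h disc_nz by (simp add: hh_def)
  have RD: "to_geom r \<in> D" for r
    using subalg_base[OF subalg_D] by (simp add: to_geom_def)
  have hhD: "hh \<in> D" unfolding hh_def by (rule subalg_mult[OF subalg_D RD disc_D])
  define N where "N = n + length ys + 1"
  \<comment> \<open>Coordinates of V, then the elements of D occurring in the roots, then one last
    slot for the inverse of \<open>hh\<close>: the +1 in \<open>N\<close>.\<close>
  define y where "y i = (if i < n then xa i else if i < n + length ys then ys ! (i - n) else inverse hh)" for i
  have yD: "y i \<in> D" for i
  proof -
    have "inverse hh \<in> D" by (rule ac.subalg_inverse[OF subalg_D hhD])
    then show ?thesis using ysD RD by (auto simp: y_def xa_def)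
  qed
  let ?I = "relation_ideal \<kappa> N y"
  have I: "?I \<subseteq> mpolys N" by (auto simp: relation_ideal_def)
  have ker: "base_change N ?I = {p \<in> mpolys N. mpoly_eval j y p = 0}"
    by (rule kernel_eq_base_change[OF j j_ac[symmetric] subalg_\<kappa>_D lin_disjoint_D yD])
  have jr: "comm_ring_hom j" by unfold_locales
  \<comment> \<open>The base-changed ideal is the kernel of an evaluation in a field, hence
    prime.\<close>
  have "absolutely_irreducible N ?I"
    unfolding absolutely_irreducible_def ker by (rule primeideal_kernel[OF jr])
  moreover have "ideal ?I (mpoly_ring N)"
    by (rule ideal_relation_ideal) unfold_locales
  ultimately obtain a where a: "\<And>p. p \<in> ?I \<Longrightarrow> mpoly_eval id a p = 0"
    using PAC unfolding PAC_def by blast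
  define ev where "ev = mpoly_eval j y"
  define pe where "pe = mpoly_eval (\<lambda>c. c :: 'k alg_closure) (\<lambda>i. to_ac (a i))"
  interpret ev: comm_ring_hom ev unfolding ev_def by (rule mpoly_eval_hom[OF jr])
  interpret pe: comm_ring_hom pe unfolding pe_def by (rule mpoly_eval_hom) (standard, auto)
  have to_ac_r: "comm_ring_hom (to_ac :: 'k \<Rightarrow> 'k alg_closure)" by unfold_locales
  have pe_map: "pe (mapc to_ac p) = to_ac (mpoly_eval id a p)" for p
    unfolding pe_def by (simp add: mpoly_eval_map mpoly_eval_comp[OF to_ac_r])
  \<comment> \<open>The K-point kills the relations over K and therefore their base change, which is
    the full kernel of \<open>ev\<close>.\<close>
  have pe0: "pe q = 0" if q: "q \<in> mpolys N" "ev q = 0" for q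
    unfolding pe_def
  proof (rule base_change_zero[OF _ _ _ I, where h = to_ac])
    show "additive_map (\<lambda>c. c :: 'k alg_closure)" "additive_map (to_ac :: 'k \<Rightarrow> 'k alg_closure)"
      by (simp_all add: additive_map_def)
    fix g assume "g \<in> ?I"
    then have "to_ac (mpoly_eval id a g) = 0" using a by simp
    then show "mpoly_eval to_ac (\<lambda>i. to_ac (a i)) g = 0"
      by (simp add: mpoly_eval_comp[OF to_ac_r])
  qed (use q ker in \<open>auto simp: ev_def\<close>)
  let ?C = "mpolys N :: 'k alg_closure mpoly set"
  \<comment> \<open>On \<open>A\<close> any preimage under \<open>ev\<close> gives the same value,
    by \<open>pe0\<close>; outside \<open>A\<close> the value is arbitrary.\<close>
  define \<phi> where "\<phi> z = pe (SOME q. q \<in> ?C \<and> ev q = z)" for z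
  define A where "A = ev ` ?C"
  have \<phi>_ev: "\<phi> (ev q) = pe q" if q: "q \<in> ?C" for q
  proof -
    define q' where "q' = (SOME q'. q' \<in> ?C \<and> ev q' = ev q)"
    have q': "q' \<in> ?C \<and> ev q' = ev q" unfolding q'_def by (rule someI[of _ q]) (use q in simp)
    have "q' + - q \<in> ?C" using q q' by (intro mpoly_ring_add mpoly_ring_uminus) auto
    moreover have "ev (q' + - q) = 0" using q' by (simp add: ev.hom_minus)
    ultimately have "pe (q' + - q) = 0" by (rule pe0)
    then show ?thesis by (simp add: \<phi>_def q'_def[symmetric] pe.hom_minus)
  qed
  have A_j: "j v \<in> A" and \<phi>_j: "\<phi> (j v) = v" for v
  proof -
    have c: "single 0 v \<in> ?C" by (rule mpoly_ring_single) simp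
    have "ev (single 0 v) = j v" by (simp add: ev_def mpoly_eval_single)
    moreover have "pe (single 0 v) = v" by (simp add: pe_def mpoly_eval_single)
    ultimately show "j v \<in> A" "\<phi> (j v) = v" using \<phi>_ev[OF c] c unfolding A_def by (metis imageI)+
  qed
  have A_add: "u + w \<in> A" and A_mult: "u * w \<in> A" and \<phi>_add: "\<phi> (u + w) = \<phi> u + \<phi> w"
    and \<phi>_mult: "\<phi> (u * w) = \<phi> u * \<phi> w" if uw: "u \<in> A" "w \<in> A" for u w
  proof -
    obtain p q where pq: "p \<in> ?C" "u = ev p" "q \<in> ?C" "w = ev q" using uw unfolding A_def by blast
    have c: "p + q \<in> ?C" "p * q \<in> ?C" using pq mpoly_ring_add mpoly_ring_mult by blast+
    show "u + w \<in> A" "u * w \<in> A"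
      unfolding A_def pq ev.hom_add[symmetric] ev.hom_mult[symmetric] using c by blast+
    show "\<phi> (u + w) = \<phi> u + \<phi> w"
      unfolding pq(2,4) ev.hom_add[symmetric] \<phi>_ev[OF c(1)] \<phi>_ev[OF pq(1)] \<phi>_ev[OF pq(3)] by (rule pe.hom_add)
    show "\<phi> (u * w) = \<phi> u * \<phi> w"
      unfolding pq(2,4) ev.hom_mult[symmetric] \<phi>_ev[OF c(2)] \<phi>_ev[OF pq(1)] \<phi>_ev[OF pq(3)] by (rule pe.hom_mult)
  qed
  have A_y: "y i \<in> A" and \<phi>_y: "\<phi> (y i) = to_ac (a i)" if i: "i < N" for i
  proof -
    let ?q = "single (single i 1) 1 :: 'k alg_closure mpoly"
    have c: "?q \<in> ?C" by (rule mpoly_ring_single) (use i in simp)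
    have "ev ?q = y i" by (simp add: ev_def mpoly_eval_single monom_eval_def)
    moreover have "pe ?q = to_ac (a i)" by (simp add: pe_def mpoly_eval_single monom_eval_def)
    ultimately show "y i \<in> A" "\<phi> (y i) = to_ac (a i)" using \<phi>_ev[OF c] c unfolding A_def by (metis imageI)+
  qed
  have A_R: "to_geom r \<in> A" and \<phi>_R: "\<phi> (to_geom r) \<in> range to_ac" for r
  proof -
    obtain p where p: "p \<in> mpolys n" "mpoly_eval \<iota> x p = r" using R_poly by blast
    have c: "mapc to_ac p \<in> ?C"
      by (rule mpoly_ring_map[OF _ mpoly_ring_mono[OF _ p(1)]]) (simp_all add: N_def)
    have "ev (mapc to_ac p) = mpoly_eval \<kappa> y p"
      by (simp add: ev_def mpoly_eval_map j_ac)
    also have "\<dots> = mpoly_eval \<kappa> xa p" by (rule mpoly_eval_cong[OF p(1)]) (simp add: y_def)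
    also have "\<dots> = mpoly_eval j xa (mapc to_ac p)" by (simp add: mpoly_eval_map j_ac)
    also have "\<dots> = to_geom r" using ev_map[OF j j_ac, of p] p(2) by simp
    finally have e: "ev (mapc to_ac p) = to_geom r" .
    show "to_geom r \<in> A" unfolding A_def e[symmetric] using c by (rule imageI)
    show "\<phi> (to_geom r) \<in> range to_ac" unfolding e[symmetric] \<phi>_ev[OF c] pe_map by (rule rangeI)
  qed
  have ys_y: "\<exists>i<N. d = y i" if d: "d \<in> set ys" for d
  proof -
    obtain i where "i < length ys" "d = ys ! i" using d by (auto simp: in_set_conv_nth)
    then show ?thesis by (intro exI[of _ "n + i"]) (auto simp: y_def N_def)
  qed
  have A_0: "0 \<in> A" and \<phi>_0: "\<phi> 0 = 0" using A_j[of 0] \<phi>_j[of 0] by simp_all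
  have lists: "lincomb zs \<in> A \<and> \<phi> (lincomb zs) = (\<Sum>(v, d)\<leftarrow>zs. v * \<phi> d)"
    if "snd ` set zs \<subseteq> set ys" for zs
    using that
  proof (induction zs)
    case Nil
    then show ?case using A_0 \<phi>_0 by simp
  next
    case (Cons z zs)
    obtain v d where z: "z = (v, d)" by (cases z)
    have "d \<in> set ys" using Cons.prems z by simp
    then have d: "d \<in> A" using ys_y A_y by blast
    have IH: "lincomb zs \<in> A" "\<phi> (lincomb zs) = (\<Sum>(v, d)\<leftarrow>zs. v * \<phi> d)"
      using Cons by simp_all
    show ?case
      using A_add[OF A_mult[OF A_j[of v] d] IH(1)] \<phi>_add[OF A_mult[OF A_j[of v] d] IH(1)]
        \<phi>_mult[OF A_j[of v] d] IH(2)
      by (simp only: z list.map prod.case sum_list.Cons \<phi>_j simp_thms)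
  qed
  have xs_ys: "snd ` set (xs r) \<subseteq> set ys" if "r \<in> Rt" for r unfolding ys using that by blast
  have roots_A: "r \<in> A" and \<phi>_root: "\<phi> r = (\<Sum>(v, d)\<leftarrow>xs r. v * \<phi> d)" if r: "r \<in> Rt" for r
    using lists[OF xs_ys[OF r]] xs(2)[OF r, symmetric] by simp_all
  have A_diff: "u - w \<in> A" and \<phi>_diff: "\<phi> (u - w) = \<phi> u - \<phi> w" if uw: "u \<in> A" "w \<in> A" for u w
  proof -
    have m: "j (- 1) * w \<in> A" by (rule A_mult[OF A_j uw(2)])
    have e: "u - w = u + j (- 1) * w" by (simp add: j.hom_uminus)
    show "u - w \<in> A" unfolding e by (rule A_add[OF uw(1) m])
    show "\<phi> (u - w) = \<phi> u - \<phi> w"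
      unfolding e \<phi>_add[OF uw(1) m] \<phi>_mult[OF A_j uw(2)] \<phi>_j by simp
  qed
  have A_prod: "prod u S \<in> A \<and> \<phi> (prod u S) = (\<Prod>i\<in>S. \<phi> (u i))"
    if "finite S" "\<And>i. i \<in> S \<Longrightarrow> u i \<in> A" for u and S :: "('r geom \<times> 'r geom) set"
    using that
  proof (induction S)
    case empty
    then show ?case using A_j[of 1] \<phi>_j[of 1] by simp
  next
    case (insert i S)
    then show ?case using A_mult[of "u i" "prod u S"] \<phi>_mult[of "u i" "prod u S"] by simp
  qed
  let ?P = "{(r, s). r \<in> Rt \<and> s \<in> Rt \<and> r \<noteq> s}"
  have "(case p of (r, s) \<Rightarrow> r - s) \<in> A" if "p \<in> ?P" for p
    using that roots_A A_diff by auto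
  note disc_prod = A_prod[OF finite_pairs this]
  have disc_A: "disc \<in> A" unfolding disc_def by (rule conjunct1[OF disc_prod])
  have \<phi>_disc: "\<phi> disc = (\<Prod>p\<in>?P. \<phi> (case p of (r, s) \<Rightarrow> r - s))"
    unfolding disc_def by (rule conjunct2[OF disc_prod])
  have "inverse hh = y (n + length ys)" by (simp add: y_def)
  then have ihA: "inverse hh \<in> A" using A_y[of "n + length ys"] by (simp add: N_def)
  have hhA: "hh \<in> A" unfolding hh_def by (rule A_mult[OF A_R disc_A])
  \<comment> \<open>The inverse of \<open>hh\<close> also has a value, so the value of
    \<open>hh\<close> is a unit.\<close>
  have "\<phi> hh * \<phi> (inverse hh) = \<phi> (j 1)" using \<phi>_mult[OF hhA ihA] hh_nz by simp
  then have "\<phi> hh \<noteq> 0" unfolding \<phi>_j by auto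
  then have nz: "\<phi> (to_geom h) \<noteq> 0" "\<phi> disc \<noteq> 0"
    unfolding hh_def \<phi>_mult[OF A_R disc_A] by auto
  have inj: "inj_on \<phi> Rt"
  proof (rule inj_onI, rule ccontr)
    fix r s assume rs: "r \<in> Rt" "s \<in> Rt" "\<phi> r = \<phi> s" "r \<noteq> s"
    then have "\<phi> (r - s) = 0" using \<phi>_diff[OF roots_A[OF rs(1)] roots_A[OF rs(2)]] by simp
    then have "\<phi> disc = 0"
      unfolding \<phi>_disc using finite_pairs rs by (intro prod_zero) auto
    then show False using nz(2) by blast
  qed
  have "specialization \<iota> n x f \<theta> \<phi> A"
  proof (unfold_locales)
    show "Rt \<subseteq> A" using roots_A by blast
    fix g \<sigma> z assume g: "g \<in> carrier GK" and \<sigma>: "\<sigma> \<in> fixing (range to_ac)"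
      and gs: "\<And>v. v \<in> ac.sep \<Longrightarrow> g (j v) = j (\<sigma> v)" and z: "z \<in> Rt"
    obtain \<gamma> where \<gamma>: "\<gamma> \<in> H" "\<forall>z\<in>Ks. \<gamma> z = g z" "\<forall>z\<in>F. \<gamma> z = \<theta> g z" using H_lift[OF g] by blast
    interpret g: field_hom \<gamma> using \<gamma>(1) H_fixing fixing_hom by blast
    interpret s: field_hom \<sigma> using \<sigma> by (rule fixing_hom)
    have zF: "z \<in> F" using z unfolding F_eq by (rule alg_gen.gen)
    let ?zs = "map (\<lambda>(v, d). (\<sigma> v, d)) (xs z)"
    \<comment> \<open>The lift \<gamma> in H fixes the elements of D, so it only changes the
      coefficients v into \<sigma> v.\<close>
    have g_list: "\<gamma> (lincomb ws) = (\<Sum>(v, d)\<leftarrow>map (\<lambda>(v, d). (\<sigma> v, d)) ws. j v * d)"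
      if "set ws \<subseteq> ac.sep \<times> D" for ws
      using that
    proof (induction ws)
      case (Cons w ws)
      obtain v d where w: "w = (v, d)" by (cases w)
      have v: "v \<in> ac.sep" and d: "d \<in> D" using Cons.prems w by auto
      have "j v \<in> Ks" using v unfolding Ks_eq by blast
      then have "\<gamma> (j v) = j (\<sigma> v)" using \<gamma>(2) gs[OF v] by simp
      moreover have "\<gamma> d = d" using d \<gamma>(1) by (simp add: D_def)
      ultimately show ?case using Cons
        by (simp only: w list.map prod.case sum_list.Cons g.hom_add g.hom_mult list.set insert_subset simp_thms)
    qed simp
    have "\<theta> g z = \<gamma> z" using \<gamma>(3) zF by simp
    also have "\<dots> = \<gamma> (lincomb (xs z))" by (subst xs(2)[OF z]) (rule refl)
    also have "\<dots> = lincomb ?zs" by (rule g_list[OF xs(1)[OF z]])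
    finally have "\<phi> (\<theta> g z) = \<phi> (lincomb ?zs)" by simp
    also have "\<dots> = (\<Sum>(v, d)\<leftarrow>?zs. v * \<phi> d)"
    proof -
      have "snd ` set ?zs \<subseteq> set ys" using xs_ys[OF z] by force
      then show ?thesis using lists by blast
    qed
    \<comment> \<open>Each \<phi> d is a coordinate of the K-point, so \<sigma> fixes it and can be
      pulled out of the sum.\<close>
    also have "\<dots> = \<sigma> (\<Sum>(v, d)\<leftarrow>xs z. v * \<phi> d)"
    proof -
      have "(\<Sum>(v, d)\<leftarrow>map (\<lambda>(v, d). (\<sigma> v, d)) ws. v * \<phi> d) = \<sigma> (\<Sum>(v, d)\<leftarrow>ws. v * \<phi> d)"
        if "snd ` set ws \<subseteq> set ys" for ws
        using that
      proof (induction ws)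
        case (Cons w ws)
        obtain v d where w: "w = (v, d)" by (cases w)
        have "d \<in> set ys" using Cons.prems w by simp
        then obtain i where "i < N" "d = y i" using ys_y by blast
        then have "\<sigma> (\<phi> d) = \<phi> d" using \<phi>_y fixing_fix[OF \<sigma>] by simp
        then show ?case using Cons by (simp add: w s.hom_add s.hom_mult)
      qed simp
      then show ?thesis using xs_ys[OF z] by blast
    qed
    also have "(\<Sum>(v, d)\<leftarrow>xs z. v * \<phi> d) = \<phi> z" by (rule \<phi>_root[OF z, symmetric])
    finally show "\<phi> (\<theta> g z) = \<sigma> (\<phi> z)" .
  qed (fact A_j A_add A_mult \<phi>_j \<phi>_add \<phi>_mult A_R \<phi>_R inj)+
  then show thesis using nz(1) by (rule that)
qed

end

text \<open>The sets of primes avoiding one element are closed under intersection, by the product h1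
  h2, so these generators of the topology are a basis.\<close>

lemma zariski_nbhd:
  assumes "openin zariski U" "\<pp> \<in> U"
  shows "\<exists>h. h \<notin> \<pp> \<and> {\<qq>. primeideal \<qq> ring_of_type_algebra \<and> h \<notin> \<qq>} \<subseteq> U"
proof -
  let ?B = "{{\<pp>. primeideal \<pp> ring_of_type_algebra \<and> h \<notin> \<pp>} | h :: 'a. True}"
  have gen: "generate_topology_on ?B U"
    using assms(1) unfolding zariski_def by (rule openin_topology_generated_by)
  have "\<pp> \<in> \<Union>?B"
    using openin_subset[OF assms(1)] assms(2) unfolding zariski_def topology_generated_by_topspace by blast
  then have prime: "primeideal \<pp> ring_of_type_algebra" by blast
  show ?thesis
    using gen assms(2)
  proof induction
    case (Int a b)
    then obtain h1 h2 where h: "h1 \<notin> \<pp>" "{\<qq>. primeideal \<qq> ring_of_type_algebra \<and> h1 \<notin> \<qq>} \<subseteq> a"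
      "h2 \<notin> \<pp>" "{\<qq>. primeideal \<qq> ring_of_type_algebra \<and> h2 \<notin> \<qq>} \<subseteq> b" by blast
    have "h1 * h2 \<notin> \<pp>" using primeideal.I_prime[OF prime, of h1 h2] h by auto
    moreover have "h1 \<notin> \<qq>" "h2 \<notin> \<qq>" if q: "primeideal \<qq> ring_of_type_algebra" "h1 * h2 \<notin> \<qq>" for \<qq>
    proof -
      interpret q: primeideal \<qq> ring_of_type_algebra by (rule q(1))
      show "h1 \<notin> \<qq>" "h2 \<notin> \<qq>" using q.I_r_closed[of h1 h2] q.I_l_closed[of h2 h1] q(2) by auto
    qed
    ultimately show ?case using h by (intro exI[of _ "h1 * h2"]) blast
  next
    case (UN K)
    then obtain k where k: "k \<in> K" "\<pp> \<in> k" by blast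
    obtain h where h: "h \<notin> \<pp>" "{\<qq>. primeideal \<qq> ring_of_type_algebra \<and> h \<notin> \<qq>} \<subseteq> k"
      using UN.IH[OF k] by (elim exE conjE)
    have "k \<subseteq> \<Union>K" using k(1) by blast
    then show ?case using h by (intro exI[of _ h] conjI order_trans[OF h(2)])
  next
    case (Basis s)
    then show ?case by blast
  qed simp
qed

theorem theorem2p4:
  fixes \<iota> :: "'k::field \<Rightarrow> 'r::idom"
    and n :: nat and x :: "nat \<Rightarrow> 'r"
    and f :: "'r poly" and P :: "nat multiset"
  assumes "PAC TYPE('k)"
    and "affine_algebra \<iota> n x"
    and "absolutely_irreducible n (relation_ideal \<iota> n x)"
    and "smooth n (relation_ideal \<iota> n x)"
    and "lead_coeff f = 1"
    and "separable (map_poly to_fract f)"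
    and "is_partition P (degree f)"
    and "\<exists>\<theta>. embedding_solution \<iota> f \<theta> \<and> orbit_type \<iota> f \<theta> = P"
  shows "\<exists>S \<subseteq> rational_points \<iota>.
      zariski closure_of S = topspace zariski \<and>
      (\<forall>\<pp>\<in>S. separable (reduce_poly \<iota> \<pp> f) \<and>
               factorization_type (reduce_poly \<iota> \<pp> f) = P)"
proof -
  obtain \<theta> where \<theta>: "embedding_solution \<iota> f \<theta>" "orbit_type \<iota> f \<theta> = P" using assms(8) by blast
  interpret geom_solution \<iota> n x f \<theta>
    by unfold_locales (use assms \<theta> in auto)
  let ?S = "{\<pp> \<in> rational_points \<iota>. separable (reduce_poly \<iota> \<pp> f) \<and> factorization_type (reduce_poly \<iota> \<pp> f) = P}"
  have dense: "\<exists>\<qq>. \<qq> \<in> ?S \<and> \<qq> \<in> U" if U: "openin zariski U" "\<pp> \<in> U" for U \<pp>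
  proof -
    obtain h where h: "h \<notin> \<pp>" "{\<qq>. primeideal \<qq> ring_of_type_algebra \<and> h \<notin> \<qq>} \<subseteq> U"
      using zariski_nbhd[OF U] by blast
    have "\<pp> \<in> topspace zariski" using openin_subset[OF U(1)] U(2) by blast
    then have "primeideal \<pp> ring_of_type_algebra"
      unfolding zariski_def topology_generated_by_topspace by blast
    then have "ideal \<pp> ring_of_type_algebra" by (rule primeideal.axioms(1))
    then have "0 \<in> \<pp>"
      using additive_subgroup.zero_closed[OF ideal.axioms(1)] by fastforce
    \<comment> \<open>A basic open set that contains some prime has h \<noteq> 0, which is all that
      \<open>specialization_exists\<close> asks of h.\<close>
    then have "h \<noteq> 0" using h(1) by auto
    then obtain \<phi> A where sp: "specialization \<iota> n x f \<theta> \<phi> A" and nz: "\<phi> (to_geom h) \<noteq> 0"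
      using specialization_exists[OF assms(1)] by blast
    interpret sp: specialization \<iota> n x f \<theta> \<phi> A by (rule sp)
    have "h \<notin> sp.pt" using nz sp.\<rho>[of h] by (auto simp: sp.pt_def)
    moreover have "primeideal sp.pt ring_of_type_algebra"
      using cring.maximalideal_prime[OF cring_from_type_algebra sp.pt_maximal] .
    ultimately have "sp.pt \<in> U" using h(2) by blast
    then show ?thesis
      using sp.pt_rational sp.separable_g0 sp.factorization_type_g0 \<theta>(2) by blast
  qed
  have "zariski closure_of ?S = topspace zariski"
    using dense by (auto simp: in_closure_of)
  then show ?thesis by (intro exI[of _ ?S]) auto
qed

end
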